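(* For integers $t \ge 1$ and $n \ge 1$ let $a^*_t(n) := \sum_{\lambda \in \mathcal{SC}(n)} n_t(\lambda)$ and $b^*_t(n) := \sum_{\lambda \in \mathcal{DO}(n)} n_t(\lambda)$. Then: (1) For all $t \geq 1$, as $n \to \infty$, $$a_t^*(n) \sim \frac{\sqrt[4]{3}}{2 \pi \sqrt[4]{2}\, n^{1/4}}\, e^{\pi \sqrt{n/6}}.$$ (2) For all $t \geq 1$, there exists a constant $\beta^*_t \in \mathbb{Q}(\log 2)$ such that, as $n \to \infty$, $$b_t^*(n) \sim \beta^*_t \,\frac{\sqrt[4]{3}}{\pi \sqrt[4]{2}\, n^{1/4}}\, e^{\pi \sqrt{n/6}},$$ and $\beta^*_t \in \mathbb{Q}$ if and only if $t \equiv 0 \pmod 3$. (3) For all $t \geq 2$, the constant $\beta^*_t$ of (2) satisfies $\beta^*_t < \frac{1}{2}$.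
   Context: A partition $\lambda$ of $n$ is a non-increasing sequence of positive integers summing to $n$, drawn as a Ferrers–Young diagram of left-justified rows. The hook number of a box is the number of boxes to its right in its row, plus the number of boxes below it in its column, plus one. $n_t(\lambda)$ is the number of boxes of $\lambda$ with hook number exactly $t$. $\mathcal{SC}(n)$ is the set of self-conjugate partitions of $n$ and $\mathcal{DO}(n)$ the set of partitions of $n$ into distinct odd parts. $\mathbb{Q}(\log 2)$ is the field generated over $\mathbb{Q}$ by the natural logarithm of $2$. *)

theory Defs
  imports
    Complex_Main
    "HOL-Library.Landau_Symbols"
    "HOL-Number_Theory.Cong"
    "HOL-Algebra.Generated_Fields"
    "HOL-Algebra.Algebraic_Closure_Type"
begin

definition partitions :: "nat \<Rightarrow> nat list set" where
  "partitions n = {xs. sorted_wrt (\<ge>) xs \<and> (\<forall>x\<in>set xs. 0 < x) \<and> sum_list xs = n}"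

(* Boxes are (row, column) pairs, both counted from 0. *)
definition diagram :: "nat list \<Rightarrow> (nat \<times> nat) set" where
  "diagram xs = {(i, j). i < length xs \<and> j < xs ! i}"

definition hook_number :: "nat list \<Rightarrow> nat \<times> nat \<Rightarrow> nat" where
  "hook_number xs = (\<lambda>(i, j).
     card {j'. j < j' \<and> (i, j') \<in> diagram xs} +
     card {i'. i < i' \<and> (i', j) \<in> diagram xs} + 1)"

definition num_hooks :: "nat \<Rightarrow> nat list \<Rightarrow> nat" where
  "num_hooks t xs = card {b \<in> diagram xs. hook_number xs b = t}"

(* The diagram of the conjugate partition is the transposed diagram, and a partition is
   determined by its diagram. *)
definition SC :: "nat \<Rightarrow> nat list set" where
  "SC n = {xs \<in> partitions n. prod.swap ` diagram xs = diagram xs}"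

definition DO :: "nat \<Rightarrow> nat list set" where
  "DO n = {xs \<in> partitions n. distinct xs \<and> (\<forall>x\<in>set xs. odd x)}"

definition a_star :: "nat \<Rightarrow> nat \<Rightarrow> nat" where
  "a_star t n = (\<Sum>xs\<in>SC n. num_hooks t xs)"

definition b_star :: "nat \<Rightarrow> nat \<Rightarrow> nat" where
  "b_star t n = (\<Sum>xs\<in>DO n. num_hooks t xs)"

definition rat_log2_field :: "real set" where
  "rat_log2_field = generate_field ring_of_type_algebra (insert (ln 2) \<rat>)"

(* The index sets of the sums, and the sets counted by card, are finite, so no sum or
   cardinality above takes the default value 0 for infinite sets. *)
lemma finite_partitions: "finite (partitions n)"
proof (rule finite_subset)
  show "partitions n \<subseteq> {xs. set xs \<subseteq> {..n} \<and> length xs \<le> n}"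
  proof
    fix xs assume "xs \<in> partitions n"
    then have pos: "\<forall>x\<in>set xs. 0 < x" and sum: "sum_list xs = n"
      by (auto simp: partitions_def)
    have "length xs \<le> sum_list xs"
      using pos by (induction xs) auto
    moreover have "x \<le> n" if "x \<in> set xs" for x
      using member_le_sum_list[OF that] sum by simp
    ultimately show "xs \<in> {xs. set xs \<subseteq> {..n} \<and> length xs \<le> n}"
      using sum by auto
  qed
  show "finite {xs. set xs \<subseteq> {..n} \<and> length xs \<le> n}"
    by (rule finite_lists_length_le) simp
qed

lemma finite_SC: "finite (SC n)"
  by (rule finite_subset[OF _ finite_partitions]) (auto simp: SC_def)

lemma finite_DO: "finite (DO n)"
  by (rule finite_subset[OF _ finite_partitions]) (auto simp: DO_def)

lemma finite_diagram: "finite (diagram xs)"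
proof -
  have "diagram xs = (SIGMA i:{..<length xs}. {..<xs ! i})"
    by (auto simp: diagram_def)
  then show ?thesis by simp
qed

lemma finite_arm: "finite {j'. j < j' \<and> (i, j') \<in> diagram xs}"
  by (rule finite_subset[OF _ finite_imageI[OF finite_diagram, where h = snd]])
     force

lemma finite_leg: "finite {i'. i < i' \<and> (i', j) \<in> diagram xs}"
  by (rule finite_subset[OF _ finite_imageI[OF finite_diagram, where h = fst]])
     force

end

theory Submission
  imports
    "HOL-Probability.Probability"
    "HOL-Real_Asymp.Real_Asymp"
    Defs
begin

text \<open>
  Both \<open>SC n\<close> and \<open>DO n\<close> are in bijection with the finite sets \<open>A\<close> of natural numbers with
  \<open>(\<Sum>a\<in>A. 2 a + 1) = n\<close> (diagonal hooks and parts, respectively), and the number of hooks of length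
  \<open>t\<close> counts, up to boundary terms, the positions \<open>m\<close> at which \<open>A\<close> shows one of finitely many patterns
  in a bounded window around \<open>m\<close>. Choose \<open>A\<close> at random, \<open>a \<in> A\<close> independently with odds
  \<open>exp (- (2 a + 1) x)\<close> where \<open>x = pi / sqrt (24 n)\<close>. The number of sets of weight \<open>n\<close> with a given
  pattern is a Fourier coefficient of a product of Bernoulli characteristic functions, and a local
  limit theorem by dominated convergence reduces the asymptotics to the expected number of patterns,
  which is a Riemann sum for \<open>1 / (2 x)\<close> times \<open>\<integral> y ^ l / (1 + y) ^ k\<close> over the unit interval. Such an integral
  with \<open>l < k\<close> is rational unless \<open>k = l + 1\<close>, when it is \<open>ln 2\<close> plus a rational; for the distinct
  odd parts the latter occurs, exactly once, iff \<open>3\<close> does not divide \<open>t\<close>. The constant is at most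
  \<open>ln 2 / 2\<close> because the patterns for fixed \<open>y\<close> describe disjoint ways for a random walk with steps
  2 and 3 to meet a given level.
\<close>

subsection \<open>Self-conjugate partitions and sets of diagonal hook lengths\<close>

text \<open>With this x the expected weight of A is n to leading order, and a set of weight w has
  probability proportional to exp (- w x), so all sets of weight n are equally likely. The variance
  is about pi^2 / (12 x^3), hence the Fourier integral lives on angles of order x^(3/2), while of
  order 1 / x positions m can carry a pattern; the product x^(1/2) is the origin of n^(-1/4) in the
  statement. The obstacle is uniformity, since the number of positions grows with n. The sum over m
  is therefore taken under the integral before passing to the limit, and the required element m
  supplies the factor exp (- (2 m + 1) x) that keeps this sum of order 1 / x. No splitting into arcs
  is needed: one geometric sum bounds the integrand on the whole circle. The logarithm of the
  normalizing product has to be known up to o(1) and not just to leading order; this succeeds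
  because the odd multiples of x are midpoints of cells of length 2 x, so that the midpoint rule
  applies.\<close>

definition wt :: "nat \<Rightarrow> nat" where
  "wt a = 2 * a + 1"

definition odd_sets :: "nat \<Rightarrow> nat set set" where
  "odd_sets n = {A. finite A \<and> sum wt A = n}"

lemma odd_sets_bound:
  assumes "A \<in> odd_sets n" "a \<in> A"
  shows "a < n"
proof -
  have "wt a \<le> sum wt A"
    using assms by (intro member_le_sum) (auto simp: odd_sets_def)
  with assms show ?thesis by (simp add: odd_sets_def wt_def)
qed

lemma odd_sets_subset: "odd_sets n \<subseteq> Pow {..<n}"
  using odd_sets_bound by blast

lemma finite_odd_sets: "finite (odd_sets n)"
  by (rule finite_subset[OF odd_sets_subset]) simp

text \<open>Extended by zero past the last row, so that symmetry of the diagram becomes a condition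
  on all pairs of naturals and every column index is also a row index.\<close>

definition row :: "nat list \<Rightarrow> nat \<Rightarrow> nat" where
  "row xs i = (if i < length xs then xs ! i else 0)"

lemma diagram_iff_row: "(i, j) \<in> diagram xs \<longleftrightarrow> j < row xs i"
  by (auto simp: diagram_def row_def)

lemma row_pos_iff: "xs \<in> partitions n \<Longrightarrow> 0 < row xs i \<longleftrightarrow> i < length xs"
  by (auto simp: row_def partitions_def)

lemma row_antimono:
  assumes "xs \<in> partitions n" "i \<le> j"
  shows "row xs j \<le> row xs i"
  using assms sorted_wrt_nth_less[of "(\<ge>)" xs i j]
  by (cases "i = j") (auto simp: row_def partitions_def)

lemma partition_eqI:
  assumes "xs \<in> partitions n" "ys \<in> partitions m" "\<And>i. row xs i = row ys i"
  shows "xs = ys"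
proof -
  have "i < length xs \<longleftrightarrow> i < length ys" for i
    using assms(3)[of i] row_pos_iff[OF assms(1)] row_pos_iff[OF assms(2)] by metis
  then have len: "length xs = length ys"
    by (metis linorder_neq_iff)
  show ?thesis
  proof (rule nth_equalityI[OF len])
    fix i assume "i < length xs"
    then show "xs ! i = ys ! i"
      using assms(3)[of i] len by (simp add: row_def)
  qed
qed

lemma SC_iff: "xs \<in> SC n \<longleftrightarrow> xs \<in> partitions n \<and> (\<forall>i j. j < row xs i \<longleftrightarrow> i < row xs j)"
proof -
  have "prod.swap ` diagram xs = diagram xs \<longleftrightarrow> (\<forall>i j. (i, j) \<in> diagram xs \<longleftrightarrow> (j, i) \<in> diagram xs)"
    by (force simp: image_iff set_eq_iff)
  then show ?thesis
    by (simp add: SC_def diagram_iff_row)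
qed

lemma SC_partition: "xs \<in> SC n \<Longrightarrow> xs \<in> partitions n"
  by (simp add: SC_iff)

lemma SC_row_sym: "xs \<in> SC n \<Longrightarrow> j < row xs i \<longleftrightarrow> i < row xs j"
  unfolding SC_iff by blast

text \<open>The Maya diagram (beta-set) of the partition: the content of the last box of each row,
  which marks the vertical steps of the boundary path. Empty rows contribute all sufficiently
  negative integers.\<close>

definition edge_pos :: "nat list \<Rightarrow> nat \<Rightarrow> int" where
  "edge_pos xs i = int (row xs i) - int i - 1"

lemma edge_pos_strict_antimono:
  assumes "xs \<in> partitions n" "i < j"
  shows "edge_pos xs j < edge_pos xs i"
  using row_antimono[OF assms(1), of i j] assms(2) by (simp add: edge_pos_def)

lemma edge_pos_inj: "xs \<in> partitions n \<Longrightarrow> inj (edge_pos xs)"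
  by (rule linorder_injI) (metis edge_pos_strict_antimono less_irrefl)

text \<open>By symmetry \<open>row xs i - j - 1\<close> and \<open>row xs j - i - 1\<close>, taken
  in the integers, are both nonnegative or both negative. Their sum is therefore never -1, and this
  gap is what \<open>SC_edge_complement\<close> exploits.\<close>

lemma SC_box_iff_edge:
  assumes "xs \<in> SC n"
  shows "j < row xs i \<longleftrightarrow> 0 \<le> edge_pos xs i + edge_pos xs j"
    and "\<not> j < row xs i \<longleftrightarrow> edge_pos xs i + edge_pos xs j \<le> -2"
proof -
  have *: "j < row xs i \<longleftrightarrow> i < row xs j"
    by (rule SC_row_sym[OF assms])
  show "j < row xs i \<longleftrightarrow> 0 \<le> edge_pos xs i + edge_pos xs j"
    using * unfolding edge_pos_def by linarith
  show "\<not> j < row xs i \<longleftrightarrow> edge_pos xs i + edge_pos xs j \<le> -2"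
    using * unfolding edge_pos_def by linarith
qed

text \<open>The leg in column j is read off from row j by symmetry, so arm and leg are the two
  summands of \<open>SC_box_iff_edge\<close>.\<close>

lemma SC_hook_number:
  assumes "xs \<in> SC n" "j < row xs i"
  shows "int (hook_number xs (i, j)) = edge_pos xs i + edge_pos xs j + 1"
proof -
  note sym = SC_row_sym[OF assms(1)]
  have "{j'. j < j' \<and> (i, j') \<in> diagram xs} = {j<..<row xs i}"
    by (auto simp: diagram_iff_row)
  moreover have "{i'. i < i' \<and> (i', j) \<in> diagram xs} = {i<..<row xs j}"
    using sym by (auto simp: diagram_iff_row)
  moreover have "i < row xs j"
    using assms(2) sym by blast
  ultimately show ?thesis
    using assms(2) by (simp add: hook_number_def edge_pos_def)
qed

text \<open>Transposing the diagram reverses the boundary path and exchanges vertical and horizontal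
  steps, sending position k to -1 - k. One direction is the forbidden sum -1; for the other, a
  missed position k is crossed by a horizontal step, whose column has edge position -1 - k.\<close>

lemma SC_edge_complement:
  assumes "xs \<in> SC n"
  shows "k \<in> range (edge_pos xs) \<longleftrightarrow> - 1 - k \<notin> range (edge_pos xs)"
proof
  assume "k \<in> range (edge_pos xs)"
  then obtain i where i: "k = edge_pos xs i" by blast
  show "- 1 - k \<notin> range (edge_pos xs)"
  proof
    assume "- 1 - k \<in> range (edge_pos xs)"
    then obtain j where "- 1 - k = edge_pos xs j" by blast
    with i have "edge_pos xs i + edge_pos xs j = -1" by simp
    then show False
      using SC_box_iff_edge[OF assms, of j i] by linarith
  qed
next
  assume nin: "- 1 - k \<notin> range (edge_pos xs)"
  note part = SC_partition[OF assms] and sym = SC_row_sym[OF assms]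
  have ex: "\<exists>i. edge_pos xs i \<le> k"
  proof
    show "edge_pos xs (length xs + nat (- k)) \<le> k"
      by (simp add: edge_pos_def row_def)
  qed
  define i where "i = (LEAST i. edge_pos xs i \<le> k)"
  have i1: "edge_pos xs i \<le> k"
    unfolding i_def by (rule LeastI_ex[OF ex])
  have i2: "\<not> edge_pos xs i' \<le> k" if "i' < i" for i'
    using not_less_Least that unfolding i_def by blast
  show "k \<in> range (edge_pos xs)"
  proof (rule ccontr)
    assume nk: "k \<notin> range (edge_pos xs)"
    with i1 have lt: "edge_pos xs i < k"
      by (metis order_le_less rangeI)
    then have kj: "int (row xs i) \<le> k + int i"
      by (simp add: edge_pos_def)
    \<comment> \<open>Column k + i is the one on diagonal k in row i. Row i is too short to reach it
      and the row above is long enough, so this column has height exactly i.\<close>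
    then obtain j where j: "int j = k + int i"
      by (metis nonneg_int_cases of_nat_0_le_iff order_trans)
    have "\<not> j < row xs i"
      using kj j by linarith
    then have "row xs j \<le> i"
      using sym by (meson not_less)
    moreover have "i \<le> row xs j"
    proof (cases i)
      case (Suc i')
      then have "\<not> edge_pos xs i' \<le> k" using i2 by simp
      then have "j < row xs i'"
        using j Suc by (simp add: edge_pos_def)
      with sym Suc show ?thesis by (metis Suc_leI)
    qed simp
    ultimately have "edge_pos xs j = -1 - k"
      using j by (simp add: edge_pos_def)
    with nin show False by (metis rangeI)
  qed
qed

text \<open>The arm lengths of the diagonal boxes, that is one half of the Frobenius symbol;
  self-conjugacy makes the legs equal to the arms. The diagonal hook lengths are the images under
  \<open>wt\<close>.\<close>

definition diag_set :: "nat list \<Rightarrow> nat set" where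
  "diag_set xs = {a. int a \<in> range (edge_pos xs)}"

lemma range_edge_pos:
  assumes "xs \<in> SC n"
  shows "k \<in> range (edge_pos xs) \<longleftrightarrow> (if 0 \<le> k then nat k \<in> diag_set xs else nat (-1 - k) \<notin> diag_set xs)"
  using SC_edge_complement[OF assms, of k] by (auto simp: diag_set_def)

text \<open>Both sequences are strictly decreasing, and the i-th largest element of the range is
  determined by strong induction.\<close>

lemma edge_pos_eq_if_range_eq:
  assumes "xs \<in> partitions n" "ys \<in> partitions m" "range (edge_pos xs) = range (edge_pos ys)"
  shows "edge_pos xs i = edge_pos ys i"
proof -
  have main: "edge_pos xs i \<le> edge_pos ys i"
    if xs: "xs \<in> partitions n" and ys: "ys \<in> partitions m"
      and r: "range (edge_pos xs) = range (edge_pos ys)" and IH: "\<forall>i'<i. edge_pos xs i' = edge_pos ys i'"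
    for xs ys n m i
  proof -
    obtain j where j: "edge_pos xs i = edge_pos ys j"
      using r by (metis imageE rangeI)
    have "\<not> j < i"
      using IH j edge_pos_strict_antimono[OF xs] by (metis less_irrefl)
    then show ?thesis
      using j edge_pos_strict_antimono[OF ys, of i j] by (cases "i = j") auto
  qed
  show ?thesis
  proof (induction i rule: less_induct)
    case (less i)
    have "edge_pos xs i \<le> edge_pos ys i"
      by (rule main[OF assms(1,2,3)]) (simp add: less)
    moreover have "edge_pos ys i \<le> edge_pos xs i"
      by (rule main[OF assms(2,1) assms(3)[symmetric]]) (simp add: less)
    ultimately show ?case by simp
  qed
qed

lemma diag_set_inj: "inj_on diag_set (SC n)"
proof (rule inj_onI)
  fix xs ys assume xs: "xs \<in> SC n" and ys: "ys \<in> SC n" and eq: "diag_set xs = diag_set ys"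
  have "range (edge_pos xs) = range (edge_pos ys)"
    by (rule Set.set_eqI) (simp only: range_edge_pos[OF xs] range_edge_pos[OF ys] eq)
  then have "row xs i = row ys i" for i
    using edge_pos_eq_if_range_eq[of xs n ys n i] SC_partition[OF xs] SC_partition[OF ys] by (simp add: edge_pos_def)
  then show "xs = ys"
    by (rule partition_eqI[OF SC_partition[OF xs] SC_partition[OF ys]])
qed

lemma card_diagram: "card (diagram xs) = sum_list xs"
proof -
  have "diagram xs = (SIGMA i:{..<length xs}. {..<xs ! i})"
    by (auto simp: diagram_def)
  then have "card (diagram xs) = (\<Sum>i<length xs. xs ! i)"
    by simp
  then show ?thesis
    by (simp add: sum_list_sum_nth atLeast0LessThan)
qed

lemma finite_diag_set:
  assumes "xs \<in> SC n" shows "diag_set xs \<subseteq> {..<n}"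
proof
  fix a assume "a \<in> diag_set xs"
  then obtain i where i: "int a = edge_pos xs i" by (auto simp: diag_set_def)
  then have "a < row xs i" by (simp add: edge_pos_def)
  moreover have "row xs i \<le> sum_list xs"
    by (simp add: row_def member_le_sum_list)
  moreover have "sum_list xs = n"
    using SC_partition[OF assms] by (simp add: partitions_def)
  ultimately show "a \<in> {..<n}" by simp
qed

text \<open>Each diagonal box spans the boxes weakly to its right and strictly below it.\<close>

lemma sum_wt_diag_set:
  assumes "xs \<in> SC n"
  shows "sum wt (diag_set xs) = n"
proof -
  note part = SC_partition[OF assms] and sym = SC_row_sym[OF assms]
  define D where "D = {i. i < row xs i}"
  have finD: "finite D"
  proof (rule finite_subset)
    show "D \<subseteq> {..<length xs}"
    proof
      fix i assume "i \<in> D"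
      then have "0 < row xs i" by (simp add: D_def)
      then show "i \<in> {..<length xs}" by (simp only: row_pos_iff[OF part] lessThan_iff)
    qed
  qed simp
  define U where "U = (SIGMA i:D. {i..<row xs i})"
  define L where "L = (SIGMA i:D. {i<..<row xs i})"
  have "diagram xs = U \<union> prod.swap ` L"
  proof (rule Set.set_eqI, clarify)
    fix i j
    have "(i, j) \<in> diagram xs \<longleftrightarrow> j < row xs i" by (rule diagram_iff_row)
    moreover have "i < row xs i" if "i \<le> j" "j < row xs i" using that by simp
    moreover have "(i, j) \<in> prod.swap ` L \<longleftrightarrow> (j, i) \<in> L" by (force simp: image_iff)
    ultimately show "(i, j) \<in> diagram xs \<longleftrightarrow> (i, j) \<in> U \<union> prod.swap ` L"
      using sym[of i j] by (auto simp: U_def L_def D_def)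
  qed
  moreover have "U \<inter> prod.swap ` L = {}"
    by (auto simp: U_def L_def)
  moreover have "finite U" "finite L"
    using finD by (auto simp: U_def L_def)
  moreover have "card (prod.swap ` L) = card L"
    by (rule card_image) (auto intro: inj_onI)
  ultimately have "card (diagram xs) = card U + card L"
    by (simp add: card_Un_disjoint)
  also have "\<dots> = (\<Sum>i\<in>D. (row xs i - i) + (row xs i - Suc i))"
    using finD by (simp add: U_def L_def sum.distrib)
  also have "\<dots> = (\<Sum>i\<in>D. wt (nat (edge_pos xs i)))"
    by (rule sum.cong) (auto simp: D_def wt_def edge_pos_def)
  also have "\<dots> = sum wt ((\<lambda>i. nat (edge_pos xs i)) ` D)"
  proof (rule sum.reindex_cong[symmetric, OF _ refl refl])
    show "inj_on (\<lambda>i. nat (edge_pos xs i)) D"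
    proof (rule inj_onI)
      fix i j assume "i \<in> D" "j \<in> D" "nat (edge_pos xs i) = nat (edge_pos xs j)"
      then have "edge_pos xs i = edge_pos xs j"
        by (auto simp: D_def edge_pos_def)
      then show "i = j" using edge_pos_inj[OF part] by (meson injD)
    qed
  qed
  also have "(\<lambda>i. nat (edge_pos xs i)) ` D = diag_set xs"
  proof
    show "(\<lambda>i. nat (edge_pos xs i)) ` D \<subseteq> diag_set xs"
    proof clarify
      fix i assume "i \<in> D"
      then have "int (nat (edge_pos xs i)) = edge_pos xs i"
        by (simp add: D_def edge_pos_def)
      then show "nat (edge_pos xs i) \<in> diag_set xs"
        unfolding diag_set_def by (simp only: mem_Collect_eq rangeI)
    qed
    show "diag_set xs \<subseteq> (\<lambda>i. nat (edge_pos xs i)) ` D"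
    proof
      fix a assume "a \<in> diag_set xs"
      then obtain i where "int a = edge_pos xs i" by (auto simp: diag_set_def)
      moreover from this have "i \<in> D" by (simp add: D_def edge_pos_def)
      ultimately show "a \<in> (\<lambda>i. nat (edge_pos xs i)) ` D" by force
    qed
  qed
  finally show ?thesis
    using part by (simp add: card_diagram partitions_def)
qed

text \<open>Elements are added in increasing order. The new largest element a wraps a hook with arm
  and leg a around the old diagram, which is pushed one step along the diagonal and so keeps its
  edge positions.\<close>

lemma ex_SC_diag_set:
  assumes "finite A"
  shows "\<exists>n. \<exists>xs\<in>SC n. diag_set xs = A"
  using assms
proof (induction A rule: finite_linorder_max_induct)
  case empty
  have "[] \<in> SC 0" by (simp add: SC_iff partitions_def row_def)
  moreover have "diag_set [] = {}" by (auto simp: diag_set_def edge_pos_def row_def)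
  ultimately show ?case by blast
next
  case (insert a A)
  then obtain n xs where xs: "xs \<in> SC n" and A: "diag_set xs = A" by blast
  note part = SC_partition[OF xs] and sym = SC_row_sym[OF xs]
  have r0: "row xs 0 \<le> a"
  proof (cases "row xs 0")
    case (Suc r)
    then have "int r = edge_pos xs 0" by (simp add: edge_pos_def)
    then have "r \<in> A" using A by (auto simp: diag_set_def)
    with insert Suc show ?thesis by auto
  qed simp
  have rle: "row xs i \<le> a" for i
    using row_antimono[OF part, of 0 i] r0 by simp
  have len: "length xs \<le> a"
    using sym[of _ 0] row_pos_iff[OF part] r0 by (metis leI le_trans less_irrefl)
  \<comment> \<open>The rows of length 1 fill the first column up to height a + 1, matching the
    first row.\<close>
  define ys where "ys = Suc a # (map Suc xs @ replicate (a - length xs) 1)"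
  have row0: "row ys 0 = Suc a" by (simp add: ys_def row_def)
  have rowS: "row ys (Suc i) = (if i < a then Suc (row xs i) else 0)" for i
    using len by (auto simp: ys_def row_def nth_append)
  have xs_le: "x \<le> a" if "x \<in> set xs" for x
  proof -
    obtain i where "i < length xs" "x = xs ! i"
      using \<open>x \<in> set xs\<close> by (metis in_set_conv_nth)
    then show ?thesis using rle[of i] by (simp add: row_def)
  qed
  have "sorted_wrt (\<ge>) (map Suc xs)"
    using part by (simp add: partitions_def sorted_wrt_map)
  moreover have "sorted_wrt (\<ge>) (replicate (a - length xs) (1::nat))"
    by (simp add: sorted_wrt_iff_nth_less)
  ultimately have "sorted_wrt (\<ge>) ys"
    using xs_le by (auto simp: ys_def sorted_wrt_append)
  then have part': "ys \<in> partitions (sum_list ys)"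
    by (auto simp: partitions_def ys_def)
  have sym': "j < row ys i \<longleftrightarrow> i < row ys j" for i j
  proof (cases i; cases j)
    fix i' j' assume "i = Suc i'" "j = Suc j'"
    then show ?thesis
      using sym[of i' j'] rle[of i'] rle[of j'] by (auto simp: rowS)
  qed (auto simp: row0 rowS)
  then have SC': "ys \<in> SC (sum_list ys)"
    using part' sym' unfolding SC_iff by blast
  have e0: "edge_pos ys 0 = int a" by (simp add: edge_pos_def row0)
  have eS: "edge_pos ys (Suc i) = edge_pos xs i" if "i < a" for i
    using that by (simp add: edge_pos_def rowS)
  \<comment> \<open>From index a on the shift breaks down, since the new rows are empty there; but
    then the positions are negative in both diagrams and do not touch the diagonal sets.\<close>
  have eS': "edge_pos ys (Suc i) < 0" "edge_pos xs i < 0" if "\<not> i < a" for i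
    using that rle[of i] by (simp_all add: edge_pos_def rowS)
  have "diag_set ys = insert a A"
  proof (rule Set.set_eqI)
    fix b
    have "int b \<in> range (edge_pos ys) \<longleftrightarrow> b = a \<or> (\<exists>i. int b = edge_pos ys (Suc i))"
      unfolding image_iff by (metis e0 not0_implies_Suc of_nat_eq_iff UNIV_I)
    also have "(\<exists>i. int b = edge_pos ys (Suc i)) \<longleftrightarrow> (\<exists>i. int b = edge_pos xs i)"
      using eS eS' by (metis of_nat_0_le_iff not_less)
    finally show "b \<in> diag_set ys \<longleftrightarrow> b \<in> insert a A"
      using A by (auto simp: diag_set_def)
  qed
  with SC' show ?case by blast
qed

lemma diag_set_bij: "bij_betw diag_set (SC n) (odd_sets n)"
proof (rule bij_betw_imageI[OF diag_set_inj])
  show "diag_set ` SC n = odd_sets n"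
  proof
    show "diag_set ` SC n \<subseteq> odd_sets n"
    proof clarify
      fix xs assume xs: "xs \<in> SC n"
      then have "finite (diag_set xs)"
        by (rule finite_subset[OF finite_diag_set finite_lessThan])
      with sum_wt_diag_set[OF xs] show "diag_set xs \<in> odd_sets n"
        by (simp add: odd_sets_def)
    qed
    show "odd_sets n \<subseteq> diag_set ` SC n"
    proof
      fix A assume A: "A \<in> odd_sets n"
      then have "finite A" and sum: "sum wt A = n" by (simp_all add: odd_sets_def)
      then obtain m xs where xs: "xs \<in> SC m" "diag_set xs = A"
        using ex_SC_diag_set by blast
      with sum_wt_diag_set[OF xs(1)] sum have "m = n" by simp
      with xs show "A \<in> diag_set ` SC n" by blast
    qed
  qed
qed

text \<open>By \<open>SC_hook_number\<close>, hooks of length t are ordered pairs of edge positions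
  with sum t - 1. A position k >= t has a negative partner, occupied iff k - t is not in A; negative
  k are the mirror image, whence the factor 2. For 0 <= k < t both partners are nonnegative, which
  gives the second summand.\<close>

lemma SC_num_hooks:
  assumes "xs \<in> SC n" "t \<ge> 1"
  defines "A \<equiv> diag_set xs"
  shows "num_hooks t xs = 2 * card {a \<in> A. t \<le> a \<and> a - t \<notin> A} + card {a \<in> A. a < t \<and> t - 1 - a \<in> A}"
proof -
  define P where "P = range (edge_pos xs)"
  note part = SC_partition[OF assms(1)]
  have inj: "inj (edge_pos xs)" by (rule edge_pos_inj[OF part])
  have P: "k \<in> P \<longleftrightarrow> (if 0 \<le> k then nat k \<in> A else nat (-1 - k) \<notin> A)" for k
    unfolding P_def A_def by (rule range_edge_pos[OF assms(1)])
  define S where "S = {k \<in> P. int t - 1 - k \<in> P}"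
  have "bij_betw (\<lambda>(i, j). edge_pos xs i) {b \<in> diagram xs. hook_number xs b = t} S"
  proof (rule bij_betw_imageI)
    have box: "(i, j) \<in> {b \<in> diagram xs. hook_number xs b = t} \<longleftrightarrow> edge_pos xs i + edge_pos xs j + 1 = int t" for i j
    proof (cases "j < row xs i")
      case True
      then have "hook_number xs (i, j) = t \<longleftrightarrow> edge_pos xs i + edge_pos xs j + 1 = int t"
        using SC_hook_number[OF assms(1) True] by linarith
      with True show ?thesis by (simp add: diagram_iff_row)
    next
      case False
      \<comment> \<open>Outside the diagram the sum is at most -2 and never t - 1, so the equation
        alone characterizes the boxes.\<close>
      then show ?thesis
        using SC_box_iff_edge(2)[OF assms(1), of j i] by (auto simp: diagram_iff_row)
    qed
    show "inj_on (\<lambda>(i, j). edge_pos xs i) {b \<in> diagram xs. hook_number xs b = t}"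
    proof (rule inj_onI, clarify)
      fix i j i' j' assume "(i, j) \<in> diagram xs" "(i', j') \<in> diagram xs" "t = hook_number xs (i, j)"
        "hook_number xs (i', j') = hook_number xs (i, j)" and e: "edge_pos xs i = edge_pos xs i'"
      then have "edge_pos xs i + edge_pos xs j + 1 = int t" "edge_pos xs i' + edge_pos xs j' + 1 = int t"
        using box[of i j] box[of i' j'] by auto
      with e have "edge_pos xs j = edge_pos xs j'" by simp
      with e inj show "i = i' \<and> j = j'" by (meson injD)
    qed
    show "(\<lambda>(i, j). edge_pos xs i) ` {b \<in> diagram xs. hook_number xs b = t} = S"
    proof (intro equalityI subsetI)
      fix k assume "k \<in> (\<lambda>(i, j). edge_pos xs i) ` {b \<in> diagram xs. hook_number xs b = t}"
      then obtain i j where "(i, j) \<in> {b \<in> diagram xs. hook_number xs b = t}" "k = edge_pos xs i"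
        by auto
      then have "int t - 1 - k = edge_pos xs j" "k = edge_pos xs i"
        using box[of i j] by auto
      then show "k \<in> S" by (simp add: S_def P_def)
    next
      fix k assume "k \<in> S"
      then obtain i j where "k = edge_pos xs i" "int t - 1 - k = edge_pos xs j"
        by (auto simp: S_def P_def)
      then have "(i, j) \<in> {b \<in> diagram xs. hook_number xs b = t}" "k = edge_pos xs i"
        using box[of i j] by auto
      then show "k \<in> (\<lambda>(i, j). edge_pos xs i) ` {b \<in> diagram xs. hook_number xs b = t}"
        by force
    qed
  qed
  then have card: "num_hooks t xs = card S"
    unfolding num_hooks_def by (rule bij_betw_same_card)
  define B where "B = {a \<in> A. t \<le> a \<and> a - t \<notin> A}"
  define C where "C = {a \<in> A. a < t \<and> t - 1 - a \<in> A}"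
  have finA: "finite A"
    using finite_diag_set[OF assms(1)] finite_subset unfolding A_def by blast
  then have fin: "finite B" "finite C" by (auto simp: B_def C_def)
  have S: "k \<in> S \<longleftrightarrow> k \<in> int ` B \<or> k \<in> int ` C \<or> k \<in> (\<lambda>a. int t - 1 - int a) ` B" for k
  proof -
    consider "k < 0" | "0 \<le> k" "k < int t" | "int t \<le> k" by linarith
    then show ?thesis
    proof cases
      case 1
      define a where "a = nat (int t - 1 - k)"
      have a: "k = int t - 1 - int a" "t \<le> a" "nat (- 1 - k) = a - t"
        using 1 by (auto simp: a_def)
      then show ?thesis
        using 1 P[of k] P[of "int t - 1 - k"] by (auto simp: S_def B_def C_def image_iff)
    next
      case 2
      define a where "a = nat k"
      have a: "k = int a" "a < t" "nat (int t - 1 - k) = t - 1 - a"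
        using 2 by (auto simp: a_def)
      then show ?thesis
        using 2 P[of k] P[of "int t - 1 - k"] by (auto simp: S_def B_def C_def image_iff)
    next
      case 3
      define a where "a = nat k"
      have a: "k = int a" "t \<le> a" "nat (-1 - (int t - 1 - k)) = a - t"
        using 3 by (auto simp: a_def)
      then show ?thesis
        using 3 P[of k] P[of "int t - 1 - k"] by (auto simp: S_def B_def C_def image_iff)
    qed
  qed
  have "card S = card (int ` B \<union> (int ` C \<union> (\<lambda>a. int t - 1 - int a) ` B))"
    using S by (intro arg_cong[of _ _ card]) auto
  also have "\<dots> = card (int ` B) + (card (int ` C) + card ((\<lambda>a. int t - 1 - int a) ` B))"
    using fin assms(2) by (subst card_Un_disjoint; (subst card_Un_disjoint)?) (auto simp: B_def C_def)
  also have "\<dots> = 2 * card B + card C"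
    by (simp add: card_image inj_on_def)
  finally show ?thesis
    using card by (simp add: B_def C_def)
qed

lemma a_star_eq:
  assumes "t \<ge> 1"
  shows "a_star t n = 2 * (\<Sum>A\<in>odd_sets n. card {a \<in> A. t \<le> a \<and> a - t \<notin> A})
     + (\<Sum>A\<in>odd_sets n. card {a \<in> A. a < t \<and> t - 1 - a \<in> A})"
proof -
  define f where "f A = 2 * card {a \<in> A. t \<le> a \<and> a - t \<notin> A} + card {a \<in> A. a < t \<and> t - 1 - a \<in> A}"
    for A :: "nat set"
  have "a_star t n = (\<Sum>xs\<in>SC n. f (diag_set xs))"
    unfolding a_star_def f_def using SC_num_hooks[OF _ assms] by (intro sum.cong) auto
  also have "\<dots> = sum f (odd_sets n)"
    by (rule sum.reindex_bij_betw[OF diag_set_bij])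
  finally show ?thesis
    by (simp add: f_def sum.distrib sum_distrib_left)
qed


section \<open>Hooks in partitions into distinct odd parts\<close>

definition half_set :: "nat list \<Rightarrow> nat set" where
  "half_set xs = (\<lambda>x. x div 2) ` set xs"

lemma DO_D:
  assumes "xs \<in> DO n"
  shows "sorted_wrt (\<ge>) xs" "distinct xs" "\<And>x. x \<in> set xs \<Longrightarrow> odd x" "sum_list xs = n"
  using assms by (auto simp: DO_def partitions_def)

lemma wt_half: "odd x \<Longrightarrow> wt (x div 2) = x"
  by (simp add: wt_def)

lemma wt_inj: "inj_on wt S"
  by (rule inj_onI) (simp add: wt_def)

lemma set_eq_wt_half_set: "xs \<in> DO n \<Longrightarrow> set xs = wt ` half_set xs"
  using DO_D(3)[of xs n] by (force simp: half_set_def image_image wt_half)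

lemma half_set_bij: "bij_betw half_set (DO n) (odd_sets n)"
proof (rule bij_betw_imageI)
  show "inj_on half_set (DO n)"
  proof (rule inj_onI)
    fix xs ys assume xs: "xs \<in> DO n" and ys: "ys \<in> DO n" and eq: "half_set xs = half_set ys"
    have "set (rev xs) = set (rev ys)"
      using set_eq_wt_half_set[OF xs] set_eq_wt_half_set[OF ys] eq by simp
    moreover have "sorted (rev xs)" "sorted (rev ys)" "distinct (rev xs)" "distinct (rev ys)"
      using DO_D(1,2)[OF xs] DO_D(1,2)[OF ys] by (simp_all add: sorted_wrt_rev)
    ultimately have "rev xs = rev ys"
      by (metis sorted_distinct_set_unique)
    then show "xs = ys" by simp
  qed
  show "half_set ` DO n = odd_sets n"
  proof
    show "half_set ` DO n \<subseteq> odd_sets n"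
    proof clarify
      fix xs assume xs: "xs \<in> DO n"
      have "sum wt (half_set xs) = \<Sum>(wt ` half_set xs)"
        by (simp add: sum.reindex[OF wt_inj])
      also have "\<dots> = n"
        using DO_D(2,4)[OF xs] set_eq_wt_half_set[OF xs] by (metis distinct_sum_list_conv_Sum)
      finally show "half_set xs \<in> odd_sets n"
        by (simp add: odd_sets_def half_set_def)
    qed
    show "odd_sets n \<subseteq> half_set ` DO n"
    proof
      fix A assume "A \<in> odd_sets n"
      then have fin: "finite A" and sum: "sum wt A = n" by (simp_all add: odd_sets_def)
      define xs where "xs = rev (sorted_list_of_set (wt ` A))"
      have set: "set xs = wt ` A" and dist: "distinct xs"
        using fin by (simp_all add: xs_def)
      have "sum_list xs = n"
        using dist set sum by (simp add: distinct_sum_list_conv_Sum sum.reindex[OF wt_inj])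
      moreover have "sorted_wrt (\<ge>) xs"
        by (simp add: xs_def sorted_wrt_rev)
      ultimately have "xs \<in> DO n"
        using set dist by (auto simp: DO_def partitions_def wt_def)
      moreover have "half_set xs = A"
        unfolding half_set_def set image_image wt_def by simp
      ultimately show "A \<in> half_set ` DO n" by blast
    qed
  qed
qed

text \<open>Distinct parts identify rows with their lengths, so the leg counts the smaller parts
  that exceed j.\<close>

lemma DO_hook_number:
  assumes "xs \<in> DO n" "i < length xs" "j < xs ! i"
  shows "hook_number xs (i, j) = (xs ! i - j - 1) + card {x \<in> set xs. j < x \<and> x < xs ! i} + 1"
proof -
  have "{j'. j < j' \<and> (i, j') \<in> diagram xs} = {j<..<xs ! i}"
    using assms(2) by (auto simp: diagram_def)
  moreover have "{x \<in> set xs. j < x \<and> x < xs ! i} = (!) xs ` {i'. i < i' \<and> (i', j) \<in> diagram xs}"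
  proof (intro equalityI subsetI)
    fix x assume x: "x \<in> {x \<in> set xs. j < x \<and> x < xs ! i}"
    then obtain i' where i': "i' < length xs" "x = xs ! i'"
      by (auto simp: in_set_conv_nth)
    have "\<not> i' \<le> i"
      using sorted_wrt_nth_less[OF DO_D(1)[OF assms(1)], of i' i] i' x assms(2)
      by (cases "i' = i") auto
    with x i' show "x \<in> (!) xs ` {i'. i < i' \<and> (i', j) \<in> diagram xs}"
      by (auto simp: diagram_def)
  next
    fix x assume "x \<in> (!) xs ` {i'. i < i' \<and> (i', j) \<in> diagram xs}"
    then obtain i' where i': "i < i'" "i' < length xs" "j < xs ! i'" "x = xs ! i'"
      by (auto simp: diagram_def)
    then have "xs ! i' \<le> xs ! i"
      using sorted_wrt_nth_less[OF DO_D(1)[OF assms(1)], of i i'] by simp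
    moreover have "xs ! i' \<noteq> xs ! i"
      using nth_eq_iff_index_eq[OF DO_D(2)[OF assms(1)], of i' i] i' by simp
    ultimately show "x \<in> {x \<in> set xs. j < x \<and> x < xs ! i}"
      using i' by auto
  qed
  moreover have "inj_on ((!) xs) {i'. i < i' \<and> (i', j) \<in> diagram xs}"
    using DO_D(2)[OF assms(1)] by (intro inj_on_nth) (auto simp: diagram_def)
  ultimately show ?thesis
    by (simp add: hook_number_def card_image)
qed

text \<open>A box is encoded by its arm length \<open>a\<close> and the index \<open>m\<close> of its row length \<open>2 m + 1\<close>.\<close>

lemma DO_num_hooks:
  assumes "xs \<in> DO n" "t \<ge> 1"
  defines "A \<equiv> half_set xs"
  shows "num_hooks t xs
    = (\<Sum>a<t. card {m \<in> A. a \<le> 2 * m \<and> card (A \<inter> {m - a div 2..<m}) = t - 1 - a})"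
proof -
  have set: "set xs = wt ` A"
    unfolding A_def by (rule set_eq_wt_half_set[OF assms(1)])
  have finA: "finite A" by (simp add: A_def half_set_def)
  \<comment> \<open>The row of length 2 b + 1 reaches column 2 m - a iff 2 b + 1 > 2 m - a, that is
    b >= m - a div 2. So the leg is read off from a window of a div 2 positions just below
    m.\<close>
  have hook: "hook_number xs (i, 2 * m - a) = a + card (A \<inter> {m - a div 2..<m}) + 1"
    if "i < length xs" "xs ! i = wt m" "a \<le> 2 * m" for i m a
  proof -
    have "{x \<in> set xs. 2 * m - a < x \<and> x < xs ! i} = wt ` (A \<inter> {m - a div 2..<m})"
      unfolding set using that by (auto simp: wt_def)
    then have "card {x \<in> set xs. 2 * m - a < x \<and> x < xs ! i} = card (A \<inter> {m - a div 2..<m})"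
      by (simp add: card_image wt_inj)
    then show ?thesis
      using DO_hook_number[OF assms(1) that(1), of "2 * m - a"] that by (simp add: wt_def)
  qed
  let ?S = "SIGMA a:{..<t}. {m \<in> A. a \<le> 2 * m \<and> card (A \<inter> {m - a div 2..<m}) = t - 1 - a}"
  have "bij_betw (\<lambda>(i, j). (xs ! i - 1 - j, xs ! i div 2)) {b \<in> diagram xs. hook_number xs b = t} ?S"
  proof (rule bij_betw_imageI)
    have coord: "\<exists>m a. m \<in> A \<and> i < length xs \<and> xs ! i = wt m \<and> a \<le> 2 * m \<and> j = 2 * m - a"
      if "(i, j) \<in> diagram xs" for i j
    proof -
      have i: "i < length xs" "j < xs ! i" using that by (auto simp: diagram_def)
      then obtain m where m: "m \<in> A" "xs ! i = wt m"
        using set by (metis imageE nth_mem)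
      moreover have "j = 2 * m - (2 * m - j)" "2 * m - j \<le> 2 * m"
        using m i by (auto simp: wt_def)
      ultimately show ?thesis using i by blast
    qed
    show "inj_on (\<lambda>(i, j). (xs ! i - 1 - j, xs ! i div 2)) {b \<in> diagram xs. hook_number xs b = t}"
    proof (rule inj_onI, clarify)
      fix i j i' j' assume b: "(i, j) \<in> diagram xs" "(i', j') \<in> diagram xs"
        and e: "xs ! i - 1 - j = xs ! i' - 1 - j'" "xs ! i div 2 = xs ! i' div 2"
      obtain m a where m: "i < length xs" "xs ! i = wt m" "a \<le> 2 * m" "j = 2 * m - a"
        using coord[OF b(1)] by blast
      obtain m' a' where m': "i' < length xs" "xs ! i' = wt m'" "a' \<le> 2 * m'" "j' = 2 * m' - a'"
        using coord[OF b(2)] by blast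
      have "m = m'" using e(2) m m' by (simp add: wt_def)
      moreover from this have "a = a'" using e(1) m m' by (simp add: wt_def)
      ultimately show "i = i' \<and> j = j'"
        using m m' nth_eq_iff_index_eq[OF DO_D(2)[OF assms(1)], of i i'] by simp
    qed
    show "(\<lambda>(i, j). (xs ! i - 1 - j, xs ! i div 2)) ` {b \<in> diagram xs. hook_number xs b = t} = ?S"
    proof (intro equalityI subsetI)
      fix p assume "p \<in> (\<lambda>(i, j). (xs ! i - 1 - j, xs ! i div 2)) ` {b \<in> diagram xs. hook_number xs b = t}"
      then obtain i j where b: "(i, j) \<in> diagram xs" "hook_number xs (i, j) = t"
        and p: "p = (xs ! i - 1 - j, xs ! i div 2)" by auto
      obtain m a where m: "m \<in> A" "i < length xs" "xs ! i = wt m" "a \<le> 2 * m" "j = 2 * m - a"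
        using coord[OF b(1)] by blast
      have "p = (a, m)" using p m by (simp add: wt_def)
      moreover have "t = a + card (A \<inter> {m - a div 2..<m}) + 1"
        using hook[OF m(2,3,4)] b(2) m(5) by simp
      ultimately show "p \<in> ?S" using m by simp
    next
      fix p assume "p \<in> ?S"
      then obtain a m where p: "p = (a, m)" "a < t" "m \<in> A" "a \<le> 2 * m"
        "card (A \<inter> {m - a div 2..<m}) = t - 1 - a" by auto
      obtain i where i: "i < length xs" "xs ! i = wt m"
        using p(3) set by (metis imageI in_set_conv_nth)
      have "hook_number xs (i, 2 * m - a) = t"
        using hook[OF i p(4)] p by simp
      moreover have "(i, 2 * m - a) \<in> diagram xs"
        using i p by (simp add: diagram_def wt_def)
      ultimately have b: "(i, 2 * m - a) \<in> {b \<in> diagram xs. hook_number xs b = t}" by simp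
      have "p = (\<lambda>(i, j). (xs ! i - 1 - j, xs ! i div 2)) (i, 2 * m - a)"
        using i p by (simp add: wt_def)
      then show "p \<in> (\<lambda>(i, j). (xs ! i - 1 - j, xs ! i div 2)) ` {b \<in> diagram xs. hook_number xs b = t}"
        using b by (rule image_eqI)
    qed
  qed
  then have "num_hooks t xs = card ?S"
    unfolding num_hooks_def by (rule bij_betw_same_card)
  also have "\<dots> = (\<Sum>a<t. card {m \<in> A. a \<le> 2 * m \<and> card (A \<inter> {m - a div 2..<m}) = t - 1 - a})"
    using finA by (intro card_SigmaI) auto
  finally show ?thesis .
qed

lemma b_star_eq:
  assumes "t \<ge> 1"
  shows "b_star t n = (\<Sum>A\<in>odd_sets n. \<Sum>a<t.
     card {m \<in> A. a \<le> 2 * m \<and> card (A \<inter> {m - a div 2..<m}) = t - 1 - a})"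
proof -
  have "b_star t n = (\<Sum>xs\<in>DO n. (\<lambda>A. \<Sum>a<t.
     card {m \<in> A. a \<le> 2 * m \<and> card (A \<inter> {m - a div 2..<m}) = t - 1 - a}) (half_set xs))"
    unfolding b_star_def using DO_num_hooks[OF _ assms] by (intro sum.cong) auto
  also have "\<dots> = (\<Sum>A\<in>odd_sets n. \<Sum>a<t.
     card {m \<in> A. a \<le> 2 * m \<and> card (A \<inter> {m - a div 2..<m}) = t - 1 - a})"
    by (rule sum.reindex_bij_betw[OF half_set_bij])
  finally show ?thesis .
qed

subsection \<open>The limiting constants\<close>

text \<open>At 0 the i-th derivative is i! times a coefficient, which vanishes for i < n, while n!
  divides i! for i >= n. The symmetry x -> 1 - x carries this over to 1.\<close>

lemma niven_poly_higher_pderiv: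
  fixes i n :: nat
  defines "p \<equiv> Polynomial.monom 1 n * [:1, -1:] ^ n :: real poly"
  shows "\<exists>c\<in>\<int>. poly ((pderiv ^^ i) p) 0 = fact n * c" "\<exists>c\<in>\<int>. poly ((pderiv ^^ i) p) 1 = fact n * c"
proof -
  have int: "Polynomial.coeff ([:1, -1:] ^ m :: real poly) k \<in> \<int>" for m k
  proof (induction m arbitrary: k)
    case (Suc m)
    then show ?case
      by (cases k) (auto intro!: Ints_diff simp: coeff_pCons)
  qed (auto simp: coeff_1)
  have coeff: "Polynomial.coeff p i = (if n \<le> i then Polynomial.coeff ([:1, -1:] ^ n) (i - n) else 0)"
    by (simp add: p_def coeff_monom_mult)
  show zero: "\<exists>c\<in>\<int>. poly ((pderiv ^^ i) p) 0 = fact n * c"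
  proof (cases "n \<le> i")
    case True
    then have "(fact n :: int) dvd fact i" by (rule fact_dvd)
    then obtain d :: int where "fact i = fact n * d" by (elim dvdE)
    then have "(fact i :: real) = fact n * of_int d"
      by (metis of_int_fact of_int_mult)
    then have "poly ((pderiv ^^ i) p) 0 = fact n * (of_int d * Polynomial.coeff p i)"
      by (simp add: poly_0_coeff_0 coeff_higher_pderiv pochhammer_fact[symmetric])
    then show ?thesis
      using int coeff True by (intro bexI[of _ "of_int d * Polynomial.coeff p i"] Ints_mult) auto
  next
    case False
    then show ?thesis
      by (intro bexI[of _ 0]) (simp_all add: poly_0_coeff_0 coeff_higher_pderiv coeff)
  qed
  have pcompose_power: "pcompose (q ^ m) r = pcompose q r ^ m" for q r :: "real poly" and m
    by (induction m) (simp_all add: pcompose_1 pcompose_mult)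
  have refl: "pcompose p [:1, -1:] = p"
  proof -
    have "pcompose (Polynomial.monom 1 n) [:1, -1:] = ([:1, -1:] ^ n :: real poly)"
      by (simp add: monom_altdef pcompose_power pcompose_pCons)
    moreover have "pcompose ([:1, -1:] ^ n) [:1, -1:] = (Polynomial.monom 1 n :: real poly)"
      by (simp add: monom_altdef pcompose_power pcompose_pCons)
    ultimately show ?thesis
      by (simp add: p_def pcompose_mult mult.commute)
  qed
  have "(pderiv ^^ i) p = Polynomial.smult ((-1) ^ i) (pcompose ((pderiv ^^ i) p) [:1, -1:])"
  proof (induction i)
    case 0
    then show ?case using refl by simp
  next
    case (Suc i)
    have "(pderiv ^^ Suc i) p = pderiv (Polynomial.smult ((-1) ^ i) (pcompose ((pderiv ^^ i) p) [:1, -1:]))"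
      using Suc by simp
    also have "\<dots> = Polynomial.smult ((-1) ^ Suc i) (pcompose ((pderiv ^^ Suc i) p) [:1, -1:])"
      by (simp add: pderiv_smult pderiv_pcompose pderiv_pCons)
    finally show ?case .
  qed
  then have "poly ((pderiv ^^ i) p) 1 = poly (Polynomial.smult ((-1) ^ i) (pcompose ((pderiv ^^ i) p) [:1, -1:])) 1"
    by simp
  also have "\<dots> = (-1) ^ i * poly ((pderiv ^^ i) p) 0"
    by (simp add: poly_pcompose)
  finally have one: "poly ((pderiv ^^ i) p) 1 = (-1) ^ i * poly ((pderiv ^^ i) p) 0" .
  from zero obtain c where "c \<in> \<int>" "poly ((pderiv ^^ i) p) 0 = fact n * c" by blast
  with one show "\<exists>c\<in>\<int>. poly ((pderiv ^^ i) p) 1 = fact n * c"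
    by (intro bexI[of _ "(-1) ^ i * c"]) auto
qed

text \<open>Niven's argument: if \<open>exp a = 2 ^ b\<close>, integrating \<open>a ^ (2 n + 1) * exp (a x) * x ^ n * (1 - x) ^ n\<close>
  by parts produces a positive multiple of \<open>fact n\<close> that grows only geometrically in \<open>n\<close>.\<close>

lemma ln2_irrational: "ln 2 \<notin> (\<rat> :: real set)"
proof
  assume "ln 2 \<in> (\<rat> :: real set)"
  then obtain a b :: nat where b: "b \<noteq> 0" and ab: "\<bar>ln 2\<bar> = real a / real b"
    by (rule Rats_abs_nat_div_natE) blast
  have ln2: "real b * ln 2 = real a" using ab b by (simp add: field_simps)
  then have a0: "real a > 0" using b by (metis ln_gt_zero mult_pos_pos of_nat_0_less_iff neq0_conv one_less_numeral_iff semiring_norm(76))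
  have expa: "exp (real a) = 2 ^ b"
    using ln2 by (metis exp_ln exp_of_nat_mult zero_less_numeral)
  have "(\<lambda>n. (2 ^ b * real a) * (real a ^ 2) ^ n / fact n) \<longlonglongrightarrow> 0"
    using tendsto_mult[OF tendsto_const[of "2 ^ b * real a"] summable_LIMSEQ_zero[OF summable_exp[of "real a ^ 2"]]]
    by (simp add: field_simps)
  then have "eventually (\<lambda>n. (2 ^ b * real a) * (real a ^ 2) ^ n / fact n < 1) sequentially"
    by (rule order_tendstoD(2)) simp
  then obtain n where n: "(2 ^ b * real a) * (real a ^ 2) ^ n / fact n < 1"
    by (meson eventually_sequentially order_refl)
  define p where "p = (Polynomial.monom 1 n * [:1, -1:] ^ n :: real poly)"
  \<comment> \<open>The result of integrating by parts until the polynomial is exhausted. It is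
    scaled by a power of a, so that no denominators appear and the values at 0 and 1 are integer
    multiples of n!.\<close>
  define F where "F x = (\<Sum>i\<le>2 * n. (-1) ^ i * real a ^ (2 * n - i) * poly ((pderiv ^^ i) p) x)" for x
  have degp: "Polynomial.degree p \<le> 2 * n"
  proof -
    have "Polynomial.degree p \<le> Polynomial.degree (Polynomial.monom 1 n :: real poly) + Polynomial.degree ([:1, -1:] ^ n :: real poly)"
      unfolding p_def by (rule degree_mult_le)
    also have "\<dots> \<le> n + n"
      by (intro add_mono degree_monom_le) (simp add: degree_power_eq)
    finally show ?thesis by simp
  qed
  have top: "(pderiv ^^ Suc (2 * n)) p = 0"
    by (rule poly_eqI) (simp add: coeff_higher_pderiv coeff_eq_0 degp le_imp_less_Suc del: funpow.simps, 
        use degp in \<open>simp add: coeff_eq_0\<close>)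
  have telescope: "real a * F x + (\<Sum>i\<le>2 * n. (-1) ^ i * real a ^ (2 * n - i) * poly ((pderiv ^^ Suc i) p) x)
      = real a ^ (2 * n + 1) * poly p x" for x
  proof -
    define g where "g i = (-1) ^ i * real a ^ (2 * n + 1 - i) * poly ((pderiv ^^ i) p) x" for i
    have "real a * F x + (\<Sum>i\<le>2 * n. (-1) ^ i * real a ^ (2 * n - i) * poly ((pderiv ^^ Suc i) p) x)
      = (\<Sum>i\<le>2 * n. g i - g (Suc i))"
      unfolding F_def sum_distrib_left sum.distrib[symmetric] g_def
      by (intro sum.cong refl) (auto simp: Suc_diff_le)
    also have "\<dots> = g 0 - g (Suc (2 * n))"
      by (rule sum_telescope)
    also have "\<dots> = real a ^ (2 * n + 1) * poly p x"
      unfolding g_def top by simp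
    finally show ?thesis .
  qed
  have der: "((\<lambda>x. exp (real a * x) * F x) has_real_derivative
      exp (real a * x) * (real a ^ (2 * n + 1) * poly p x)) (at x)" for x
  proof -
    have "(F has_real_derivative (\<Sum>i\<le>2 * n. (-1) ^ i * real a ^ (2 * n - i) * poly ((pderiv ^^ Suc i) p) x)) (at x)"
      unfolding F_def by (intro DERIV_sum) (auto intro!: derivative_eq_intros poly_DERIV)
    then have "((\<lambda>x. exp (real a * x) * F x) has_real_derivative
      exp (real a * x) * real a * F x + exp (real a * x) *
        (\<Sum>i\<le>2 * n. (-1) ^ i * real a ^ (2 * n - i) * poly ((pderiv ^^ Suc i) p) x)) (at x)"
      by (auto intro!: derivative_eq_intros)
    then show ?thesis
      unfolding telescope[symmetric] by (simp add: algebra_simps)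
  qed
  \<comment> \<open>The mean value theorem takes the place of the integral: the integer multiple 2^b
    F(1) - F(0) of n! equals one positive value of the derivative, which is below n! by the choice
    of n.\<close>
  obtain x where x: "0 < x" "x < 1"
    and mvt: "exp (real a * 1) * F 1 - exp (real a * 0) * F 0
      = (1 - 0) * (exp (real a * x) * (real a ^ (2 * n + 1) * poly p x))"
    using MVT2[of 0 1 "\<lambda>x. exp (real a * x) * F x" "\<lambda>x. exp (real a * x) * (real a ^ (2 * n + 1) * poly p x)"] der
    by auto
  have px: "poly p x = x ^ n * (1 - x) ^ n"
    by (simp add: p_def poly_monom)
  have px01: "0 < poly p x" "poly p x \<le> 1"
    using x unfolding px by (auto intro!: mult_le_one power_le_one)
  have FI: "\<exists>c\<in>\<int>. F y = fact n * c" if y: "y = 0 \<or> y = 1" for y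
  proof -
    have "\<exists>c\<in>\<int>. poly ((pderiv ^^ i) p) y = fact n * c" for i
      using niven_poly_higher_pderiv[of i n] y unfolding p_def by blast
    then obtain c where c: "\<And>i. c i \<in> \<int>" "\<And>i. poly ((pderiv ^^ i) p) y = fact n * c i"
      by metis
    have "F y = fact n * (\<Sum>i\<le>2 * n. (-1) ^ i * real a ^ (2 * n - i) * c i)"
      unfolding F_def c(2) sum_distrib_left by (simp add: mult_ac)
    moreover have "(\<Sum>i\<le>2 * n. (-1) ^ i * real a ^ (2 * n - i) * c i) \<in> \<int>"
      using c(1) by (intro Ints_sum Ints_mult Ints_power) auto
    ultimately show ?thesis by blast
  qed
  obtain c0 c1 where c: "c0 \<in> \<int>" "c1 \<in> \<int>" "F 0 = fact n * c0" "F 1 = fact n * c1"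
    using FI[of 0] FI[of 1] by auto
  define k where "k = 2 ^ b * c1 - c0"
  have kI: "k \<in> \<int>" unfolding k_def using c by (intro Ints_diff Ints_mult Ints_power) auto
  have eq: "fact n * k = exp (real a * x) * (real a ^ (2 * n + 1) * poly p x)"
    using mvt c expa by (simp add: k_def algebra_simps)
  have "0 < fact n * k"
    unfolding eq using a0 px01 by simp
  then have "0 < k" by (simp add: zero_less_mult_iff)
  then have "1 \<le> k" using kI by (auto elim!: Ints_cases)
  have "exp (real a * x) * (real a ^ (2 * n + 1) * poly p x) \<le> exp (real a) * (real a ^ (2 * n + 1) * 1)"
    using a0 px01 x by (intro mult_mono) (auto intro!: mult_left_le)
  then have "fact n * k \<le> 2 ^ b * real a ^ (2 * n + 1)"
    using eq expa by simp
  also have "\<dots> = (2 ^ b * real a) * (real a ^ 2) ^ n"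
    by (simp add: power_mult[symmetric])
  also have "\<dots> < fact n"
    using n by (simp add: field_simps)
  finally show False
    using \<open>1 \<le> k\<close> by (simp add: mult_less_cancel_left2)
qed

section \<open>Moment integrals over the unit interval\<close>

text \<open>With y = exp (- u) and p = y / (1 + y), the occupation probability, this becomes for l <
  k the integral of p^(l + 1) (1 - p)^(k - l - 1) over u > 0: a pattern with l + 1 required and k -
  l - 1 forbidden positions.\<close>

definition moment_int :: "nat \<Rightarrow> nat \<Rightarrow> real" where
  "moment_int l k = integral {0..1} (\<lambda>y. y ^ l / (1 + y) ^ k)"

lemma moment_int_has_integral: "((\<lambda>y::real. y ^ l / (1 + y) ^ k) has_integral moment_int l k) {0..1}"
  unfolding moment_int_def
  by (intro integrable_integral integrable_continuous_interval continuous_intros) auto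

text \<open>One factor y in the numerator is written as (1 + y) - 1.\<close>

lemma moment_int_rec: "moment_int (Suc l) (Suc k) = moment_int l k - moment_int l (Suc k)"
proof -
  have "((\<lambda>y::real. y ^ l / (1 + y) ^ k - y ^ l / (1 + y) ^ Suc k) has_integral
      moment_int l k - moment_int l (Suc k)) {0..1}"
    by (intro has_integral_diff moment_int_has_integral)
  then have "((\<lambda>y::real. y ^ Suc l / (1 + y) ^ Suc k) has_integral
      moment_int l k - moment_int l (Suc k)) {0..1}"
  proof (rule has_integral_eq[rotated])
    fix y :: real assume "y \<in> {0..1}"
    then have "1 + y \<noteq> 0" by simp
    then show "y ^ l / (1 + y) ^ k - y ^ l / (1 + y) ^ Suc k = y ^ Suc l / (1 + y) ^ Suc k"
      by (simp add: divide_simps) (simp add: algebra_simps)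
  qed
  from has_integral_unique[OF moment_int_has_integral this] show ?thesis .
qed

lemma moment_int_0_1: "moment_int 0 1 = ln 2"
proof -
  have "((\<lambda>y::real. y ^ 0 / (1 + y) ^ 1) has_integral ln (1 + 1) - ln (1 + 0)) {0..1}"
    by (intro fundamental_theorem_of_calculus)
       (auto intro!: derivative_eq_intros simp: has_real_derivative_iff_has_vector_derivative[symmetric])
  from has_integral_unique[OF moment_int_has_integral this] show ?thesis by simp
qed

lemma moment_int_0: "moment_int 0 (Suc (Suc k)) = (1 - 1 / 2 ^ Suc k) / real (Suc k)"
proof -
  define G :: "real \<Rightarrow> real" where "G y = - (inverse (1 + y) ^ Suc k / real (Suc k))" for y
  have der: "(G has_real_derivative y ^ 0 / (1 + y) ^ Suc (Suc k)) (at y within {0..1})" if "y \<in> {0..1}" for y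
  proof -
    have "((\<lambda>y. inverse (1 + y)) has_real_derivative - (inverse (1 + y) ^ 2)) (at y within {0..1})"
      using that by (auto intro!: derivative_eq_intros simp: power2_eq_square)
    from DERIV_power[OF this, of "Suc k"]
    have "((\<lambda>y. inverse (1 + y) ^ Suc k) has_real_derivative
        real (Suc k) * (- (inverse (1 + y) ^ 2) * inverse (1 + y) ^ k)) (at y within {0..1})"
      by simp
    from DERIV_cdivide[OF DERIV_minus[OF this], of "real (Suc k)"]
    have "(G has_real_derivative - (real (Suc k) * (- (inverse (1 + y) ^ 2) * inverse (1 + y) ^ k)) / real (Suc k))
        (at y within {0..1})"
      by (simp add: G_def[abs_def])
    also have "- (real (Suc k) * (- (inverse (1 + y) ^ 2) * inverse (1 + y) ^ k)) / real (Suc k)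
        = inverse (1 + y) ^ 2 * inverse (1 + y) ^ k"
      by (simp del: of_nat_Suc)
    finally show ?thesis
      by (simp add: power2_eq_square divide_inverse power_inverse mult_ac)
  qed
  have "((\<lambda>y::real. y ^ 0 / (1 + y) ^ Suc (Suc k)) has_integral G 1 - G 0) {0..1}"
    by (rule fundamental_theorem_of_calculus)
       (simp, unfold has_real_derivative_iff_has_vector_derivative[symmetric], rule der)
  from has_integral_unique[OF moment_int_has_integral this]
  have "moment_int 0 (Suc (Suc k)) = G 1 - G 0" .
  then show ?thesis
    by (simp add: G_def diff_divide_distrib inverse_eq_divide power_one_over del: of_nat_Suc)
qed

text \<open>Both terms of the recursion satisfy the hypothesis again, so it descends to l = 0, where
  the exponent is at least 2 and the antiderivative is a rational function.\<close>

lemma moment_int_rational: "l < k \<Longrightarrow> moment_int l (Suc k) \<in> \<rat>"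
proof (induction l arbitrary: k)
  case 0
  then show ?case by (cases k) (simp_all add: moment_int_0 del: power_Suc)
next
  case (Suc l)
  then obtain k' where "k = Suc k'" "l < k'" by (cases k) auto
  with Suc.IH[of k'] Suc.IH[of k] show ?case
    unfolding moment_int_rec by (auto intro: Rats_diff)
qed

text \<open>One term of the recursion is again diagonal and the other rational, so the logarithm
  from l = 0 is passed on with coefficient 1.\<close>

lemma moment_int_diag: "moment_int l (Suc l) - ln 2 \<in> \<rat>"
proof (induction l)
  case 0
  then show ?case using moment_int_0_1 by simp
next
  case (Suc l)
  have "moment_int (Suc l) (Suc (Suc l)) - ln 2 = (moment_int l (Suc l) - ln 2) - moment_int l (Suc (Suc l))"
    by (simp add: moment_int_rec)
  also have "\<dots> \<in> \<rat>"
    by (intro Rats_diff Suc moment_int_rational) simp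
  finally show ?case .
qed

text \<open>Here a is the arm length and t - 1 - a the leg length; the binomial coefficient counts
  the choices of occupied positions in the window of size a div 2. The division by 2 comes from the
  spacing 2 x of the odd weights.\<close>

definition hook_const :: "nat \<Rightarrow> real" where
  "hook_const t = (\<Sum>a<t. real ((a div 2) choose (t - 1 - a)) * moment_int (t - 1 - a) (Suc (a div 2))) / 2"

text \<open>The values of a + a div 2 are 3 q for a = 2 q and 3 q + 1 for a = 2 q + 1, so t - 1 is
  missed exactly when it is 2 modulo 3.\<close>

lemma div2_add_eq_iff: "(\<exists>a<t. t - 1 - a = a div 2) \<longleftrightarrow> t mod 3 \<noteq> 0" for t :: nat
proof
  assume "\<exists>a<t. t - 1 - a = a div 2"
  then show "t mod 3 \<noteq> 0" by presburger
next
  assume "t mod 3 \<noteq> 0"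
  moreover have "t mod 3 < 3" by simp
  ultimately have "t mod 3 = 1 \<or> t mod 3 = 2" by linarith
  then show "\<exists>a<t. t - 1 - a = a div 2"
  proof
    assume "t mod 3 = 1"
    then obtain q where "t = 3 * q + 1" by (metis mult_div_mod_eq)
    then have "2 * q < t \<and> t - 1 - 2 * q = 2 * q div 2" by simp
    then show ?thesis by blast
  next
    assume "t mod 3 = 2"
    then obtain q where "t = 3 * q + 2" by (metis mult_div_mod_eq)
    then have "2 * q + 1 < t \<and> t - 1 - (2 * q + 1) = (2 * q + 1) div 2" by simp
    then show ?thesis by blast
  qed
qed

lemma hook_const_form:
  "\<exists>r\<in>\<rat>. hook_const t = r + (if t mod 3 = 0 then 0 else ln 2 / 2)"
proof -
  define f where "f a = real ((a div 2) choose (t - 1 - a)) * moment_int (t - 1 - a) (Suc (a div 2))" for a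
  \<comment> \<open>If the leg is shorter than a div 2 the moment is rational; at equality the
    binomial coefficient is 1 and one ln 2 appears; beyond that the binomial coefficient is
    0.\<close>
  have rat: "f a - (if t - 1 - a = a div 2 then ln 2 else 0) \<in> \<rat>" for a
  proof (cases "t - 1 - a" "a div 2" rule: linorder_cases)
    case less
    then show ?thesis unfolding f_def by (auto intro!: Rats_mult moment_int_rational)
  next
    case equal
    then show ?thesis using moment_int_diag[of "a div 2"] by (simp add: f_def)
  next
    case greater
    then show ?thesis by (simp add: f_def binomial_eq_0)
  qed
  have "(\<Sum>a<t. if t - 1 - a = a div 2 then ln 2 else 0) = (if t mod 3 = 0 then 0 else ln 2 :: real)"
  proof (cases "t mod 3 = 0")
    case True
    then have "\<forall>a<t. t - 1 - a \<noteq> a div 2" using div2_add_eq_iff[of t] by metis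
    then have "(\<Sum>a<t. if t - 1 - a = a div 2 then ln 2 else 0) = (0 :: real)"
      by (intro sum.neutral) simp
    with True show ?thesis by simp
  next
    case False
    then obtain a where a: "a < t" "t - 1 - a = a div 2" using div2_add_eq_iff[of t] by metis
    \<comment> \<open>Since a + a div 2 is strictly increasing, two logarithms can neither add up
      nor cancel.\<close>
    have "b = a" if "b < t" "t - 1 - b = b div 2" for b
      using a that div_le_mono[of a b 2] div_le_mono[of b a 2] by linarith
    then have iff: "t - 1 - b = b div 2 \<longleftrightarrow> b = a" if "b \<in> {..<t}" for b
      using a that by blast
    have "(\<Sum>b<t. if t - 1 - b = b div 2 then ln 2 else 0) = (\<Sum>b<t. if b = a then ln 2 else 0 :: real)"
      by (rule sum.cong[OF refl]) (simp only: iff)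
    also have "\<dots> = ln 2"
      using a(1) by simp
    finally show ?thesis using False by simp
  qed
  then have "hook_const t = (\<Sum>a<t. f a - (if t - 1 - a = a div 2 then ln 2 else 0)) / 2
      + (if t mod 3 = 0 then 0 else ln 2 / 2)"
    unfolding hook_const_def f_def[symmetric] sum_subtractf by auto
  moreover have "(\<Sum>a<t. f a - (if t - 1 - a = a div 2 then ln 2 else 0)) / 2 \<in> \<rat>"
    using rat by (intro Rats_divide Rats_sum) auto
  ultimately show ?thesis by blast
qed

lemma hook_const_rational_iff: "hook_const t \<in> \<rat> \<longleftrightarrow> [t = 0] (mod 3)"
proof -
  obtain r where r: "r \<in> \<rat>" "hook_const t = r + (if t mod 3 = 0 then 0 else ln 2 / 2)"
    using hook_const_form by blast
  have "r + ln 2 / 2 \<notin> \<rat>"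
  proof
    assume "r + ln 2 / 2 \<in> \<rat>"
    then have "(r + ln 2 / 2 - r) * 2 \<in> \<rat>" using r(1) by (intro Rats_mult Rats_diff) auto
    then show False using ln2_irrational by simp
  qed
  with r show ?thesis by (simp add: cong_def)
qed

lemma hook_const_in_rat_log2_field: "hook_const t \<in> rat_log2_field"
proof -
  have add: "x + y \<in> rat_log2_field" if "x \<in> rat_log2_field" "y \<in> rat_log2_field" for x y
    using generate_field.eng_add[of x "ring_of_type_algebra :: real ring"] that
    unfolding rat_log2_field_def by (simp add: ring_of_type_algebra_def)
  have mult: "x * y \<in> rat_log2_field" if "x \<in> rat_log2_field" "y \<in> rat_log2_field" for x y
    using generate_field.eng_mult[of x "ring_of_type_algebra :: real ring"] that
    unfolding rat_log2_field_def by (simp add: ring_of_type_algebra_def)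
  have rat: "x \<in> rat_log2_field" if "x \<in> \<rat>" for x
    unfolding rat_log2_field_def using that by (intro generate_field.incl) simp
  have ln2: "ln 2 \<in> rat_log2_field"
    unfolding rat_log2_field_def by (intro generate_field.incl) simp
  obtain r where r: "r \<in> \<rat>" "hook_const t = r + (if t mod 3 = 0 then 0 else ln 2 / 2)"
    using hook_const_form by blast
  have "ln 2 * (1 / 2) \<in> rat_log2_field"
    by (rule mult[OF ln2 rat]) simp
  then have "r + ln 2 * (1 / 2) \<in> rat_log2_field"
    by (rule add[OF rat[OF r(1)]])
  moreover have "r \<in> rat_log2_field" by (rule rat[OF r(1)])
  ultimately show ?thesis by (simp add: r(2))
qed

text \<open>For a walk from \<open>0\<close> that adds \<open>3\<close> with probability \<open>y / (1 + y)\<close> and \<open>2\<close> otherwise,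
  this is the probability of visiting \<open>k\<close>.\<close>

definition renewal :: "real \<Rightarrow> nat \<Rightarrow> real" where
  "renewal y k = (\<Sum>j\<in>{j. 2 * j \<le> k}. real (j choose (k - 2 * j)) * y ^ (k - 2 * j) / (1 + y) ^ j)"

lemma finite_double_le: "finite {j. 2 * j \<le> (k::nat)}"
  by (rule finite_subset[of _ "{..k}"]) auto

text \<open>Conditioning on one step of the walk: size 2 leaves k + 1 to cover and size 3 leaves k.
  In the sum j is the number of steps, k - 2 j of them of size 3, and for each j the identity is
  Pascal's rule.\<close>

lemma renewal_rec:
  assumes "y \<ge> 0"
  shows "renewal y (k + 3) = renewal y (k + 1) / (1 + y) + y / (1 + y) * renewal y k"
proof -
  define f where "f k j = real (j choose (k - 2 * j)) * y ^ (k - 2 * j) / (1 + y) ^ j" for k j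
  have "{j. 2 * j \<le> k + 3} = insert 0 (Suc ` {j. 2 * j \<le> k + 1})"
  proof (rule Set.set_eqI)
    fix j show "j \<in> {j. 2 * j \<le> k + 3} \<longleftrightarrow> j \<in> insert 0 (Suc ` {j. 2 * j \<le> k + 1})"
      by (cases j) auto
  qed
  then have "renewal y (k + 3) = (\<Sum>j\<in>insert 0 (Suc ` {j. 2 * j \<le> k + 1}). f (k + 3) j)"
    unfolding renewal_def f_def by simp
  also have "\<dots> = f (k + 3) 0 + (\<Sum>j\<in>{j. 2 * j \<le> k + 1}. f (k + 3) (Suc j))"
    using finite_double_le[of "k + 1"] by (simp add: sum.reindex)
  also have "f (k + 3) 0 = 0"
    by (simp add: f_def)
  also have "(\<Sum>j\<in>{j. 2 * j \<le> k + 1}. f (k + 3) (Suc j))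
    = (\<Sum>j\<in>{j. 2 * j \<le> k + 1}. f (k + 1) j / (1 + y) + (if 2 * j \<le> k then y / (1 + y) * f k j else 0))"
  proof (rule sum.cong[OF refl])
    fix j assume "j \<in> {j. 2 * j \<le> k + 1}"
    then consider "2 * j = k + 1" | i where "k = 2 * j + i"
      by (metis le_Suc_ex le_SucE mem_Collect_eq Suc_eq_plus1)
    then show "f (k + 3) (Suc j) = f (k + 1) j / (1 + y) + (if 2 * j \<le> k then y / (1 + y) * f k j else 0)"
    proof cases
      case 1
      then have "k + 3 - 2 * Suc j = 0" "\<not> 2 * j \<le> k" "k + 1 - 2 * j = 0" by simp_all
      then show ?thesis by (simp add: f_def)
    next
      case 2
      then have "k + 3 - 2 * Suc j = Suc i" "2 * j \<le> k" "k + 1 - 2 * j = Suc i" "k - 2 * j = i" by simp_all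
      then show ?thesis
        using assms by (simp add: f_def divide_simps) (simp add: algebra_simps)
    qed
  qed
  also have "\<dots> = (\<Sum>j\<in>{j. 2 * j \<le> k + 1}. f (k + 1) j / (1 + y))
      + (\<Sum>j\<in>{j. 2 * j \<le> k}. y / (1 + y) * f k j)"
    unfolding sum.distrib
    by (intro arg_cong2[of _ _ _ _ "(+)"] refl sum.mono_neutral_cong_right finite_double_le) auto
  also have "\<dots> = renewal y (k + 1) / (1 + y) + y / (1 + y) * renewal y k"
    unfolding renewal_def f_def sum_divide_distrib sum_distrib_left by simp
  finally show ?thesis by simp
qed

lemma renewal_nonneg: "y \<ge> 0 \<Longrightarrow> 0 \<le> renewal y k"
  unfolding renewal_def by (intro sum_nonneg) auto

text \<open>The three summands are the probabilities of visiting \<open>k + 2\<close>, of visiting \<open>k + 1\<close>, and of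
  jumping from \<open>k\<close> over both.\<close>

lemma renewal_partition:
  assumes "y \<ge> 0"
  shows "renewal y (k + 2) + renewal y (k + 1) + y / (1 + y) * renewal y k = 1"
proof (induction k)
  case 0
  have "{j::nat. 2 * j \<le> 2} = {0, 1}" "{j::nat. 2 * j \<le> 1} = {0}" "{j::nat. 2 * j \<le> 0} = {0}" by auto
  then have "renewal y 2 = 1 / (1 + y)" "renewal y 1 = 0" "renewal y 0 = 1"
    by (simp_all add: renewal_def)
  then show ?case using assms by (simp add: add_divide_distrib[symmetric] numeral_2_eq_2)
next
  case (Suc k)
  have e: "renewal y (Suc k + 2) = renewal y (k + 1) / (1 + y) + y / (1 + y) * renewal y k"
    using renewal_rec[OF assms, of k] by (simp add: eval_nat_numeral)
  have "renewal y (k + 1) / (1 + y) + y / (1 + y) * renewal y (k + 1) = renewal y (k + 1)"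
    using assms by (simp add: divide_simps) (simp add: algebra_simps)
  with Suc e show ?case by simp
qed

text \<open>All steps have size at least 2, so the walk cannot visit both of two adjacent
  levels.\<close>

lemma renewal_add_le_1:
  assumes "y \<ge> 0"
  shows "renewal y (k + 1) + renewal y k \<le> 1"
proof (cases k)
  case 0
  have "{j::nat. 2 * j \<le> 1} = {0}" "{j::nat. 2 * j \<le> 0} = {0}" by auto
  then show ?thesis using 0 by (simp add: renewal_def)
next
  case (Suc k')
  have "0 \<le> y / (1 + y) * renewal y k'"
    using assms renewal_nonneg by simp
  with renewal_partition[OF assms, of k'] Suc show ?thesis by simp
qed

text \<open>For a = 2 j the leg is the number of steps of size 3 among j steps ending at t - 1; for
  a = 2 j + 1 the walk ends at t - 2. The sum is thus the probability of visiting one of two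
  adjacent levels.\<close>

lemma sum_hook_weights_le_1:
  assumes "y \<ge> 0"
  shows "(\<Sum>a<t. real ((a div 2) choose (t - 1 - a)) * y ^ (t - 1 - a) / (1 + y) ^ (a div 2)) \<le> 1"
proof -
  define f where "f a = real ((a div 2) choose (t - 1 - a)) * y ^ (t - 1 - a) / (1 + y) ^ (a div 2)" for a
  have fin: "finite {a. a < t \<and> even a}" "finite {a. a < t \<and> odd a}" by auto
  have "(\<Sum>a<t. f a) = (\<Sum>a\<in>{a. a < t \<and> even a} \<union> {a. a < t \<and> odd a}. f a)"
    by (rule sum.cong) auto
  also have "\<dots> = (\<Sum>a\<in>{a. a < t \<and> even a}. f a) + (\<Sum>a\<in>{a. a < t \<and> odd a}. f a)"
    by (rule sum.union_disjoint) (use fin in auto)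
  also have "\<dots> \<le> 1"
  proof (cases t)
    case (Suc k)
    have "(\<Sum>a\<in>{a. a < t \<and> even a}. f a) = (\<Sum>j\<in>{j. 2 * j \<le> k}. f (2 * j))"
      by (rule sum.reindex_bij_witness[of _ "\<lambda>j. 2 * j" "\<lambda>a. a div 2"]) (auto simp: Suc)
    also have "\<dots> = renewal y k"
      unfolding renewal_def f_def Suc by simp
    finally have even: "(\<Sum>a\<in>{a. a < t \<and> even a}. f a) = renewal y k" .
    show ?thesis
    proof (cases k)
      case 0
      have "{a. a < t \<and> odd a} = {}" using Suc 0 by (auto elim: oddE)
      then have "sum f {a. a < t \<and> odd a} = 0" by (simp only: sum.empty)
      moreover have "{j::nat. 2 * j \<le> 0} = {0}" by auto
      ultimately show ?thesis using even 0 by (simp add: renewal_def)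
    next
      case (Suc k')
      have "(\<Sum>a\<in>{a. a < t \<and> odd a}. f a) = (\<Sum>j\<in>{j. 2 * j \<le> k'}. f (2 * j + 1))"
        by (rule sum.reindex_bij_witness[of _ "\<lambda>j. 2 * j + 1" "\<lambda>a. a div 2"])
           (auto simp: Suc \<open>t = Suc k\<close> elim!: oddE)
      also have "\<dots> = renewal y k'"
        unfolding renewal_def f_def Suc \<open>t = Suc k\<close> by simp
      finally show ?thesis
        using even renewal_add_le_1[OF assms, of k'] Suc by simp
    qed
  qed (auto simp: f_def)
  finally show ?thesis by (simp add: f_def)
qed

lemma hook_const_less_half: "hook_const t < 1 / 2"
proof -
  have "((\<lambda>y::real. \<Sum>a<t. real ((a div 2) choose (t - 1 - a)) * (y ^ (t - 1 - a) / (1 + y) ^ Suc (a div 2)))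
      has_integral (\<Sum>a<t. real ((a div 2) choose (t - 1 - a)) * moment_int (t - 1 - a) (Suc (a div 2)))) {0..1}"
    by (intro has_integral_sum has_integral_mult_right moment_int_has_integral) auto
  then have "(\<Sum>a<t. real ((a div 2) choose (t - 1 - a)) * moment_int (t - 1 - a) (Suc (a div 2))) \<le> moment_int 0 1"
  proof (rule has_integral_le[OF _ moment_int_has_integral])
    fix y :: real assume "y \<in> {0..1}"
    then have y: "y \<ge> 0" by simp
    have "(\<Sum>a<t. real ((a div 2) choose (t - 1 - a)) * (y ^ (t - 1 - a) / (1 + y) ^ Suc (a div 2)))
      = (\<Sum>a<t. real ((a div 2) choose (t - 1 - a)) * y ^ (t - 1 - a) / (1 + y) ^ (a div 2)) / (1 + y)"
      unfolding sum_divide_distrib by (simp add: field_simps)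
    also have "\<dots> \<le> 1 / (1 + y)"
      using sum_hook_weights_le_1[OF y, of t] y by (intro divide_right_mono) auto
    finally show "(\<Sum>a<t. real ((a div 2) choose (t - 1 - a)) * (y ^ (t - 1 - a) / (1 + y) ^ Suc (a div 2)))
      \<le> y ^ 0 / (1 + y) ^ 1" by simp
  qed
  also have "\<dots> < 1"
    using moment_int_0_1 ln_2_less_1 by simp
  finally show ?thesis by (simp add: hook_const_def)
qed

subsection \<open>The logarithm of the partition function\<close>

text \<open>This is - Li_2 (- v), a primitive of ln (1 + v) / v.\<close>

definition alt_dilog :: "real \<Rightarrow> real" where
  "alt_dilog v = (\<Sum>k. (-1) ^ k / (real k + 1)\<^sup>2 * v ^ Suc k)"

lemma inverse_Suc_squares_sums: "(\<lambda>k. 1 / (real k + 1)\<^sup>2) sums (pi\<^sup>2 / 6)"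
  using inverse_squares_sums by (simp add: add.commute)

lemma summable_inverse_Suc_squares: "summable (\<lambda>k. 1 / (real k + 1)\<^sup>2)"
  using inverse_Suc_squares_sums by (rule sums_summable)

lemma norm_alt_dilog_term:
  assumes "\<bar>v\<bar> \<le> 1"
  shows "norm ((-1) ^ k / (real k + 1)\<^sup>2 * v ^ Suc k) \<le> 1 / (real k + 1)\<^sup>2"
proof -
  have "norm ((-1) ^ k / (real k + 1)\<^sup>2 * v ^ Suc k) = 1 / (real k + 1)\<^sup>2 * \<bar>v\<bar> ^ Suc k"
    by (simp add: norm_mult power_abs abs_mult)
  also have "\<dots> \<le> 1 / (real k + 1)\<^sup>2 * 1"
    by (rule mult_left_mono[OF power_le_one]) (use assms in auto)
  finally show ?thesis by simp
qed

text \<open>The endpoint v = 1, outside the disc in which the series is differentiated termwise, is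
  needed because the first cell of the Riemann sums starts at u = 0.\<close>

lemma continuous_on_alt_dilog: "continuous_on {0..1} alt_dilog"
proof -
  have "uniform_limit {0..1} (\<lambda>n v. \<Sum>k<n. (-1) ^ k / (real k + 1)\<^sup>2 * v ^ Suc k)
      (\<lambda>v. \<Sum>k. (-1) ^ k / (real k + 1)\<^sup>2 * v ^ Suc k) sequentially"
    by (rule Weierstrass_m_test[OF norm_alt_dilog_term summable_inverse_Suc_squares]) auto
  then show ?thesis
    unfolding alt_dilog_def[abs_def]
    by (rule uniform_limit_theorem[rotated]) (auto intro!: always_eventually continuous_intros)
qed

lemma has_real_derivative_alt_dilog:
  assumes "0 < v" "v < 1"
  shows "(alt_dilog has_real_derivative ln (1 + v) / v) (at v)"
proof -
  define c where "c n = (if n = 0 then 0 else (-1) ^ (n - 1) / (real n)\<^sup>2 :: real)" for n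
  have summ: "summable (\<lambda>n. c n * y ^ n)" if "\<bar>y\<bar> \<le> 1" for y
  proof -
    have "summable (\<lambda>k. (-1) ^ k / (real k + 1)\<^sup>2 * y ^ Suc k)"
      by (rule summable_comparison_test'[OF summable_inverse_Suc_squares, of 0])
         (use norm_alt_dilog_term[OF that] in auto)
    then have "summable (\<lambda>k. c (Suc k) * y ^ Suc k)"
      by (simp add: c_def add.commute)
    then show ?thesis by (subst (asm) summable_Suc_iff)
  qed
  have eq: "alt_dilog y = (\<Sum>n. c n * y ^ n)" if "\<bar>y\<bar> \<le> 1" for y
    using suminf_split_head[OF summ[OF that]] by (simp add: alt_dilog_def c_def add.commute)
  have "((\<lambda>y. \<Sum>n. c n * y ^ n) has_real_derivative (\<Sum>n. diffs c n * v ^ n)) (at v)"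
    by (rule termdiffs_strong[OF summ, of 1]) (use assms in auto)
  moreover have "eventually (\<lambda>y. y \<in> {0<..<1}) (nhds v)"
    by (rule eventually_nhds_in_open) (use assms in auto)
  then have "eventually (\<lambda>y. alt_dilog y = (\<Sum>n. c n * y ^ n)) (nhds v)"
    by (rule eventually_mono) (rule eq, auto)
  note DERIV_cong_ev[OF refl this refl]
  ultimately have "(alt_dilog has_real_derivative (\<Sum>n. diffs c n * v ^ n)) (at v)"
    by metis
  moreover have "(\<Sum>n. diffs c n * v ^ n) = ln (1 + v) / v"
  proof -
    have d: "diffs c n * v ^ n = (-1) ^ n * (1 / real (n + 1)) * v ^ Suc n / v" for n
    proof -
      have "diffs c n = (-1) ^ n * (1 / real (Suc n))"
        by (simp add: diffs_def c_def power2_eq_square del: of_nat_Suc)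
      then show ?thesis using assms by simp
    qed
    have "ln (1 + v) = (\<Sum>n. (-1) ^ n * (1 / real (n + 1)) * (1 + v - 1) ^ Suc n)"
      by (rule ln_series) (use assms in auto)
    moreover have "summable (\<lambda>n. (-1) ^ n * (1 / real (n + 1)) * v ^ Suc n)"
    proof (rule summable_comparison_test'[of "\<lambda>n. v ^ n" 0])
      show "summable (\<lambda>n. v ^ n)" using assms by (intro summable_geometric) auto
      fix n
      have "norm ((-1) ^ n * (1 / real (n + 1)) * v ^ Suc n) = 1 / real (n + 1) * v * v ^ n"
        using assms by (simp add: norm_mult power_abs abs_mult)
      also have "\<dots> \<le> 1 * v ^ n"
        using assms by (intro mult_right_mono mult_le_one) auto
      finally show "norm ((-1) ^ n * (1 / real (n + 1)) * v ^ Suc n) \<le> v ^ n" by simp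
    qed
    ultimately show ?thesis
      unfolding d by (simp only: suminf_divide add_diff_cancel_left')
  qed
  ultimately show ?thesis by simp
qed

lemma alt_dilog_0: "alt_dilog 0 = 0"
  by (simp add: alt_dilog_def)

lemma alt_dilog_1: "alt_dilog 1 = pi\<^sup>2 / 12"
proof -
  have "(\<lambda>n. (-1) ^ n / (real n + 1)\<^sup>2) sums (pi\<^sup>2 / 6 - pi\<^sup>2 / 12)"
  proof -
    \<comment> \<open>The alternating series is zeta(2) minus twice the terms with even denominator
      n + 1, and those sum to zeta(2) / 4 = pi^2 / 24.\<close>
    have "(\<lambda>n. 2 * (if odd n then 1 / (real n + 1)\<^sup>2 else 0)) sums (2 * (pi\<^sup>2 / 24))"
    proof (rule sums_mult)
      have "(\<lambda>k. 1 / 4 * (1 / (real k + 1)\<^sup>2)) sums (1 / 4 * (pi\<^sup>2 / 6))"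
        by (rule sums_mult[OF inverse_Suc_squares_sums])
      then have "(\<lambda>k. if odd (2 * k + 1) then 1 / (real (2 * k + 1) + 1)\<^sup>2 else 0) sums (pi\<^sup>2 / 24)"
        by (simp add: power2_eq_square field_simps)
      moreover have "strict_mono (\<lambda>k::nat. 2 * k + 1)"
        by (simp add: strict_mono_def)
      moreover have "(if odd n then 1 / (real n + 1)\<^sup>2 else 0) = 0" if "n \<notin> range (\<lambda>k. 2 * k + 1)" for n
      proof -
        have "even n"
        proof (rule ccontr)
          assume "odd n"
          then obtain k where "n = 2 * k + 1" by (rule oddE)
          with that show False by (metis rangeI)
        qed
        then show ?thesis by simp
      qed
      ultimately show "(\<lambda>n. if odd n then 1 / (real n + 1)\<^sup>2 else 0) sums (pi\<^sup>2 / 24)"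
        using sums_mono_reindex[of "\<lambda>k. 2 * k + 1" "\<lambda>n. if odd n then 1 / (real n + 1)\<^sup>2 else 0"] by simp
    qed
    from sums_diff[OF inverse_Suc_squares_sums this]
    have "(\<lambda>n. 1 / (real n + 1)\<^sup>2 - 2 * (if odd n then 1 / (real n + 1)\<^sup>2 else 0)) sums (pi\<^sup>2 / 6 - pi\<^sup>2 / 12)"
      by simp
    moreover have "(\<lambda>n. 1 / (real n + 1)\<^sup>2 - 2 * (if odd n then 1 / (real n + 1)\<^sup>2 else 0)) = (\<lambda>n. (-1) ^ n / (real n + 1)\<^sup>2)"
      by (rule ext) simp
    ultimately show ?thesis by simp
  qed
  from sums_unique[OF this] show ?thesis
    by (simp add: alt_dilog_def)
qed

text \<open>Mean value theorem from 0: the derivative ln (1 + z) / z lies between 0 and 1.\<close>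

lemma alt_dilog_bounds:
  assumes "0 \<le> v" "v \<le> 1"
  shows "0 \<le> alt_dilog v" "alt_dilog v \<le> v"
proof -
  have "0 \<le> alt_dilog v \<and> alt_dilog v \<le> v" if "0 < v"
  proof -
    have cont: "continuous_on {0..v} alt_dilog"
      by (rule continuous_on_subset[OF continuous_on_alt_dilog]) (use assms in auto)
    have "\<exists>l z. 0 < z \<and> z < v \<and> (alt_dilog has_real_derivative l) (at z) \<and> alt_dilog v - alt_dilog 0 = (v - 0) * l"
    proof (rule MVT[OF that cont])
      fix x assume "0 < x" "x < v"
      then show "alt_dilog differentiable at x"
        using has_real_derivative_alt_dilog[of x] assms real_differentiable_def by auto
    qed
    then obtain l z where z: "0 < z" "z < v" "(alt_dilog has_real_derivative l) (at z)"
      "alt_dilog v = v * l"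
      by (auto simp: alt_dilog_0)
    have "l = ln (1 + z) / z"
      using DERIV_unique[OF z(3) has_real_derivative_alt_dilog] z assms by simp
    moreover have "0 \<le> ln (1 + z)" "ln (1 + z) \<le> z"
      using z ln_add_one_self_le_self[of z] by auto
    ultimately have "0 \<le> l" "l \<le> 1" using z by auto
    with z that show ?thesis by (simp add: mult_left_le)
  qed
  then show "0 \<le> alt_dilog v" "alt_dilog v \<le> v"
    using assms alt_dilog_0 by (cases "v = 0"; auto)+
qed

text \<open>The integral of ln (1 + exp (- s)) over s >= u, of which the logarithm of the partition
  function is a Riemann sum.\<close>

definition dilog_exp :: "real \<Rightarrow> real" where
  "dilog_exp u = alt_dilog (exp (- u))"

lemma dilog_exp_0: "dilog_exp 0 = pi\<^sup>2 / 12"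
  by (simp add: dilog_exp_def alt_dilog_1)

lemma dilog_exp_bounds: "0 \<le> u \<Longrightarrow> 0 \<le> dilog_exp u" "0 \<le> u \<Longrightarrow> dilog_exp u \<le> exp (- u)"
  using alt_dilog_bounds[of "exp (- u)"] by (simp_all add: dilog_exp_def)

lemma continuous_on_dilog_exp: "continuous_on {0..} dilog_exp"
  unfolding dilog_exp_def[abs_def]
  by (rule continuous_on_compose2[OF continuous_on_alt_dilog]) (auto intro!: continuous_intros)

lemma has_real_derivative_dilog_exp:
  assumes "u > 0"
  shows "(dilog_exp has_real_derivative - ln (1 + exp (- u))) (at u)"
proof -
  have "((\<lambda>u. exp (- u)) has_real_derivative - exp (- u)) (at u)"
    by (auto intro!: derivative_eq_intros)
  moreover have "(alt_dilog has_real_derivative ln (1 + exp (- u)) / exp (- u)) (at (exp (- u)))"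
    by (rule has_real_derivative_alt_dilog) (use assms in auto)
  ultimately have "((\<lambda>u. alt_dilog (exp (- u))) has_real_derivative
      ln (1 + exp (- u)) / exp (- u) * - exp (- u)) (at u)"
    by (rule DERIV_chain2[rotated])
  then show ?thesis by (simp add: dilog_exp_def[abs_def])
qed

text \<open>The derivative of the difference of the two sides is the square of exp (x / 2) - exp (-
  x / 2).\<close>

lemma exp_minus_exp_ge: "0 \<le> h \<Longrightarrow> 2 * h \<le> exp h - exp (- h :: real)"
proof -
  assume h: "0 \<le> h"
  have "(\<lambda>h. exp h - exp (- h) - 2 * h) 0 \<le> (\<lambda>h. exp h - exp (- h :: real) - 2 * h) h"
  proof (rule DERIV_nonneg_imp_nondecreasing[OF h])
    fix x :: real
    have "0 \<le> (exp (x / 2) - exp (- (x / 2)))\<^sup>2" by simp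
    also have "\<dots> = exp x + exp (- x) - 2"
      by (simp add: power2_diff flip: exp_double exp_add)
    finally have "0 \<le> exp x + exp (- x) - 2" .
    moreover have "((\<lambda>h. exp h - exp (- h) - 2 * h) has_real_derivative exp x + exp (- x) - 2) (at x)"
      by (auto intro!: derivative_eq_intros)
    ultimately show "\<exists>y. ((\<lambda>h. exp h - exp (- h) - 2 * h) has_real_derivative y) (at x) \<and> 0 \<le> y"
      by blast
  qed
  then show ?thesis by simp
qed

lemma exp_plus_exp_le:
  assumes "0 \<le> h" "h \<le> (1::real)"
  shows "exp h + exp (- h) - 2 \<le> 2 * h\<^sup>2" "0 \<le> exp h + exp (- h) - 2"
proof -
  have "exp h \<le> 1 + h + h\<^sup>2" using exp_bound[of h] assms by simp
  moreover have "exp (- h) \<le> 1 - h + h\<^sup>2"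
  proof -
    have "exp (- h) = 1 / exp h" by (simp add: exp_minus inverse_eq_divide)
    also have "\<dots> \<le> 1 / (1 + h)"
      by (rule divide_left_mono) (use assms exp_ge_add_one_self[of h] in auto)
    also have "\<dots> \<le> 1 - h + h\<^sup>2"
    proof -
      have "(1 - h + h\<^sup>2) * (1 + h) = 1 + h ^ 3"
        by (simp add: power2_eq_square power3_eq_cube algebra_simps)
      then have "1 \<le> (1 - h + h\<^sup>2) * (1 + h)" using assms by simp
      then show ?thesis using assms by (simp add: divide_le_eq)
    qed
    finally show ?thesis .
  qed
  ultimately show "exp h + exp (- h) - 2 \<le> 2 * h\<^sup>2" by simp
  have "0 \<le> (exp (h / 2) - exp (- (h / 2)))\<^sup>2" by simp
  also have "\<dots> = exp h + exp (- h) - 2"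
    by (simp add: power2_diff flip: exp_double exp_add)
  finally show "0 \<le> exp h + exp (- h) - 2" .
qed

text \<open>Multiplied by 2 sinh h the sum telescopes, and sinh h >= h.\<close>

lemma sum_exp_odd_le:
  assumes "0 < h"
  shows "(\<Sum>m<N. exp (- (real (2 * m + 1) * h))) \<le> 1 / (2 * h)"
proof -
  define g where "g m = exp (- (real (2 * m) * h))" for m :: nat
  have "2 * h * (\<Sum>m<N. exp (- (real (2 * m + 1) * h))) = (\<Sum>m<N. exp (- (real (2 * m + 1) * h)) * (2 * h))"
    by (simp add: sum_distrib_left mult_ac)
  also have "\<dots> \<le> (\<Sum>m<N. g m - g (Suc m))"
  proof (rule sum_mono)
    fix m
    have "exp (- (real (2 * m + 1) * h)) * (2 * h) \<le> exp (- (real (2 * m + 1) * h)) * (exp h - exp (- h))"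
      by (intro mult_left_mono exp_minus_exp_ge) (use assms in auto)
    also have "\<dots> = g m - g (Suc m)"
      by (simp add: g_def right_diff_distrib algebra_simps flip: exp_add)
    finally show "exp (- (real (2 * m + 1) * h)) * (2 * h) \<le> g m - g (Suc m)" .
  qed
  also have "\<dots> = g 0 - g N" by (rule sum_lessThan_telescope')
  also have "\<dots> \<le> 1" by (simp add: g_def)
  finally show ?thesis using assms by (simp add: field_simps)
qed

text \<open>The error of the midpoint rule on the cell [c - h, c + h], differentiated with respect
  to the half-width, is a second difference of ln (1 + exp (- u)). The cubic order matters: about 1
  / h such errors are added and then divided by 2 h, so a quadratic error would leave an unknown
  constant factor in the partition function.\<close>

lemma dilog_exp_midpoint:
  assumes "0 < h" "h \<le> 1" "h \<le> c"
  shows "0 \<le> dilog_exp (c - h) - dilog_exp (c + h) - 2 * h * ln (1 + exp (- c))"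
    and "dilog_exp (c - h) - dilog_exp (c + h) - 2 * h * ln (1 + exp (- c)) \<le> 2 * h ^ 3 * exp (- c)"
proof -
  define E where "E \<tau> = dilog_exp (c - \<tau>) - dilog_exp (c + \<tau>) - 2 * \<tau> * ln (1 + exp (- c))" for \<tau>
  define E' where "E' \<tau> = ln (1 + exp (- (c - \<tau>))) + ln (1 + exp (- (c + \<tau>))) - 2 * ln (1 + exp (- c))" for \<tau>
  have der: "(E has_real_derivative E' \<tau>) (at \<tau>)" if "0 < \<tau>" "\<tau> < h" for \<tau>
  proof -
    have "((\<lambda>\<tau>. dilog_exp (c - \<tau>)) has_real_derivative - ln (1 + exp (- (c - \<tau>))) * - 1) (at \<tau>)"
      by (rule DERIV_chain2[OF has_real_derivative_dilog_exp]) (use that assms in \<open>auto intro!: derivative_eq_intros\<close>)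
    moreover have "((\<lambda>\<tau>. dilog_exp (c + \<tau>)) has_real_derivative - ln (1 + exp (- (c + \<tau>))) * 1) (at \<tau>)"
      by (rule DERIV_chain2[OF has_real_derivative_dilog_exp]) (use that assms in \<open>auto intro!: derivative_eq_intros\<close>)
    ultimately show ?thesis
      unfolding E_def E'_def by (auto intro!: derivative_eq_intros)
  qed
  have cont: "continuous_on {0..h} E"
    unfolding E_def
    by (intro continuous_intros continuous_on_compose2[OF continuous_on_dilog_exp]) (use assms in auto)
  have "\<exists>l z. 0 < z \<and> z < h \<and> (E has_real_derivative l) (at z) \<and> E h - E 0 = (h - 0) * l"
    by (rule MVT[OF assms(1) cont]) (use der real_differentiable_def in blast)
  then obtain l z where z: "0 < z" "z < h" "(E has_real_derivative l) (at z)" "E h - E 0 = h * l" by auto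
  have l: "l = E' z" using DERIV_unique[OF z(3) der] z by simp
  define a where "a = exp (- c)"
  have a: "a > 0" by (simp add: a_def)
  \<comment> \<open>The second difference of the logarithm turns out to be ln (1 + \<delta>);
    \<delta> is nonnegative and at most 2 a z^2, because 0 <= 2 cosh z - 2 <= 2 z^2.\<close>
  define \<delta> where "\<delta> = a * (exp z + exp (- z) - 2) / (1 + a)\<^sup>2"
  have "(1 + a * exp z) * (1 + a * exp (- z)) = 1 + a * (exp z + exp (- z)) + a * a * (exp z * exp (- z))"
    by (simp add: algebra_simps)
  also have "\<dots> = (1 + a)\<^sup>2 * (1 + \<delta>)"
  proof -
    have "(1 + a)\<^sup>2 * \<delta> = a * (exp z + exp (- z) - 2)"
      using a by (simp add: \<delta>_def)
    then have "(1 + a)\<^sup>2 * (1 + \<delta>) = (1 + a)\<^sup>2 + a * (exp z + exp (- z) - 2)"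
      by (simp add: distrib_left)
    moreover have "exp z * exp (- z) = 1" by (simp flip: exp_add)
    ultimately show ?thesis by (simp add: power2_eq_square algebra_simps)
  qed
  finally have prod: "(1 + a * exp z) * (1 + a * exp (- z)) = (1 + a)\<^sup>2 * (1 + \<delta>)" .
  have z1: "0 \<le> z" "z \<le> 1" using z assms by auto
  have d0: "0 \<le> \<delta>" unfolding \<delta>_def using a exp_plus_exp_le(2)[OF z1] by simp
  have pos: "0 < 1 + a * exp z" "0 < 1 + a * exp (- z)" "0 < 1 + a" "0 < 1 + \<delta>"
    using a d0 by (auto intro: add_pos_pos)
  have "l = ln (1 + a * exp z) + ln (1 + a * exp (- z)) - 2 * ln (1 + a)"
    unfolding l E'_def a_def exp_add[symmetric] by (simp add: add.commute)
  also have "\<dots> = ln ((1 + a * exp z) * (1 + a * exp (- z))) - 2 * ln (1 + a)"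
    using pos by (subst ln_mult) auto
  also have "\<dots> = ln (1 + \<delta>)"
    unfolding prod using pos by (subst ln_mult) (auto simp: ln_realpow)
  finally have leq: "l = ln (1 + \<delta>)" .
  have "\<delta> \<le> a * (exp z + exp (- z) - 2) / 1"
    unfolding \<delta>_def using a exp_plus_exp_le(2)[OF z1] by (intro divide_left_mono) auto
  also have "\<dots> \<le> a * (2 * z\<^sup>2)"
    using a exp_plus_exp_le(1)[OF z1] by simp
  also have "\<dots> \<le> a * (2 * h\<^sup>2)"
    using a z by (intro mult_left_mono power_mono) auto
  finally have "l \<le> a * (2 * h\<^sup>2)"
    using leq ln_add_one_self_le_self[OF d0] by simp
  moreover have "0 \<le> l" using leq d0 by simp
  moreover have "E h = h * l" using z by (simp add: E_def)
  ultimately have "0 \<le> E h" "E h \<le> h * (a * (2 * h\<^sup>2))" using assms by auto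
  then show "0 \<le> dilog_exp (c - h) - dilog_exp (c + h) - 2 * h * ln (1 + exp (- c))"
    "dilog_exp (c - h) - dilog_exp (c + h) - 2 * h * ln (1 + exp (- c)) \<le> 2 * h ^ 3 * exp (- c)"
    by (simp_all add: E_def a_def power2_eq_square power3_eq_cube mult_ac)
qed

text \<open>The cells around the odd multiples of h tile [0, 2 N h], so the integrals telescope to
  \<open>dilog_exp 0\<close> minus a tail. Neither a constant nor a logarithm of h remains, which is
  why the partition function contributes no power of n.\<close>

lemma sum_ln_one_plus_exp:
  assumes "0 < h" "h \<le> 1"
  shows "\<bar>(\<Sum>m<N. ln (1 + exp (- (real (2 * m + 1) * h)))) - pi\<^sup>2 / (24 * h)\<bar>
    \<le> h / 2 + exp (- (2 * real N * h)) / (2 * h)"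
proof -
  define c where "c m = real (2 * m + 1) * h" for m :: nat
  define P where "P m = dilog_exp (2 * real m * h)" for m :: nat
  have hc: "h \<le> c m" for m using assms by (simp add: c_def)
  have P: "dilog_exp (c m - h) = P m" "dilog_exp (c m + h) = P (Suc m)" for m
    by (simp_all add: P_def c_def algebra_simps)
  let ?S = "\<Sum>m<N. ln (1 + exp (- c m))"
  have S: "P 0 - P N - 2 * h * ?S = (\<Sum>m<N. P m - P (Suc m) - 2 * h * ln (1 + exp (- c m)))"
    by (simp add: sum_subtractf sum_distrib_left flip: sum_lessThan_telescope')
  have "0 \<le> P 0 - P N - 2 * h * ?S"
    unfolding S using dilog_exp_midpoint(1)[OF assms hc] by (intro sum_nonneg) (simp add: P)
  moreover have "P 0 - P N - 2 * h * ?S \<le> (\<Sum>m<N. 2 * h ^ 3 * exp (- c m))"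
    unfolding S using dilog_exp_midpoint(2)[OF assms hc] by (intro sum_mono) (simp add: P)
  moreover have "(\<Sum>m<N. 2 * h ^ 3 * exp (- c m)) \<le> 2 * h ^ 3 * (1 / (2 * h))"
    unfolding sum_distrib_left[symmetric] c_def
    by (intro mult_left_mono sum_exp_odd_le) (use assms in auto)
  moreover have "2 * h ^ 3 * (1 / (2 * h)) = h * h"
    using assms by (simp add: power3_eq_cube)
  moreover have "P 0 = pi\<^sup>2 / 12" by (simp add: P_def dilog_exp_0)
  moreover have "0 \<le> P N" "P N \<le> exp (- (2 * real N * h))"
    using dilog_exp_bounds[of "2 * real N * h"] assms by (simp_all add: P_def)
  ultimately have "\<bar>2 * h * ?S - pi\<^sup>2 / 12\<bar> \<le> h * h + exp (- (2 * real N * h))"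
    by linarith
  then have "\<bar>2 * h * ?S - pi\<^sup>2 / 12\<bar> / (2 * h) \<le> (h * h + exp (- (2 * real N * h))) / (2 * h)"
    using assms by (intro divide_right_mono) auto
  also have "\<bar>2 * h * ?S - pi\<^sup>2 / 12\<bar> / (2 * h) = \<bar>(2 * h * ?S - pi\<^sup>2 / 12) / (2 * h)\<bar>"
    using assms by simp
  also have "(2 * h * ?S - pi\<^sup>2 / 12) / (2 * h) = ?S - pi\<^sup>2 / (24 * h)"
    using assms by (simp add: field_simps)
  also have "(h * h + exp (- (2 * real N * h))) / (2 * h) = h / 2 + exp (- (2 * real N * h)) / (2 * h)"
    using assms by (simp add: field_simps)
  finally show ?thesis by (simp add: c_def)
qed

subsection \<open>Riemann sums for the mean and the variance\<close>

text \<open>At u = wt a * x, the probability that a belongs to the random set (Fermi-Dirac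
  statistics).\<close>

definition logistic :: "real \<Rightarrow> real" where
  "logistic u = 1 / (1 + exp u)"

lemma logistic_pos: "0 < logistic u"
  by (simp add: logistic_def add_pos_pos)

lemma logistic_less_1: "logistic u < 1"
  by (simp add: logistic_def divide_less_eq add_pos_pos)

lemma logistic_le_exp: "logistic u \<le> exp (- u)"
  by (simp add: logistic_def exp_minus inverse_eq_divide frac_le)

lemma logistic_altdef: "logistic u = exp (- u) / (1 + exp (- u))"
  by (simp add: logistic_def exp_minus field_simps)

lemma one_minus_logistic: "1 - logistic u = 1 / (1 + exp (- u))"
  by (simp add: logistic_def exp_minus divide_simps add_pos_pos less_imp_neq[symmetric])

lemma has_real_derivative_logistic:
  "(logistic has_real_derivative - (logistic u * (1 - logistic u))) (at u)"
proof -
  have ne: "1 + exp u \<noteq> 0" by (metis add_pos_pos exp_gt_zero less_irrefl zero_less_one)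
  have "(logistic has_real_derivative - exp u / (1 + exp u)\<^sup>2) (at u)"
    unfolding logistic_def[abs_def] using ne
    by (auto intro!: derivative_eq_intros simp: power2_eq_square)
  moreover have "1 - logistic u = exp u / (1 + exp u)"
    using ne by (simp add: logistic_def diff_divide_eq_iff)
  then have "- exp u / (1 + exp u)\<^sup>2 = - (logistic u * (1 - logistic u))"
    by (simp add: logistic_def power2_eq_square)
  ultimately show ?thesis by simp
qed

lemma continuous_on_logistic: "continuous_on S logistic"
  by (rule DERIV_continuous_on[OF has_field_derivative_at_within[OF has_real_derivative_logistic]])

text \<open>The derivative is bounded by exp (- lo) rather than by a constant, so that the resulting
  errors can be summed over all cells.\<close>

lemma logistic_lipschitz:
  assumes "lo \<le> u" "lo \<le> v"
  shows "\<bar>logistic u - logistic v\<bar> \<le> exp (- lo) * \<bar>u - v\<bar>"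
proof -
  have "norm (logistic u - logistic v) \<le> exp (- lo) * norm (u - v)"
  proof (rule field_differentiable_bound[of "{lo..}" _ "\<lambda>u. - (logistic u * (1 - logistic u))"])
    fix z :: real assume z: "z \<in> {lo..}"
    show "(logistic has_real_derivative - (logistic z * (1 - logistic z))) (at z within {lo..})"
      by (rule has_field_derivative_at_within[OF has_real_derivative_logistic])
    have "norm (- (logistic z * (1 - logistic z))) = logistic z * (1 - logistic z)"
      using logistic_pos[of z] logistic_less_1[of z] by (simp add: abs_mult)
    also have "\<dots> \<le> exp (- z) * 1"
      using logistic_pos[of z] logistic_less_1[of z] logistic_le_exp[of z] by (intro mult_mono) auto
    also have "\<dots> \<le> exp (- lo)" using z by simp
    finally show "norm (- (logistic z * (1 - logistic z))) \<le> exp (- lo)" .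
  qed (use assms in auto)
  then show ?thesis by simp
qed

lemma sum_exp_linear_le:
  assumes "0 < h" "h \<le> 1"
  shows "(\<Sum>m<N. exp (- (real m * h))) \<le> 2 / h"
proof -
  have "(\<Sum>m<N. exp (- (real m * h))) = exp (h / 2) * (\<Sum>m<N. exp (- (real (2 * m + 1) * (h / 2))))"
    unfolding sum_distrib_left exp_add[symmetric] by (intro sum.cong refl arg_cong[of _ _ exp]) (simp add: algebra_simps)
  also have "\<dots> \<le> 2 * (1 / (2 * (h / 2)))"
  proof (intro mult_mono sum_exp_odd_le)
    have "exp (h / 2) \<le> 1 + h / 2 + (h / 2)\<^sup>2"
      using assms by (intro exp_bound) auto
    also have "\<dots> \<le> 1 + 1 / 2 + (1 / 2)\<^sup>2"
      using assms by (intro add_mono power_mono) auto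
    also have "\<dots> \<le> 2" by (simp add: power2_eq_square)
    finally show "exp (h / 2) \<le> 2" .
  qed (use assms in \<open>auto intro!: sum_nonneg\<close>)
  finally show ?thesis by simp
qed

text \<open>The samples y only have to be close to g on their cell, because later they are products
  of factors taken at several neighbouring points. The mean value theorem turns each cell integral
  into 2 h times a value of g, and the weights exp (- m h) sum to at most 2 / h, whence 4 C
  h.\<close>

lemma riemann_sum_cells:
  fixes G g :: "real \<Rightarrow> real"
  assumes der: "\<And>u. 0 < u \<Longrightarrow> (G has_real_derivative g u) (at u)"
    and cont: "continuous_on {0..} G" and h: "0 < h" "h \<le> 1" and C: "0 \<le> C"
    and close: "\<And>m \<xi>. m < N \<Longrightarrow> 2 * real m * h < \<xi> \<Longrightarrow> \<xi> < 2 * (real m + 1) * h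
      \<Longrightarrow> \<bar>y m - g \<xi>\<bar> \<le> C * h * exp (- (real m * h))"
  shows "\<bar>2 * h * (\<Sum>m<N. y m) - (G (2 * real N * h) - G 0)\<bar> \<le> 4 * C * h"
proof -
  define P where "P m = G (2 * real m * h)" for m :: nat
  have cell: "\<bar>2 * h * y m - (P (Suc m) - P m)\<bar> \<le> 2 * h * (C * h * exp (- (real m * h)))" if "m < N" for m
  proof -
    let ?a = "2 * real m * h" and ?b = "2 * (real m + 1) * h"
    have ab: "?a < ?b" using h by (simp add: algebra_simps)
    have "\<exists>l z. ?a < z \<and> z < ?b \<and> (G has_real_derivative l) (at z) \<and> G ?b - G ?a = (?b - ?a) * l"
    proof (rule MVT[OF ab])
      show "continuous_on {?a..?b} G"
        by (rule continuous_on_subset[OF cont]) (use h in auto)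
      fix x assume "?a < x" "x < ?b"
      moreover have "0 \<le> ?a" using h by simp
      ultimately show "G differentiable at x"
        using der[of x] real_differentiable_def by fastforce
    qed
    then obtain l z where z: "?a < z" "z < ?b" "(G has_real_derivative l) (at z)" "G ?b - G ?a = (?b - ?a) * l"
      by blast
    have "0 \<le> ?a" using h by simp
    then have "l = g z" using DERIV_unique[OF z(3) der] z(1) by linarith
    moreover have "?b - ?a = 2 * h" by (simp add: algebra_simps)
    ultimately have "P (Suc m) - P m = 2 * h * g z"
      using z(4) by (simp add: P_def algebra_simps)
    then have "\<bar>2 * h * y m - (P (Suc m) - P m)\<bar> = 2 * h * \<bar>y m - g z\<bar>"
      using h by (simp add: abs_mult flip: right_diff_distrib)
    also have "\<dots> \<le> 2 * h * (C * h * exp (- (real m * h)))"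
      using close[OF that z(1,2)] h by (intro mult_left_mono) auto
    finally show ?thesis .
  qed
  have "2 * h * (\<Sum>m<N. y m) - (P N - P 0) = (\<Sum>m<N. 2 * h * y m - (P (Suc m) - P m))"
    by (simp add: sum_subtractf sum_distrib_left flip: sum_lessThan_telescope)
  also have "\<bar>\<dots>\<bar> \<le> (\<Sum>m<N. 2 * h * (C * h * exp (- (real m * h))))"
    by (rule order_trans[OF sum_abs sum_mono]) (use cell in simp)
  also have "\<dots> = 2 * h * (C * h) * (\<Sum>m<N. exp (- (real m * h)))"
    by (simp add: sum_distrib_left mult_ac)
  also have "\<dots> \<le> 2 * h * (C * h) * (2 / h)"
    by (intro mult_left_mono sum_exp_linear_le) (use h C in auto)
  also have "\<dots> = 4 * C * h" using h by simp
  finally show ?thesis by (simp add: P_def)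
qed

text \<open>On cell m one has u / 2 > m h, so the bound on g' yields the weight exp (- m h). Asking
  only for exp (- u / 2) leaves the other half of the exponential to absorb powers of u.\<close>

lemma riemann_sum_midpoint:
  fixes G g g' :: "real \<Rightarrow> real"
  assumes der: "\<And>u. 0 < u \<Longrightarrow> (G has_real_derivative g u) (at u)"
    and cont: "continuous_on {0..} G" and h: "0 < h" "h \<le> 1" and C: "0 \<le> C"
    and der': "\<And>u. 0 < u \<Longrightarrow> (g has_real_derivative g' u) (at u)"
    and bound: "\<And>u. 0 < u \<Longrightarrow> \<bar>g' u\<bar> \<le> C * exp (- (u / 2))"
  shows "\<bar>2 * h * (\<Sum>m<N. g (real (wt m) * h)) - (G (2 * real N * h) - G 0)\<bar> \<le> 4 * C * h"
proof (rule riemann_sum_cells[OF der cont h C])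
  fix m \<xi> assume \<xi>: "2 * real m * h < \<xi>" "\<xi> < 2 * (real m + 1) * h"
  let ?S = "{2 * real m * h<..<2 * (real m + 1) * h}"
  have pos: "0 \<le> 2 * real m * h" using h by simp
  have c: "2 * real m * h < real (wt m) * h" "real (wt m) * h < 2 * (real m + 1) * h"
    using h by (auto simp: wt_def)
  have "norm (g (real (wt m) * h) - g \<xi>) \<le> (C * exp (- (real m * h))) * norm (real (wt m) * h - \<xi>)"
  proof (rule field_differentiable_bound[of ?S g g'])
    fix z assume z: "z \<in> ?S"
    have "2 * real m * h < z" using z by (simp only: greaterThanLessThan_iff)
    with pos have "0 < z" by (rule order_le_less_trans)
    then show "(g has_real_derivative g' z) (at z within ?S)"
      by (rule has_field_derivative_at_within[OF der'])
    have "\<bar>g' z\<bar> \<le> C * exp (- (z / 2))" using \<open>0 < z\<close> by (rule bound)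
    also have "\<dots> \<le> C * exp (- (real m * h))" using \<open>2 * real m * h < z\<close> C by (intro mult_left_mono) auto
    finally show "norm (g' z) \<le> C * exp (- (real m * h))" by simp
  qed (use \<xi> c in auto)
  also have "\<dots> \<le> (C * exp (- (real m * h))) * h"
  proof (rule mult_left_mono)
    show "norm (real (wt m) * h - \<xi>) \<le> h"
      using \<xi> by (simp add: wt_def abs_le_iff algebra_simps)
  qed (use C in auto)
  finally show "\<bar>g (real (wt m) * h) - g \<xi>\<bar> \<le> C * h * exp (- (real m * h))"
    by (simp add: mult_ac)
qed

text \<open>Integration by parts of u * \<open>logistic\<close> u, normalized to vanish at infinity;
  the whole integral is minus the value at 0.\<close>

definition mean_primitive :: "real \<Rightarrow> real" where
  "mean_primitive u = - u * ln (1 + exp (- u)) - dilog_exp u"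

lemma has_real_derivative_mean_primitive:
  assumes "0 < u"
  shows "(mean_primitive has_real_derivative u * logistic u) (at u)"
proof -
  have "0 < 1 + exp (- u)" by (simp add: add_pos_pos)
  then have "((\<lambda>u. ln (1 + exp (- u))) has_real_derivative - logistic u) (at u)"
    by (auto intro!: derivative_eq_intros simp: logistic_altdef)
  from DERIV_diff[OF DERIV_mult[OF DERIV_minus[OF DERIV_ident] this] has_real_derivative_dilog_exp[OF assms]]
  show ?thesis
    unfolding mean_primitive_def[abs_def] by (simp add: algebra_simps)
qed

lemma continuous_on_mean_primitive: "continuous_on {0..} mean_primitive"
  unfolding mean_primitive_def[abs_def]
  by (intro continuous_intros continuous_on_dilog_exp) (auto simp: add_pos_pos less_imp_neq[symmetric])

lemma mean_primitive_0: "mean_primitive 0 = - (pi\<^sup>2 / 12)"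
  by (simp add: mean_primitive_def dilog_exp_0)

lemma mean_primitive_bound:
  assumes "0 \<le> u"
  shows "\<bar>mean_primitive u\<bar> \<le> (u + 1) * exp (- u)"
proof -
  have "0 \<le> ln (1 + exp (- u))" "ln (1 + exp (- u)) \<le> exp (- u)"
    using ln_add_one_self_le_self[of "exp (- u)"] by auto
  then have "0 \<le> u * ln (1 + exp (- u))" "u * ln (1 + exp (- u)) \<le> u * exp (- u)"
    using assms by (auto intro: mult_left_mono)
  then show ?thesis
    using dilog_exp_bounds[OF assms] by (simp add: mean_primitive_def distrib_right)
qed

text \<open>This is the mean of the weight. Its error of order 1 / h is negligible against the
  standard deviation, of order h^(-3/2).\<close>

lemma sum_wt_logistic:
  assumes h: "0 < h" "h \<le> 1"
  shows "\<bar>(\<Sum>a<N. real (wt a) * logistic (real (wt a) * h)) - pi\<^sup>2 / (24 * h\<^sup>2)\<bar>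
    \<le> (8 * h + (2 * real N * h + 1) * exp (- (2 * real N * h))) / (2 * h\<^sup>2)"
proof -
  let ?S = "\<Sum>a<N. real (wt a) * logistic (real (wt a) * h)"
  have "\<bar>2 * h * (\<Sum>a<N. real (wt a) * h * logistic (real (wt a) * h))
      - (mean_primitive (2 * real N * h) - mean_primitive 0)\<bar> \<le> 4 * 2 * h"
  proof (rule riemann_sum_midpoint[OF has_real_derivative_mean_primitive continuous_on_mean_primitive h])
    fix u :: real assume u: "0 < u"
    show "((\<lambda>u. u * logistic u) has_real_derivative logistic u - u * (logistic u * (1 - logistic u))) (at u)"
      by (auto intro!: derivative_eq_intros has_real_derivative_logistic)
    have L: "0 \<le> logistic u * (1 - logistic u)" "logistic u * (1 - logistic u) \<le> logistic u"
      using logistic_pos[of u] logistic_less_1[of u] by (auto simp: mult_left_le)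
    have "0 \<le> u * (logistic u * (1 - logistic u))" "u * (logistic u * (1 - logistic u)) \<le> u * logistic u"
      using u L by (auto intro: mult_left_mono mult_nonneg_nonneg)
    then have "\<bar>logistic u - u * (logistic u * (1 - logistic u))\<bar> \<le> logistic u + u * logistic u"
      using logistic_pos[of u] by linarith
    also have "\<dots> = (1 + u) * logistic u" by (simp add: distrib_right)
    also have "\<dots> \<le> (2 * exp (u / 2)) * exp (- u)"
    proof (rule mult_mono[OF _ logistic_le_exp])
      show "1 + u \<le> 2 * exp (u / 2)" using exp_ge_add_one_self[of "u / 2"] u by linarith
    qed (use logistic_pos[of u] in auto)
    also have "\<dots> = 2 * exp (- (u / 2))" by (simp flip: exp_add)
    finally show "\<bar>logistic u - u * (logistic u * (1 - logistic u))\<bar> \<le> 2 * exp (- (u / 2))" .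
  qed auto
  moreover have "2 * h * (\<Sum>a<N. real (wt a) * h * logistic (real (wt a) * h)) = 2 * h\<^sup>2 * ?S"
    by (simp add: sum_distrib_left power2_eq_square mult_ac)
  moreover have "\<bar>mean_primitive (2 * real N * h)\<bar> \<le> (2 * real N * h + 1) * exp (- (2 * real N * h))"
    by (rule mean_primitive_bound) (use h in auto)
  ultimately have "\<bar>2 * h\<^sup>2 * ?S - pi\<^sup>2 / 12\<bar> \<le> 8 * h + (2 * real N * h + 1) * exp (- (2 * real N * h))"
    using mean_primitive_0 by linarith
  then have "\<bar>2 * h\<^sup>2 * ?S - pi\<^sup>2 / 12\<bar> / (2 * h\<^sup>2)
      \<le> (8 * h + (2 * real N * h + 1) * exp (- (2 * real N * h))) / (2 * h\<^sup>2)"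
    by (rule divide_right_mono) simp
  also have "\<bar>2 * h\<^sup>2 * ?S - pi\<^sup>2 / 12\<bar> / (2 * h\<^sup>2) = \<bar>(2 * h\<^sup>2 * ?S - pi\<^sup>2 / 12) / (2 * h\<^sup>2)\<bar>"
    by simp
  also have "(2 * h\<^sup>2 * ?S - pi\<^sup>2 / 12) / (2 * h\<^sup>2) = ?S - pi\<^sup>2 / (24 * h\<^sup>2)"
    using h by (simp add: diff_divide_distrib)
  finally show ?thesis .
qed

text \<open>The variance of the weight. As \<open>logistic\<close> has derivative -
  \<open>logistic\<close> * (1 - \<open>logistic\<close>), integration by parts reduces the integral
  to twice that of the mean.\<close>

lemma sum_wt_logistic_variance:
  assumes h: "0 < h" "h \<le> 1"
  shows "\<bar>(\<Sum>a<N. (real (wt a))\<^sup>2 * (logistic (real (wt a) * h) * (1 - logistic (real (wt a) * h)))) - pi\<^sup>2 / (12 * h ^ 3)\<bar>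
    \<le> (32 * h + ((2 * real N * h)\<^sup>2 + 2 * (2 * real N * h + 1)) * exp (- (2 * real N * h))) / (2 * h ^ 3)"
proof -
  let ?S = "\<Sum>a<N. (real (wt a))\<^sup>2 * (logistic (real (wt a) * h) * (1 - logistic (real (wt a) * h)))"
  let ?G = "\<lambda>u. 2 * mean_primitive u - u\<^sup>2 * logistic u"
  let ?g = "\<lambda>u. u\<^sup>2 * (logistic u * (1 - logistic u))"
  let ?U = "2 * real N * h"
  have "\<bar>2 * h * (\<Sum>a<N. ?g (real (wt a) * h)) - (?G ?U - ?G 0)\<bar> \<le> 4 * 8 * h"
  proof (rule riemann_sum_midpoint[OF _ _ h])
    show "continuous_on {0..} ?G"
      by (intro continuous_intros continuous_on_mean_primitive continuous_on_logistic)
    fix u :: real assume u: "0 < u"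
    show "(?G has_real_derivative ?g u) (at u)"
      by (auto intro!: derivative_eq_intros has_real_derivative_logistic has_real_derivative_mean_primitive[OF u])
    let ?L = "logistic u * (1 - logistic u)"
    show "(?g has_real_derivative 2 * u * ?L - u\<^sup>2 * (?L * (1 - 2 * logistic u))) (at u)"
      by (auto intro!: derivative_eq_intros has_real_derivative_logistic simp: algebra_simps power2_eq_square)
    have L: "0 \<le> ?L" "?L \<le> logistic u"
      using logistic_pos[of u] logistic_less_1[of u] by (auto simp: mult_left_le)
    have "\<bar>?L * (1 - 2 * logistic u)\<bar> \<le> logistic u * 1"
      unfolding abs_mult using L logistic_pos[of u] logistic_less_1[of u] by (intro mult_mono) auto
    then have "\<bar>u\<^sup>2 * (?L * (1 - 2 * logistic u))\<bar> \<le> u\<^sup>2 * logistic u"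
      unfolding abs_mult[of "u\<^sup>2"] by (simp add: mult_left_mono)
    moreover have "\<bar>2 * u * ?L\<bar> \<le> 2 * u * logistic u"
      using u L by (simp add: abs_mult mult_left_mono)
    ultimately have "\<bar>2 * u * ?L - u\<^sup>2 * (?L * (1 - 2 * logistic u))\<bar> \<le> 2 * u * logistic u + u\<^sup>2 * logistic u"
      by linarith
    also have "\<dots> = (2 * u + u\<^sup>2) * logistic u" by (simp add: distrib_right)
    also have "\<dots> \<le> (8 * exp (u / 2)) * exp (- u)"
    proof (rule mult_mono[OF _ logistic_le_exp])
      have "1 + u / 2 + (u / 2)\<^sup>2 / 2 \<le> exp (u / 2)" by (rule exp_lower_Taylor_quadratic) (use u in simp)
      then show "2 * u + u\<^sup>2 \<le> 8 * exp (u / 2)" using u by (simp add: power_divide)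
    qed (use logistic_pos[of u] in auto)
    also have "\<dots> = 8 * exp (- (u / 2))" by (simp flip: exp_add)
    finally show "\<bar>2 * u * ?L - u\<^sup>2 * (?L * (1 - 2 * logistic u))\<bar> \<le> 8 * exp (- (u / 2))" .
  qed auto
  moreover have "2 * h * (\<Sum>a<N. ?g (real (wt a) * h)) = 2 * h ^ 3 * ?S"
    unfolding sum_distrib_left
    by (rule sum.cong[OF refl]) (simp only: power2_eq_square power3_eq_cube mult_ac)
  moreover have U: "0 \<le> ?U" using h by simp
  have "?U\<^sup>2 * logistic ?U \<le> ?U\<^sup>2 * exp (- ?U)" "0 \<le> ?U\<^sup>2 * logistic ?U"
    using logistic_pos[of ?U] by (auto intro!: mult_left_mono logistic_le_exp)
  moreover note mean_primitive_bound[OF U]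
  ultimately have "\<bar>2 * h ^ 3 * ?S - pi\<^sup>2 / 6\<bar> \<le> 32 * h + (?U\<^sup>2 * exp (- ?U) + 2 * ((?U + 1) * exp (- ?U)))"
    using mean_primitive_0 by simp
  also have "\<dots> = 32 * h + (?U\<^sup>2 + 2 * (?U + 1)) * exp (- ?U)"
    by (simp add: distrib_right)
  finally have "\<bar>2 * h ^ 3 * ?S - pi\<^sup>2 / 6\<bar> / (2 * h ^ 3)
      \<le> (32 * h + (?U\<^sup>2 + 2 * (?U + 1)) * exp (- ?U)) / (2 * h ^ 3)"
    by (rule divide_right_mono) (use h in simp)
  also have "\<bar>2 * h ^ 3 * ?S - pi\<^sup>2 / 6\<bar> / (2 * h ^ 3) = \<bar>(2 * h ^ 3 * ?S - pi\<^sup>2 / 6) / (2 * h ^ 3)\<bar>"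
    using h by simp
  also have "(2 * h ^ 3 * ?S - pi\<^sup>2 / 6) / (2 * h ^ 3) = ?S - pi\<^sup>2 / (12 * h ^ 3)"
    using h by (simp add: diff_divide_distrib)
  finally show ?thesis .
qed

text \<open>Half of the exponential absorbs the power, by u^k / k! <= exp u with u = wt a * h / 2;
  the other half is summed as before.\<close>

lemma sum_wt_power_exp_le:
  assumes h: "0 < h"
  shows "(\<Sum>a<N. real (wt a) ^ k * exp (- (real (wt a) * h))) \<le> fact k * 2 ^ k / h ^ Suc k"
proof -
  have "(\<Sum>a<N. real (wt a) ^ k * exp (- (real (wt a) * h)))
      \<le> (\<Sum>a<N. fact k * (2 / h) ^ k * exp (- (real (2 * a + 1) * (h / 2))))"
  proof (rule sum_mono)
    fix a
    let ?u = "real (wt a) * (h / 2)"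
    have u: "0 \<le> ?u" using h by simp
    have "?u ^ k / fact k \<le> exp ?u"
    proof -
      have "(\<Sum>i\<in>{k}. ?u ^ i /\<^sub>R fact i) \<le> (\<Sum>i. ?u ^ i /\<^sub>R fact i)"
        by (rule sum_le_suminf[OF summable_exp_generic]) (use u in auto)
      then have "?u ^ k /\<^sub>R fact k \<le> exp ?u"
        unfolding exp_def by (simp only: sum.insert sum.empty finite.emptyI empty_iff not_False_eq_True add_0_right)
      then show ?thesis by (simp only: scaleR_conv_of_real of_real_inverse divide_inverse mult.commute of_real_fact of_real_eq_id id_apply)
    qed
    then have "?u ^ k \<le> fact k * exp ?u" by (simp add: field_simps)
    then have "(2 / h) ^ k * ?u ^ k \<le> (2 / h) ^ k * (fact k * exp ?u)"
      using h by (intro mult_left_mono) auto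
    moreover have "(2 / h) ^ k * ?u ^ k = real (wt a) ^ k"
      using h by (simp flip: power_mult_distrib)
    ultimately have "real (wt a) ^ k * exp (- (real (wt a) * h)) \<le> (2 / h) ^ k * (fact k * exp ?u) * exp (- (real (wt a) * h))"
      by (intro mult_right_mono) auto
    also have "\<dots> = fact k * (2 / h) ^ k * (exp ?u * exp (- (real (wt a) * h)))" by simp
    also have "exp ?u * exp (- (real (wt a) * h)) = exp (- (real (2 * a + 1) * (h / 2)))"
      by (simp add: wt_def flip: exp_add)
    finally show "real (wt a) ^ k * exp (- (real (wt a) * h)) \<le> fact k * (2 / h) ^ k * exp (- (real (2 * a + 1) * (h / 2)))" .
  qed
  also have "\<dots> \<le> fact k * (2 / h) ^ k * (1 / (2 * (h / 2)))"
    unfolding sum_distrib_left[symmetric] by (intro mult_left_mono sum_exp_odd_le) (use h in auto)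
  also have "\<dots> = fact k * 2 ^ k / h ^ Suc k"
    using h by (simp add: power_divide)
  finally show ?thesis .
qed

section \<open>Expected number of pattern occurrences\<close>

text \<open>For disjoint I and J, the probability that the random set contains I and avoids
  J.\<close>

definition pattern_weight :: "real \<Rightarrow> nat set \<Rightarrow> nat set \<Rightarrow> real" where
  "pattern_weight x I J =
     (\<Prod>a\<in>I. logistic (real (wt a) * x)) * (\<Prod>a\<in>J. 1 - logistic (real (wt a) * x))"

lemma pattern_weight_nonneg: "0 \<le> pattern_weight x I J"
  unfolding pattern_weight_def using logistic_pos logistic_less_1
  by (intro mult_nonneg_nonneg prod_nonneg) (auto intro: less_imp_le)

text \<open>Keeping only the factor of one required element suffices to make the sums over m of
  order 1 / x.\<close>

lemma pattern_weight_le_exp: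
  assumes "finite I" "m \<in> I"
  shows "pattern_weight x I J \<le> exp (- (real (wt m) * x))"
proof -
  have L: "0 \<le> logistic u" "logistic u \<le> 1" for u
    using logistic_pos[of u] logistic_less_1[of u] by auto
  have "pattern_weight x I J
      = logistic (real (wt m) * x) * ((\<Prod>a\<in>I - {m}. logistic (real (wt a) * x)) * (\<Prod>a\<in>J. 1 - logistic (real (wt a) * x)))"
    unfolding pattern_weight_def by (simp add: prod.remove[OF assms])
  also have "\<dots> \<le> exp (- (real (wt m) * x)) * (1 * 1)"
    using L by (intro mult_mono logistic_le_exp prod_le_1 mult_nonneg_nonneg prod_nonneg) auto
  finally show ?thesis by simp
qed

text \<open>All factors lie in [0, 1], so the difference of the products is at most the sum of the
  differences of the factors.\<close>

lemma logistic_prod_diff: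
  assumes "finite I" "finite J" "I \<inter> J = {}" "lo \<le> \<xi>"
    and u: "\<And>a. a \<in> I \<union> J \<Longrightarrow> lo \<le> u a \<and> \<bar>u a - \<xi>\<bar> \<le> \<delta>"
  shows "\<bar>(\<Prod>a\<in>I. logistic (u a)) * (\<Prod>a\<in>J. 1 - logistic (u a))
      - logistic \<xi> ^ card I * (1 - logistic \<xi>) ^ card J\<bar> \<le> real (card (I \<union> J)) * (exp (- lo) * \<delta>)"
proof -
  define f where "f v a = (if a \<in> I then logistic v else 1 - logistic v)" for v and a :: 'a
  have f: "(\<Prod>a\<in>I \<union> J. f (v a) a) = (\<Prod>a\<in>I. logistic (v a)) * (\<Prod>a\<in>J. 1 - logistic (v a))" for v
  proof -
    have "(\<Prod>a\<in>I \<union> J. f (v a) a) = (\<Prod>a\<in>I. f (v a) a) * (\<Prod>a\<in>J. f (v a) a)"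
      by (rule prod.union_disjoint[OF assms(1-3)])
    also have "(\<Prod>a\<in>J. f (v a) a) = (\<Prod>a\<in>J. 1 - logistic (v a))"
      using assms(3) by (intro prod.cong) (auto simp: f_def)
    finally show ?thesis by (simp add: f_def)
  qed
  have le1: "norm (f v a) \<le> 1" for v a
    using logistic_pos[of v] logistic_less_1[of v] by (auto simp: f_def)
  have "norm ((\<Prod>a\<in>I \<union> J. f (u a) a) - (\<Prod>a\<in>I \<union> J. f \<xi> a)) \<le> (\<Sum>a\<in>I \<union> J. norm (f (u a) a - f \<xi> a))"
    by (rule norm_prod_diff[OF le1 le1])
  also have "\<dots> \<le> (\<Sum>a\<in>I \<union> J. exp (- lo) * \<delta>)"
  proof (rule sum_mono)
    fix a assume a: "a \<in> I \<union> J"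
    have "norm (f (u a) a - f \<xi> a) = \<bar>logistic (u a) - logistic \<xi>\<bar>"
      by (auto simp: f_def)
    also have "\<dots> \<le> exp (- lo) * \<bar>u a - \<xi>\<bar>"
      by (rule logistic_lipschitz) (use u[OF a] assms(4) in auto)
    also have "\<dots> \<le> exp (- lo) * \<delta>"
      using u[OF a] by (intro mult_left_mono) auto
    finally show "norm (f (u a) a - f \<xi> a) \<le> exp (- lo) * \<delta>" .
  qed
  finally show ?thesis
    unfolding f f[of "\<lambda>_. \<xi>"] by simp
qed

definition saddle :: "nat \<Rightarrow> real" where
  "saddle n = pi / sqrt (24 * real n)"

lemma saddle_pos: "0 < n \<Longrightarrow> 0 < saddle n"
  by (simp add: saddle_def)

lemma saddle_tendsto_0: "saddle \<longlonglongrightarrow> 0"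
  unfolding saddle_def[abs_def] by real_asymp

lemma eventually_saddle: "eventually (\<lambda>n. 0 < saddle n \<and> saddle n \<le> 1) sequentially"
proof -
  have "eventually (\<lambda>n. saddle n < 1) sequentially"
    by (rule order_tendstoD(2)[OF saddle_tendsto_0]) simp
  with eventually_gt_at_top[of 0] show ?thesis
    by eventually_elim (simp add: saddle_pos)
qed

definition moment_primitive :: "nat \<Rightarrow> nat \<Rightarrow> real \<Rightarrow> real" where
  "moment_primitive l k v = integral {0..v} (\<lambda>y. y ^ l / (1 + y) ^ k)"

lemma continuous_on_moment_primitive: "continuous_on {0..1} (moment_primitive l k)"
  unfolding moment_primitive_def[abs_def]
  by (rule indefinite_integral_continuous_1) (rule has_integral_integrable[OF moment_int_has_integral])

lemma has_real_derivative_moment_primitive: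
  assumes "0 < v" "v < 1"
  shows "(moment_primitive l k has_real_derivative v ^ l / (1 + v) ^ k) (at v)"
proof -
  have "continuous_on {0..1} (\<lambda>y::real. y ^ l / (1 + y) ^ k)"
    by (intro continuous_intros) auto
  then have "(moment_primitive l k has_real_derivative v ^ l / (1 + v) ^ k) (at v within {0..1})"
    unfolding moment_primitive_def[abs_def]
    by (rule integral_has_real_derivative) (use assms in auto)
  moreover have "at v within {0..1} = at v"
    by (rule at_within_interior) (use assms in auto)
  ultimately show ?thesis by simp
qed

lemma moment_primitive_0: "moment_primitive l k 0 = 0"
  by (simp add: moment_primitive_def)

lemma moment_primitive_1: "moment_primitive l k 1 = moment_int l k"
  by (simp add: moment_primitive_def moment_int_def)

text \<open>Within a window of radius K the arguments of \<open>logistic\<close> differ by O(K x),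
  so the weight is close to one function g of u = wt m * x, and the sum is a Riemann sum of mesh 2
  x; hence the division by 2. Of I and J only the sizes survive.\<close>

lemma pattern_sum_tendsto:
  fixes I J :: "nat \<Rightarrow> nat set" and M :: "nat set"
  assumes IJ: "\<And>m. m \<in> M \<Longrightarrow> I m \<inter> J m = {}" "\<And>m. m \<in> M \<Longrightarrow> I m \<union> J m \<subseteq> {m - K..m + K}"
    and card: "\<And>m. m \<in> M \<Longrightarrow> card (I m) = Suc i" "\<And>m. m \<in> M \<Longrightarrow> card (J m) = j"
    and M: "\<And>m. K \<le> m \<Longrightarrow> m \<in> M"
  shows "(\<lambda>n. saddle n * (\<Sum>m\<in>M \<inter> {..<n}. pattern_weight (saddle n) (I m) (J m)))
    \<longlonglongrightarrow> moment_int i (Suc (i + j)) / 2"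
proof -
  define g where "g u = logistic u ^ Suc i * (1 - logistic u) ^ j" for u
  define G where "G u = - moment_primitive i (Suc (i + j)) (exp (- u))" for u
  \<comment> \<open>Positions outside M are filled in with g itself so that every cell has a sample.
    They lie below K, so undoing this costs at most K, which the factor \<open>saddle n\<close>
    removes.\<close>
  define y where "y x m = (if m \<in> M then pattern_weight x (I m) (J m) else g (real (wt m) * x))" for x m
  define C where "C = real (Suc i + j) * (exp (2 * real K) * real (2 * K + 1))"
  have derG: "(G has_real_derivative g u) (at u)" if "0 < u" for u
  proof -
    have "((\<lambda>u. exp (- u)) has_real_derivative - exp (- u)) (at u)"
      by (auto intro!: derivative_eq_intros)
    from DERIV_minus[OF DERIV_chain2[OF has_real_derivative_moment_primitive this], of i "Suc (i + j)"]
    have "(G has_real_derivative - (exp (- u) ^ i / (1 + exp (- u)) ^ Suc (i + j) * - exp (- u))) (at u)"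
      using that by (simp add: G_def[abs_def])
    moreover have "- (exp (- u) ^ i / (1 + exp (- u)) ^ Suc (i + j) * - exp (- u)) = g u"
      unfolding g_def logistic_altdef one_minus_logistic[unfolded logistic_altdef]
      by (simp add: power_divide power_add mult_ac)
    ultimately show ?thesis by simp
  qed
  have contG: "continuous_on {0..} G"
    unfolding G_def[abs_def]
    by (intro continuous_intros continuous_on_compose2[OF continuous_on_moment_primitive]) auto
  have bound: "\<bar>2 * saddle n * (\<Sum>m<n. y (saddle n) m) - (G (2 * real n * saddle n) - G 0)\<bar> \<le> 4 * C * saddle n"
    if x: "0 < saddle n" "saddle n \<le> 1" for n
  proof (rule riemann_sum_cells[OF derG contG x])
    show "0 \<le> C" by (simp add: C_def)
    fix m \<xi>
    let ?x = "saddle n"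
    assume \<xi>: "2 * real m * ?x < \<xi>" "\<xi> < 2 * (real m + 1) * ?x"
    \<comment> \<open>The subtraction is in the reals and may be negative for m < K. The value lies
      below the cell and below every argument in the window.\<close>
    define lo where "lo = (2 * real m - 2 * real K) * ?x"
    have Kx: "0 \<le> real K * ?x" using x by simp
    have lo_eq: "lo = 2 * real m * ?x - 2 * (real K * ?x)" by (simp add: lo_def algebra_simps)
    then have lo: "lo \<le> \<xi>" using \<xi> x Kx by linarith
    have bd: "lo \<le> real (wt a) * ?x \<and> \<bar>real (wt a) * ?x - \<xi>\<bar> \<le> real (2 * K + 1) * ?x"
      if "a \<in> {m - K..m + K}" for a
    proof -
      have a: "real m - real K \<le> real a" "real a \<le> real m + real K" using that by auto
      define mx ax kx where "mx = real m * ?x" and "ax = real a * ?x" and "kx = real K * ?x"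
      have "(real m - real K) * ?x \<le> real a * ?x" "real a * ?x \<le> (real m + real K) * ?x"
        using a x by (auto intro: mult_right_mono)
      then have ax: "mx - kx \<le> ax" "ax \<le> mx + kx"
        by (simp_all add: left_diff_distrib distrib_right mx_def ax_def kx_def)
      have eq: "real (wt a) * ?x = 2 * ax + ?x" "real (2 * K + 1) * ?x = 2 * kx + ?x" "lo = 2 * mx - 2 * kx"
        by (simp_all add: wt_def lo_eq mx_def ax_def kx_def algebra_simps)
      have "2 * mx < \<xi>" "\<xi> < 2 * mx + 2 * ?x" "0 \<le> kx"
        using \<xi> Kx by (simp_all add: mx_def kx_def algebra_simps)
      then show ?thesis
        unfolding eq using ax by (auto simp: abs_le_iff)
    qed
    have exp_lo: "exp (- lo) \<le> exp (2 * real K) * exp (- (real m * ?x))"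
    proof -
      have "real m * ?x \<ge> 0" "real K * ?x \<le> real K" using x by (auto intro: mult_left_le)
      then show ?thesis by (simp add: lo_def algebra_simps flip: exp_add)
    qed
    have fin: "real (Suc i + j) * (exp (- lo) * (real (2 * K + 1) * ?x)) \<le> C * ?x * exp (- (real m * ?x))"
    proof -
      have "real (Suc i + j) * (exp (- lo) * (real (2 * K + 1) * ?x))
          \<le> real (Suc i + j) * ((exp (2 * real K) * exp (- (real m * ?x))) * (real (2 * K + 1) * ?x))"
        by (intro mult_left_mono mult_right_mono exp_lo) (use x in auto)
      then show ?thesis by (simp add: C_def mult_ac)
    qed
    show "\<bar>y ?x m - g \<xi>\<bar> \<le> C * ?x * exp (- (real m * ?x))"
    proof (cases "m \<in> M")
      case True
      have finIJ: "finite (I m)" "finite (J m)"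
        using IJ(2)[OF True] by (auto intro: finite_subset)
      have "\<bar>y ?x m - g \<xi>\<bar> \<le> real (card (I m \<union> J m)) * (exp (- lo) * (real (2 * K + 1) * ?x))"
      proof -
        have y: "y ?x m = (\<Prod>a\<in>I m. logistic (real (wt a) * ?x)) * (\<Prod>a\<in>J m. 1 - logistic (real (wt a) * ?x))"
          using True by (simp add: y_def pattern_weight_def)
        have g: "g \<xi> = logistic \<xi> ^ card (I m) * (1 - logistic \<xi>) ^ card (J m)"
          using card[OF True] by (simp add: g_def)
        show ?thesis
          unfolding y g by (rule logistic_prod_diff[OF finIJ IJ(1)[OF True] lo]) (use bd IJ(2)[OF True] in blast)
      qed
      also have "card (I m \<union> J m) = Suc i + j"
        using card_Un_disjoint[OF finIJ IJ(1)[OF True]] card True by simp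
      finally show ?thesis using fin by linarith
    next
      case False
      \<comment> \<open>Dummy index sets of the right sizes, all evaluated at the single point wt m
        * x, let the same lemma serve here.\<close>
      have "\<bar>(\<Prod>a\<in>{..<Suc i}. logistic (real (wt m) * ?x)) * (\<Prod>a\<in>{Suc i..<Suc i + j}. 1 - logistic (real (wt m) * ?x))
        - logistic \<xi> ^ card {..<Suc i} * (1 - logistic \<xi>) ^ card {Suc i..<Suc i + j}\<bar>
        \<le> real (card ({..<Suc i} \<union> {Suc i..<Suc i + j})) * (exp (- lo) * (real (2 * K + 1) * ?x))"
        by (rule logistic_prod_diff[OF _ _ _ lo]) (use bd[of m] in auto)
      moreover have "{..<Suc i} \<union> {Suc i..<Suc i + j} = {..<Suc i + j}" by auto
      ultimately show ?thesis
        using False fin by (simp add: y_def g_def del: of_nat_Suc)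
    qed
  qed
  have g01: "0 \<le> g u" "g u \<le> 1" for u
    using logistic_pos[of u] logistic_less_1[of u] unfolding g_def
    by (auto intro!: mult_le_one power_le_one mult_nonneg_nonneg zero_le_power)
  have diff: "\<bar>(\<Sum>m<n. y x m) - (\<Sum>m\<in>M \<inter> {..<n}. pattern_weight x (I m) (J m))\<bar> \<le> real K" for x n
  proof -
    have "(\<Sum>m<n. y x m) = (\<Sum>m\<in>(M \<inter> {..<n}) \<union> ({..<n} - M). y x m)"
      by (rule sum.cong) auto
    also have "\<dots> = (\<Sum>m\<in>M \<inter> {..<n}. y x m) + (\<Sum>m\<in>{..<n} - M. y x m)"
      by (rule sum.union_disjoint) auto
    also have "(\<Sum>m\<in>M \<inter> {..<n}. y x m) = (\<Sum>m\<in>M \<inter> {..<n}. pattern_weight x (I m) (J m))"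
      by (rule sum.cong) (auto simp: y_def)
    also have "(\<Sum>m\<in>{..<n} - M. y x m) = (\<Sum>m\<in>{..<n} - M. g (real (wt m) * x))"
      by (rule sum.cong) (auto simp: y_def)
    finally have "(\<Sum>m<n. y x m) - (\<Sum>m\<in>M \<inter> {..<n}. pattern_weight x (I m) (J m))
      = (\<Sum>m\<in>{..<n} - M. g (real (wt m) * x))" by simp
    moreover have "0 \<le> (\<Sum>m\<in>{..<n} - M. g (real (wt m) * x))"
      using g01 by (intro sum_nonneg) auto
    moreover have "(\<Sum>m\<in>{..<n} - M. g (real (wt m) * x)) \<le> real (card ({..<n} - M)) * 1"
      by (rule sum_bounded_above) (use g01 in auto)
    moreover have "card ({..<n} - M) \<le> card {..<K}"
      by (rule card_mono) (use M in \<open>auto simp: not_le[symmetric]\<close>)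
    ultimately show ?thesis by simp
  qed
  let ?T = "\<lambda>n. saddle n * (\<Sum>m\<in>M \<inter> {..<n}. pattern_weight (saddle n) (I m) (J m))"
  have G0: "G 0 = - moment_int i (Suc (i + j))"
    by (simp add: G_def moment_primitive_1)
  have "(\<lambda>n. exp (- (2 * real n * saddle n))) \<longlonglongrightarrow> 0"
    unfolding saddle_def by real_asymp
  moreover have "eventually (\<lambda>n. exp (- (2 * real n * saddle n)) \<in> {0..1}) sequentially"
    using eventually_saddle by eventually_elim simp
  ultimately have "(\<lambda>n. moment_primitive i (Suc (i + j)) (exp (- (2 * real n * saddle n)))) \<longlonglongrightarrow> moment_primitive i (Suc (i + j)) 0"
    by (intro continuous_on_tendsto_compose[OF continuous_on_moment_primitive]) auto
  then have GU: "(\<lambda>n. G (2 * real n * saddle n)) \<longlonglongrightarrow> 0"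
    using tendsto_minus by (fastforce simp: G_def moment_primitive_0)
  have "(\<lambda>n. 2 * ?T n - (G (2 * real n * saddle n) - G 0)) \<longlonglongrightarrow> 0"
  proof (rule Lim_null_comparison)
    show "eventually (\<lambda>n. norm (2 * ?T n - (G (2 * real n * saddle n) - G 0)) \<le> (4 * C + 2 * real K) * saddle n) sequentially"
      using eventually_saddle
    proof eventually_elim
      case (elim n)
      let ?x = "saddle n"
      let ?P = "\<Sum>m\<in>M \<inter> {..<n}. pattern_weight (saddle n) (I m) (J m)"
      have "\<bar>2 * ?x * (\<Sum>m<n. y ?x m) - 2 * ?x * ?P\<bar> = 2 * ?x * \<bar>(\<Sum>m<n. y ?x m) - ?P\<bar>"
        using elim by (simp add: abs_mult flip: right_diff_distrib)
      also have "\<dots> \<le> 2 * ?x * real K"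
        using diff elim by (intro mult_left_mono) auto
      finally have "\<bar>2 * ?x * (\<Sum>m<n. y ?x m) - 2 * ?x * ?P\<bar> \<le> 2 * ?x * real K" .
      moreover have "\<bar>2 * ?x * (\<Sum>m<n. y ?x m) - (G (2 * real n * ?x) - G 0)\<bar> \<le> 4 * C * ?x"
        using bound elim by blast
      ultimately have "\<bar>2 * ?x * ?P - (G (2 * real n * ?x) - G 0)\<bar> \<le> 4 * C * ?x + 2 * ?x * real K"
        by linarith
      then show ?case by (simp add: algebra_simps)
    qed
    show "(\<lambda>n. (4 * C + 2 * real K) * saddle n) \<longlonglongrightarrow> 0"
      using tendsto_mult_right_zero[OF saddle_tendsto_0] by simp
  qed
  from tendsto_add[OF this tendsto_diff[OF GU tendsto_const[of "G 0"]]]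
  have "(\<lambda>n. 2 * ?T n) \<longlonglongrightarrow> moment_int i (Suc (i + j))"
    by (simp add: G0)
  from tendsto_divide[OF this tendsto_const[of 2]] show ?thesis by simp
qed

subsection \<open>Fourier representation of the counts\<close>

text \<open>The characteristic function, at - \<theta>, of the contribution of a to the
  weight.\<close>

definition char_factor :: "real \<Rightarrow> real \<Rightarrow> nat \<Rightarrow> complex" where
  "char_factor x \<theta> a =
     1 - of_real (logistic (real (wt a) * x)) + of_real (logistic (real (wt a) * x)) * cis (- (real (wt a) * \<theta>))"

text \<open>The same for the whole set below N, restricted to the event that the pattern occurs. The
  two summands are the branches "a is in" and "a is out", in the shape required for expanding over
  subsets.\<close>

definition pattern_char :: "real \<Rightarrow> real \<Rightarrow> nat \<Rightarrow> nat set \<Rightarrow> nat set \<Rightarrow> complex" where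
  "pattern_char x \<theta> N I J = (\<Prod>a<N.
     (if a \<in> J then 0 else of_real (logistic (real (wt a) * x)) * cis (- (real (wt a) * \<theta>))) +
     (if a \<in> I then 0 else 1 - of_real (logistic (real (wt a) * x))))"

text \<open>Truncation at N is harmless: a set of weight n lies below n, so the counts are exact for
  every N >= n.\<close>

definition partition_function :: "real \<Rightarrow> nat \<Rightarrow> real" where
  "partition_function x N = (\<Prod>a<N. 1 + exp (- (real (wt a) * x)))"

lemma partition_function_pos: "0 < partition_function x N"
  unfolding partition_function_def by (intro prod_pos) (simp add: add_pos_pos)

lemma prod_cis: "(\<Prod>a\<in>A. cis (f a)) = cis (\<Sum>a\<in>A. f a)"
  by (induction A rule: infinite_finite_induct) (simp_all add: cis_mult)

text \<open>Expanding the product, the coefficient of a set depends on its weight only; this is why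
  tilting by x does not disturb the count at a fixed weight.\<close>

lemma pattern_char_eq_sum:
  "pattern_char x \<theta> N I J = (\<Sum>A | A \<subseteq> {..<N} \<and> I \<inter> {..<N} \<subseteq> A \<and> A \<inter> J = {}.
     of_real (exp (- (real (sum wt A) * x)) / partition_function x N) * cis (- (real (sum wt A) * \<theta>)))"
proof -
  let ?L = "\<lambda>a. logistic (real (wt a) * x)"
  let ?f = "\<lambda>a. if a \<in> J then 0 else of_real (?L a) * cis (- (real (wt a) * \<theta>))"
  let ?g = "\<lambda>a. if a \<in> I then 0 else 1 - complex_of_real (?L a)"
  have "pattern_char x \<theta> N I J = (\<Sum>A\<in>Pow {..<N}. prod ?f A * prod ?g ({..<N} - A))"
    unfolding pattern_char_def by (rule prod_add) simp
  also have "\<dots> = (\<Sum>A | A \<subseteq> {..<N} \<and> I \<inter> {..<N} \<subseteq> A \<and> A \<inter> J = {}. prod ?f A * prod ?g ({..<N} - A))"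
  proof (rule sum.mono_neutral_right)
    show "\<forall>A\<in>Pow {..<N} - {A. A \<subseteq> {..<N} \<and> I \<inter> {..<N} \<subseteq> A \<and> A \<inter> J = {}}. prod ?f A * prod ?g ({..<N} - A) = 0"
    proof
      fix A assume A: "A \<in> Pow {..<N} - {A. A \<subseteq> {..<N} \<and> I \<inter> {..<N} \<subseteq> A \<and> A \<inter> J = {}}"
      then have fin: "finite A" by (auto intro: finite_subset)
      from A consider a where "a \<in> A" "a \<in> J" | a where "a \<in> {..<N} - A" "a \<in> I"
        by blast
      then show "prod ?f A * prod ?g ({..<N} - A) = 0"
      proof cases
        case 1
        then have "prod ?f A = 0" using fin by (intro prod_zero bexI[of _ a]) auto
        then show ?thesis by simp
      next
        case 2
        then have "prod ?g ({..<N} - A) = 0" by (intro prod_zero bexI[of _ a]) auto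
        then show ?thesis by simp
      qed
    qed
  qed auto
  also have "\<dots> = (\<Sum>A | A \<subseteq> {..<N} \<and> I \<inter> {..<N} \<subseteq> A \<and> A \<inter> J = {}.
     of_real (exp (- (real (sum wt A) * x)) / partition_function x N) * cis (- (real (sum wt A) * \<theta>)))"
  proof (rule sum.cong[OF refl])
    fix A assume "A \<in> {A. A \<subseteq> {..<N} \<and> I \<inter> {..<N} \<subseteq> A \<and> A \<inter> J = {}}"
    then have A: "A \<subseteq> {..<N}" "I \<inter> {..<N} \<subseteq> A" "A \<inter> J = {}" by auto
    then have fin: "finite A" by (auto intro: finite_subset)
    let ?v = "\<lambda>a. exp (- (real (wt a) * x))"
    have "prod ?f A = (\<Prod>a\<in>A. of_real (?L a) * cis (- (real (wt a) * \<theta>)))"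
      using A by (intro prod.cong) auto
    also have "\<dots> = of_real (\<Prod>a\<in>A. ?L a) * cis (- (real (sum wt A) * \<theta>))"
      by (simp add: prod.distrib prod_cis sum_negf sum_distrib_right)
    finally have f: "prod ?f A = of_real (\<Prod>a\<in>A. ?L a) * cis (- (real (sum wt A) * \<theta>))" .
    have g: "prod ?g ({..<N} - A) = of_real (\<Prod>a\<in>{..<N} - A. 1 - ?L a)"
      unfolding of_real_prod using A by (intro prod.cong) auto
    have "partition_function x N = (\<Prod>a\<in>A. 1 + ?v a) * (\<Prod>a\<in>{..<N} - A. 1 + ?v a)"
      unfolding partition_function_def using prod.subset_diff[OF A(1), of "\<lambda>a. 1 + ?v a"] by simp
    moreover have "(\<Prod>a\<in>A. ?L a) = exp (- (real (sum wt A) * x)) / (\<Prod>a\<in>A. 1 + ?v a)"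
      unfolding logistic_altdef prod_dividef exp_sum[OF fin, symmetric]
      by (simp add: sum_negf sum_distrib_right)
    moreover have "(\<Prod>a\<in>{..<N} - A. 1 - ?L a) = 1 / (\<Prod>a\<in>{..<N} - A. 1 + ?v a)"
      unfolding one_minus_logistic prod_dividef by simp
    ultimately have "(\<Prod>a\<in>A. ?L a) * (\<Prod>a\<in>{..<N} - A. 1 - ?L a) = exp (- (real (sum wt A) * x)) / partition_function x N"
      by simp
    then have eq: "complex_of_real (\<Prod>a\<in>A. ?L a) * of_real (\<Prod>a\<in>{..<N} - A. 1 - ?L a)
        = of_real (exp (- (real (sum wt A) * x)) / partition_function x N)"
      by (simp only: of_real_mult[symmetric])
    show "prod ?f A * prod ?g ({..<N} - A)
      = of_real (exp (- (real (sum wt A) * x)) / partition_function x N) * cis (- (real (sum wt A) * \<theta>))"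
      unfolding f g eq[symmetric] by (simp only: mult_ac)
  qed
  finally show ?thesis .
qed

lemma continuous_on_cis_mult: "continuous_on S (\<lambda>\<theta>. cis (c * \<theta>))"
  unfolding cis_conv_exp by (intro continuous_intros)

lemma integral_cis_orthogonal:
  "(\<integral>\<theta>. indicator {-pi..pi} \<theta> *\<^sub>R cis (real_of_int k * \<theta>) \<partial>lborel) = (if k = 0 then 2 * pi else 0)"
proof (cases "k = 0")
  case True
  have "(\<integral>\<theta>. indicator {-pi..pi} \<theta> *\<^sub>R (1::complex) \<partial>lborel) = of_real (2 * pi)"
    by (simp add: measure_def lborel_integral_real_affine[symmetric] scaleR_conv_of_real)
  with True show ?thesis by simp
next
  case False
  define F where "F \<theta> = cis (real_of_int k * \<theta>) / (\<i> * of_int k)" for \<theta>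
  have "(\<integral>\<theta>. indicator {-pi..pi} \<theta> *\<^sub>R cis (real_of_int k * \<theta>) \<partial>lborel) = F pi - F (- pi)"
  proof (rule integral_FTC_atLeastAtMost)
    fix \<theta> :: real
    have "((\<lambda>z. exp (\<i> * (of_int k * z)) / (\<i> * of_int k)) has_field_derivative exp (\<i> * (of_int k * of_real \<theta>))) (at (of_real \<theta>))"
      using False by (auto intro!: derivative_eq_intros simp: algebra_simps)
    from has_vector_derivative_real_field[OF this]
    have "((\<lambda>\<theta>. exp (\<i> * (of_int k * of_real \<theta>)) / (\<i> * of_int k)) has_vector_derivative
        exp (\<i> * (of_int k * of_real \<theta>))) (at \<theta> within {-pi..pi})" .
    then show "(F has_vector_derivative cis (real_of_int k * \<theta>)) (at \<theta> within {-pi..pi})"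
      by (simp add: F_def[abs_def] cis_conv_exp)
  qed (use continuous_on_cis_mult in auto)
  moreover have "cis (real_of_int k * pi) = cis (real_of_int k * (- pi))"
  proof -
    have "cis (real_of_int k * pi) = cis (real_of_int k * (- pi)) * cis (2 * pi * real_of_int k)"
      unfolding cis_mult by (rule arg_cong[of _ _ cis]) simp
    then show ?thesis by simp
  qed
  ultimately show ?thesis using False by (simp add: F_def)
qed

text \<open>Orthogonality extracts the sets of weight n. The identity is exact for every x; the
  saddle point serves only to concentrate the integrand.\<close>

lemma card_pattern_eq_integral:
  assumes "n \<le> N" "I \<subseteq> {..<N}"
  shows "of_nat (card {A \<in> odd_sets n. I \<subseteq> A \<and> A \<inter> J = {}})
    = of_real (exp (real n * x) * partition_function x N / (2 * pi)) *
      (\<integral>\<theta>. indicator {-pi..pi} \<theta> *\<^sub>R (cis (real n * \<theta>) * pattern_char x \<theta> N I J) \<partial>lborel)"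
proof -
  let ?F = "partition_function x N"
  let ?S = "{A. A \<subseteq> {..<N} \<and> I \<inter> {..<N} \<subseteq> A \<and> A \<inter> J = {}}"
  have F: "?F \<noteq> 0" using partition_function_pos[of x N] by simp
  let ?c = "\<lambda>A. complex_of_real (exp (- (real (sum wt A) * x)) / ?F)"
  let ?k = "\<lambda>A. int n - int (sum wt A)"
  have "(\<integral>\<theta>. indicator {-pi..pi} \<theta> *\<^sub>R (cis (real n * \<theta>) * pattern_char x \<theta> N I J) \<partial>lborel)
    = (\<integral>\<theta>. (\<Sum>A\<in>?S. ?c A * (indicator {-pi..pi} \<theta> *\<^sub>R cis (real_of_int (?k A) * \<theta>))) \<partial>lborel)"
  proof (rule Bochner_Integration.integral_cong[OF refl])
    fix \<theta>
    have "cis (real n * \<theta>) * (?c A * cis (- (real (sum wt A) * \<theta>))) = ?c A * cis (real_of_int (?k A) * \<theta>)" for A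
    proof -
      have "cis (real_of_int (?k A) * \<theta>) = cis (real n * \<theta>) * cis (- (real (sum wt A) * \<theta>))"
        unfolding cis_mult by (rule arg_cong[of _ _ cis]) (simp add: left_diff_distrib)
      then show ?thesis by simp
    qed
    then show "indicator {-pi..pi} \<theta> *\<^sub>R (cis (real n * \<theta>) * pattern_char x \<theta> N I J)
      = (\<Sum>A\<in>?S. ?c A * (indicator {-pi..pi} \<theta> *\<^sub>R cis (real_of_int (?k A) * \<theta>)))"
      unfolding pattern_char_eq_sum sum_distrib_left scaleR_sum_right by (simp only: mult_scaleR_right)
  qed
  also have "\<dots> = (\<Sum>A\<in>?S. ?c A * (\<integral>\<theta>. indicator {-pi..pi} \<theta> *\<^sub>R cis (real_of_int (?k A) * \<theta>) \<partial>lborel))"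
  proof (subst Bochner_Integration.integral_sum)
    fix A assume "A \<in> ?S"
    have "integrable lborel (\<lambda>\<theta>. indicator {-pi..pi} \<theta> *\<^sub>R cis (real_of_int (?k A) * \<theta>))"
      using borel_integrable_atLeastAtMost'[OF continuous_on_cis_mult] unfolding set_integrable_def .
    then show "integrable lborel (\<lambda>\<theta>. ?c A * (indicator {-pi..pi} \<theta> *\<^sub>R cis (real_of_int (?k A) * \<theta>)))"
      by (rule integrable_mult_right)
  next
    show "(\<Sum>A\<in>?S. \<integral>\<theta>. ?c A * (indicator {-pi..pi} \<theta> *\<^sub>R cis (real_of_int (?k A) * \<theta>)) \<partial>lborel)
      = (\<Sum>A\<in>?S. ?c A * (\<integral>\<theta>. indicator {-pi..pi} \<theta> *\<^sub>R cis (real_of_int (?k A) * \<theta>) \<partial>lborel))"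
      by (intro sum.cong refl integral_mult_right_zero)
  qed
  also have "\<dots> = (\<Sum>A\<in>?S. if sum wt A = n then of_real (exp (- (real n * x)) / ?F * (2 * pi)) else 0)"
  proof -
    have "?k A = 0 \<longleftrightarrow> sum wt A = n" for A by linarith
    then show ?thesis
      unfolding integral_cis_orthogonal by (intro sum.cong refl) (simp del: of_nat_sum)
  qed
  also have "\<dots> = (\<Sum>A\<in>{A \<in> ?S. sum wt A = n}. of_real (exp (- (real n * x)) / ?F * (2 * pi)))"
    by (rule sum.inter_filter[symmetric]) simp
  also have "{A \<in> ?S. sum wt A = n} = {A \<in> odd_sets n. I \<subseteq> A \<and> A \<inter> J = {}}"
  proof -
    have "A \<subseteq> {..<N}" if "A \<in> odd_sets n" for A
      using odd_sets_bound[OF that] assms(1) by fastforce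
    moreover have "A \<in> odd_sets n" if "A \<subseteq> {..<N}" "sum wt A = n" for A
      using that finite_subset[OF that(1)] by (simp add: odd_sets_def)
    moreover have "sum wt A = n" if "A \<in> odd_sets n" for A
      using that by (simp add: odd_sets_def)
    ultimately show ?thesis using assms(2) by blast
  qed
  finally have *: "(\<integral>\<theta>. indicator {-pi..pi} \<theta> *\<^sub>R (cis (real n * \<theta>) * pattern_char x \<theta> N I J) \<partial>lborel)
    = of_nat (card {A \<in> odd_sets n. I \<subseteq> A \<and> A \<inter> J = {}}) * of_real (exp (- (real n * x)) / ?F * (2 * pi))"
    by simp
  have "exp (real n * x) * ?F / (2 * pi) * (exp (- (real n * x)) / ?F * (2 * pi)) = 1"
    using F by (simp add: exp_minus)
  then have one: "complex_of_real (exp (real n * x) * ?F / (2 * pi)) * of_real (exp (- (real n * x)) / ?F * (2 * pi)) = 1"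
    by (simp only: of_real_mult[symmetric] of_real_1)
  show ?thesis
    unfolding * mult.left_commute[of "complex_of_real (exp (real n * x) * ?F / (2 * pi))"] one by simp
qed

subsection \<open>Decay away from the saddle point\<close>

lemma norm_char_factor_sq:
  "(norm (char_factor x \<theta> a))\<^sup>2 =
     1 - 2 * (logistic (real (wt a) * x) * (1 - logistic (real (wt a) * x))) * (1 - cos (real (wt a) * \<theta>))"
proof -
  let ?p = "logistic (real (wt a) * x)" and ?u = "real (wt a) * \<theta>"
  have "(norm (char_factor x \<theta> a))\<^sup>2 = (1 - ?p + ?p * cos ?u)\<^sup>2 + (?p * sin ?u)\<^sup>2"
    by (simp add: char_factor_def cmod_power2)
  also have "(?p * sin ?u)\<^sup>2 = ?p\<^sup>2 * (1 - (cos ?u)\<^sup>2)"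
    by (simp add: power_mult_distrib sin_squared_eq)
  also have "(1 - ?p + ?p * cos ?u)\<^sup>2 + ?p\<^sup>2 * (1 - (cos ?u)\<^sup>2) = 1 - 2 * (?p * (1 - ?p)) * (1 - cos ?u)"
    by (simp add: power2_eq_square algebra_simps)
  finally show ?thesis .
qed

text \<open>The Bernoulli variance is at least exp (- wt a * x) / 4, and 1 - v <= exp (- v). Trading
  \<open>logistic\<close> for the exponential makes the total exponent a geometric sum.\<close>

lemma norm_char_factor_le_exp:
  assumes "0 \<le> x"
  shows "norm (char_factor x \<theta> a) \<le> exp (- (exp (- (real (wt a) * x)) * (1 - cos (real (wt a) * \<theta>)) / 4))"
proof -
  let ?p = "logistic (real (wt a) * x)" and ?u = "real (wt a) * \<theta>" and ?v = "exp (- (real (wt a) * x))"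
  have v: "0 < ?v" "?v \<le> 1" "1 + ?v \<noteq> 0" using assms by (auto simp: add_pos_pos less_imp_neq[symmetric])
  have "?p * (1 - ?p) = ?v / (1 + ?v)\<^sup>2"
    unfolding one_minus_logistic by (simp add: logistic_altdef power2_eq_square)
  also have "\<dots> \<ge> ?v / 2\<^sup>2"
    using v by (intro divide_left_mono power_mono) auto
  finally have p: "?v / 4 \<le> ?p * (1 - ?p)" by simp
  have "(norm (char_factor x \<theta> a))\<^sup>2 \<le> 1 + - (2 * (?v / 4) * (1 - cos ?u))"
  proof -
    have "?v / 4 * (1 - cos ?u) \<le> ?p * (1 - ?p) * (1 - cos ?u)"
      using p by (rule mult_right_mono) simp
    then show ?thesis
      unfolding norm_char_factor_sq mult.assoc[of 2] by linarith
  qed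
  also have "\<dots> \<le> exp (- (2 * (?v / 4) * (1 - cos ?u)))" by (rule exp_ge_add_one_self)
  also have "\<dots> = (exp (- (?v * (1 - cos ?u) / 4)))\<^sup>2"
    by (simp flip: exp_double)
  finally show ?thesis
    by (rule power2_le_imp_le) simp
qed

lemma norm_char_factor_le_1: "norm (char_factor x \<theta> a) \<le> 1"
proof -
  have "0 \<le> 2 * (logistic (real (wt a) * x) * (1 - logistic (real (wt a) * x))) * (1 - cos (real (wt a) * \<theta>))"
    using logistic_pos[of "real (wt a) * x"] logistic_less_1[of "real (wt a) * x"]
    by (intro mult_nonneg_nonneg) auto
  then have "(norm (char_factor x \<theta> a))\<^sup>2 \<le> 1\<^sup>2"
    unfolding norm_char_factor_sq by simp
  then show ?thesis by (rule power2_le_imp_le) simp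
qed

lemma exp_minus_exp_le:
  assumes "0 \<le> x" "x \<le> (1::real)"
  shows "exp x - exp (- x) \<le> 4 * x"
proof -
  have "exp x \<le> 1 + x + x\<^sup>2" using assms by (intro exp_bound) auto
  moreover have "1 - x \<le> exp (- x)" using exp_ge_add_one_self[of "- x"] by simp
  moreover have "x\<^sup>2 \<le> x" using assms by (simp add: power2_eq_square mult_left_le)
  ultimately show ?thesis using assms by linarith
qed

lemma sin_sq_ge_quarter:
  assumes "\<bar>\<theta>\<bar> \<le> pi / 2"
  shows "\<theta>\<^sup>2 / 4 \<le> (sin \<theta>)\<^sup>2"
proof -
  have "\<bar>sin \<theta> - \<theta>\<bar> \<le> inverse 6 * \<bar>\<theta>\<bar> ^ 3"
    using Maclaurin_sin_bound[of \<theta> 3] by (simp add: eval_nat_numeral sin_coeff_def)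
  \<comment> \<open>From pi / 2 < 1.6 and 1.6^2 < 3 the cubic Taylor remainder is at most half of
    \<bar>\<theta>\<bar>.\<close>
  moreover have "\<bar>\<theta>\<bar> ^ 2 \<le> (16 / 10)\<^sup>2"
    using assms pi_approx by (intro power_mono) auto
  then have "\<bar>\<theta>\<bar> ^ 2 * \<bar>\<theta>\<bar> \<le> 3 * \<bar>\<theta>\<bar>"
    by (intro mult_right_mono) (auto simp: power2_eq_square)
  then have "\<bar>\<theta>\<bar> ^ 3 \<le> 3 * \<bar>\<theta>\<bar>" by (simp add: power3_eq_cube power2_eq_square)
  ultimately have "\<bar>sin \<theta> - \<theta>\<bar> \<le> \<bar>\<theta>\<bar> / 2" by simp
  then have "\<bar>\<theta>\<bar> / 2 \<le> \<bar>sin \<theta>\<bar>" by linarith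
  then have "(\<bar>\<theta>\<bar> / 2)\<^sup>2 \<le> \<bar>sin \<theta>\<bar>\<^sup>2" by (rule power_mono) simp
  then show ?thesis by (simp add: power_divide)
qed

text \<open>The sum is Re (T x - T (x + i \<theta>)) for a truncated geometric series T whose full
  sum at z is 1 / (2 sinh z). Here s = sinh x and the squared modulus of sinh (x + i \<theta>) is
  s^2 + sin^2 \<theta>; the last term pays for truncating both series.\<close>

lemma sum_damped_cos_eq:
  assumes "0 < x"
  defines "s \<equiv> (exp x - exp (- x)) / 2"
  shows "(\<Sum>a<N. exp (- (real (wt a) * x)) * (1 - cos (real (wt a) * \<theta>)))
    \<ge> 1 / (2 * s) - s * cos \<theta> / (2 * (s\<^sup>2 + (sin \<theta>)\<^sup>2)) - exp (- (2 * real N * x)) / s"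
proof -
  have s: "0 < s" unfolding s_def using assms by simp
  define D where "D z = exp z - exp (- z)" for z :: complex
  define T where "T z = (\<Sum>a<N. exp (- (of_nat (wt a) * z)))" for z :: complex
  have DT: "D z * T z = 1 - exp (- (2 * of_nat N * z))" for z
  proof -
    have "D z * T z = (\<Sum>a<N. exp (- (2 * of_nat a * z)) - exp (- (2 * of_nat (Suc a) * z)))"
      unfolding T_def D_def sum_distrib_left
    proof (rule sum.cong[OF refl])
      fix a
      have "(exp z - exp (- z)) * exp (- (of_nat (wt a) * z)) = exp (z + - (of_nat (wt a) * z)) - exp (- z + - (of_nat (wt a) * z))"
        unfolding exp_add left_diff_distrib ..
      also have "z + - (of_nat (wt a) * z) = - (2 * of_nat a * z)" by (simp add: wt_def algebra_simps)
      also have "- z + - (of_nat (wt a) * z) = - (2 * of_nat (Suc a) * z)" by (simp add: wt_def algebra_simps)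
      finally show "(exp z - exp (- z)) * exp (- (of_nat (wt a) * z)) = exp (- (2 * of_nat a * z)) - exp (- (2 * of_nat (Suc a) * z))" .
    qed
    then show ?thesis
      unfolding sum_lessThan_telescope'[of "\<lambda>a. exp (- (2 * of_nat a * z))"] by simp
  qed
  define z where "z = Complex x \<theta>"
  have ReD: "Re (D z) = 2 * s * cos \<theta>" and ImD: "Im (D z) = (exp x + exp (- x)) * sin \<theta>"
    by (simp_all add: D_def z_def s_def Re_exp Im_exp algebra_simps)
  have "exp x * exp (- x) = 1" by (simp flip: exp_add)
  then have "(exp x + exp (- x))\<^sup>2 = 4 * s\<^sup>2 + 4"
    by (simp add: s_def power2_eq_square field_simps)
  then have normD: "(Re (D z))\<^sup>2 + (Im (D z))\<^sup>2 = 4 * (s\<^sup>2 + (sin \<theta>)\<^sup>2)"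
    unfolding ReD ImD power_mult_distrib by (simp add: cos_squared_eq algebra_simps)
  have pos: "0 < s\<^sup>2 + (sin \<theta>)\<^sup>2" using s by (simp add: add_pos_nonneg)
  have D0: "D z \<noteq> 0" using normD pos by auto
  have "(2 * s)\<^sup>2 \<le> (norm (D z))\<^sup>2"
    unfolding cmod_power2 normD by (simp add: power_mult_distrib)
  then have normD': "2 * s \<le> norm (D z)" by (rule power2_le_imp_le) simp
  have "T z = 1 / D z - exp (- (2 * of_nat N * z)) / D z"
    using DT[of z] D0 by (simp add: field_simps)
  then have "Re (T z) \<le> Re (1 / D z) + norm (exp (- (2 * of_nat N * z)) / D z)"
    using abs_Re_le_cmod[of "exp (- (2 * of_nat N * z)) / D z"] by simp
  also have "Re (1 / D z) = s * cos \<theta> / (2 * (s\<^sup>2 + (sin \<theta>)\<^sup>2))"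
  proof -
    have "Re (1 / D z) = Re (D z) / ((Re (D z))\<^sup>2 + (Im (D z))\<^sup>2)"
      by (simp add: Re_divide)
    also have "\<dots> = Re (D z) / (4 * (s\<^sup>2 + (sin \<theta>)\<^sup>2))"
      by (rule arg_cong[OF normD])
    also have "\<dots> = s * cos \<theta> / (2 * (s\<^sup>2 + (sin \<theta>)\<^sup>2))"
    proof -
      have "2 * s * c / (4 * P) = s * c / (2 * P)" for c P :: real by simp
      then show ?thesis unfolding ReD .
    qed
    finally show ?thesis .
  qed
  also have "norm (exp (- (2 * of_nat N * z)) / D z) = exp (- (2 * real N * x)) / norm (D z)"
    by (simp add: norm_divide z_def)
  also have "\<dots> \<le> exp (- (2 * real N * x)) / (2 * s)"
    using normD' s by (intro divide_left_mono) (auto intro!: mult_pos_pos)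
  finally have ReT: "Re (T z) \<le> s * cos \<theta> / (2 * (s\<^sup>2 + (sin \<theta>)\<^sup>2)) + exp (- (2 * real N * x)) / (2 * s)"
    by simp
  have Tx: "T (of_real x) = of_real ((1 - exp (- (2 * real N * x))) / (2 * s))"
  proof -
    have "D (of_real x) = of_real (2 * s)" by (simp add: D_def s_def flip: exp_of_real)
    moreover have "D (of_real x) * T (of_real x) = of_real (1 - exp (- (2 * real N * x)))"
      unfolding DT by (simp flip: exp_of_real)
    ultimately show ?thesis using s by (simp add: field_simps)
  qed
  have "(\<Sum>a<N. exp (- (real (wt a) * x)) * (1 - cos (real (wt a) * \<theta>))) = Re (T (of_real x)) - Re (T z)"
    unfolding T_def Re_sum sum_subtractf[symmetric]
    by (intro sum.cong refl) (simp add: z_def Re_exp algebra_simps)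
  moreover have "Re (T (of_real x)) = 1 / (2 * s) - exp (- (2 * real N * x)) / (2 * s)"
    unfolding Tx by (simp add: diff_divide_distrib)
  moreover have "exp (- (2 * real N * x)) / (2 * s) + exp (- (2 * real N * x)) / (2 * s) = exp (- (2 * real N * x)) / s"
    by simp
  ultimately show ?thesis using ReT by linarith
qed

text \<open>As all weights are odd, the second series has negative real part near \<theta> = pi and
  only helps, so 0 is the only peak of the integrand. The two regimes of the minimum meet at
  \<bar>\<theta>\<bar> = x.\<close>

lemma sum_damped_cos_ge:
  assumes x: "0 < x" "x \<le> 1" and \<theta>: "\<bar>\<theta>\<bar> \<le> pi"
  shows "(\<Sum>a<N. exp (- (real (wt a) * x)) * (1 - cos (real (wt a) * \<theta>)))
    \<ge> min (1 / x) (\<theta>\<^sup>2 / x ^ 3) / 128 - exp (- (2 * real N * x)) / x"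
proof -
  define \<mu> where "\<mu> = min (1 / x) (\<theta>\<^sup>2 / x ^ 3) / 128"
  have \<mu>: "\<mu> \<le> (1 / x) / 128" "\<mu> \<le> (\<theta>\<^sup>2 / x ^ 3) / 128"
    unfolding \<mu>_def by (auto intro!: divide_right_mono)
  define s where "s = (exp x - exp (- x)) / 2"
  have s: "x \<le> s" "s \<le> 2 * x"
    using exp_minus_exp_ge[of x] exp_minus_exp_le[of x] x by (simp_all add: s_def)
  have s0: "0 < s" using s x by simp
  have inv: "1 / (4 * x) \<le> 1 / (2 * s)" using s s0 x by (intro divide_left_mono) auto
  define B where "B = 1 / (2 * s) - s * cos \<theta> / (2 * (s\<^sup>2 + (sin \<theta>)\<^sup>2))"
  have "\<mu> \<le> B"
  proof (cases "cos \<theta> \<le> 0")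
    case True
    then have "s * cos \<theta> / (2 * (s\<^sup>2 + (sin \<theta>)\<^sup>2)) \<le> 0"
      using s0 by (intro divide_nonpos_pos mult_nonneg_nonpos) (auto intro!: add_pos_nonneg)
    then have "1 / (4 * x) \<le> B" using inv by (simp add: B_def)
    moreover have "\<mu> \<le> (1 / x) / 128" by (rule \<mu>(1))
    moreover have "(1 / x) / 128 \<le> 1 / (4 * x)" using x by (simp add: field_simps)
    ultimately show ?thesis by linarith
  next
    case False
    have "\<bar>\<theta>\<bar> \<le> pi / 2"
    proof (rule ccontr)
      assume "\<not> \<bar>\<theta>\<bar> \<le> pi / 2"
      then have "cos \<bar>\<theta>\<bar> \<le> cos (pi / 2)" using \<theta> by (intro cos_monotone_0_pi_le) auto
      with False show False by simp
    qed
    then have t: "\<theta>\<^sup>2 / 4 \<le> (sin \<theta>)\<^sup>2" by (rule sin_sq_ge_quarter)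
    define t \<sigma> where "t = \<theta>\<^sup>2 / 4" and "\<sigma> = (sin \<theta>)\<^sup>2"
    have t0: "0 \<le> t" "t \<le> \<sigma>" using t by (simp_all add: t_def \<sigma>_def)
    have ss: "0 < s\<^sup>2" using s0 by simp
    have st: "0 < s\<^sup>2 + t" "0 < s\<^sup>2 + \<sigma>" using ss t0 by linarith+
    have "s * cos \<theta> / (2 * (s\<^sup>2 + \<sigma>)) \<le> s * 1 / (2 * (s\<^sup>2 + \<sigma>))"
      using s0 t0 by (intro divide_right_mono mult_left_mono) auto
    also have "\<dots> \<le> s * 1 / (2 * (s\<^sup>2 + t))"
      using s0 t0 st by (intro divide_left_mono mult_pos_pos) auto
    finally have "1 / (2 * s) - s / (2 * (s\<^sup>2 + t)) \<le> B" by (simp add: B_def \<sigma>_def)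
    moreover have "1 / (2 * s) - s / (2 * (s\<^sup>2 + t)) = t / (2 * s * (s\<^sup>2 + t))"
    proof -
      have ne: "s \<noteq> 0" "s\<^sup>2 + t \<noteq> 0" using s0 st by auto
      show ?thesis using ne by (simp add: divide_simps) (simp add: power2_eq_square algebra_simps)
    qed
    ultimately have Bt: "t / (2 * s * (s\<^sup>2 + t)) \<le> B" by simp
    show ?thesis
    proof (cases "s\<^sup>2 \<le> t")
      case True
      have tp: "0 < t" using True ss by linarith
      have "\<mu> \<le> (1 / x) / 128" by (rule \<mu>(1))
      also have "\<dots> \<le> (1 / (4 * x)) / 2" using x by (simp add: field_simps)
      also have "\<dots> \<le> (1 / (2 * s)) / 2" using inv by (rule divide_right_mono) simp
      also have "\<dots> = t / (2 * s * (t + t))" using tp s0 by (simp add: field_simps)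
      also have "\<dots> \<le> t / (2 * s * (s\<^sup>2 + t))"
        using True s0 ss st t0 by (intro divide_left_mono mult_left_mono mult_pos_pos) auto
      finally show ?thesis using Bt by linarith
    next
      case False
      have "\<mu> \<le> (\<theta>\<^sup>2 / x ^ 3) / 128" by (rule \<mu>(2))
      \<comment> \<open>This case dictates 128: t = \<theta>^2 / 4 and s <= 2 x give 4 * 4 *
        8.\<close>
      also have "\<dots> = t / (4 * (2 * x) ^ 3)" by (simp add: t_def power_mult_distrib)
      also have "\<dots> \<le> t / (4 * s ^ 3)"
        using s s0 t0 x by (intro divide_left_mono mult_left_mono power_mono) auto
      also have "\<dots> = t / (2 * s * (s\<^sup>2 + s\<^sup>2))" by (simp add: power2_eq_square power3_eq_cube)
      also have "\<dots> \<le> t / (2 * s * (s\<^sup>2 + t))"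
        using False s0 ss st t0 by (intro divide_left_mono mult_left_mono mult_pos_pos) auto
      finally show ?thesis using Bt by linarith
    qed
  qed
  moreover have "exp (- (2 * real N * x)) / s \<le> exp (- (2 * real N * x)) / x"
    using s s0 x by (intro divide_left_mono) auto
  moreover have "B - exp (- (2 * real N * x)) / s \<le> (\<Sum>a<N. exp (- (real (wt a) * x)) * (1 - cos (real (wt a) * \<theta>)))"
    using sum_damped_cos_eq[OF x(1), of \<theta> N] unfolding B_def s_def by simp
  ultimately have "\<mu> - exp (- (2 * real N * x)) / x
    \<le> (\<Sum>a<N. exp (- (real (wt a) * x)) * (1 - cos (real (wt a) * \<theta>)))"
    by linarith
  then show ?thesis by (simp only: \<mu>_def)
qed

text \<open>This provides an integrable majorant independent of x. Where 1 / x is the minimum, the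
  constraint on \<tau> turns smallness in x into decay in \<tau>: exp (- \<kappa> / x) is O(x^3),
  and x^3 <= pi^2 / \<tau>^2.\<close>

lemma exp_neg_min_le:
  assumes x: "0 < x" "x \<le> 1" and \<kappa>: "0 < \<kappa>" "\<kappa> \<le> 1" and \<tau>: "\<bar>\<tau> * (x * sqrt x)\<bar> \<le> pi"
  shows "exp (- (\<kappa> * min (1 / x) (\<tau>\<^sup>2))) \<le> (12 * pi\<^sup>2 / \<kappa> ^ 3) * (1 / (1 + \<tau>\<^sup>2))"
proof -
  have pos: "0 < 1 + \<tau>\<^sup>2" by (simp add: add_pos_nonneg)
  have k3: "\<kappa> ^ 3 \<le> \<kappa>" using \<kappa> by (simp add: power3_eq_cube mult_left_le mult_le_one)
  have pi1: "1 \<le> 12 * pi\<^sup>2"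
  proof -
    have "1 \<le> pi" using pi_gt3 by simp
    then have "1 \<le> pi\<^sup>2" by (rule one_le_power)
    then show ?thesis by simp
  qed
  show ?thesis
  proof (cases "\<tau>\<^sup>2 \<le> 1 / x")
    case True
    have "exp (- (\<kappa> * \<tau>\<^sup>2)) = 1 / exp (\<kappa> * \<tau>\<^sup>2)" by (simp add: exp_minus inverse_eq_divide)
    also have "\<dots> \<le> 1 / (\<kappa> * (1 + \<tau>\<^sup>2))"
    proof (rule divide_left_mono)
      have "\<kappa> * (1 + \<tau>\<^sup>2) \<le> 1 + \<kappa> * \<tau>\<^sup>2" using \<kappa> by (simp add: distrib_left)
      also have "\<dots> \<le> exp (\<kappa> * \<tau>\<^sup>2)" by (rule exp_ge_add_one_self)
      finally show "\<kappa> * (1 + \<tau>\<^sup>2) \<le> exp (\<kappa> * \<tau>\<^sup>2)" .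
    qed (use \<kappa> pos in auto)
    also have "\<dots> = (1 / \<kappa>) * (1 / (1 + \<tau>\<^sup>2))" by simp
    also have "\<dots> \<le> (12 * pi\<^sup>2 / \<kappa> ^ 3) * (1 / (1 + \<tau>\<^sup>2))"
      using pos \<kappa> k3 pi1 by (intro mult_right_mono frac_le) auto
    finally show ?thesis using True by (simp add: min_def)
  next
    case False
    have "\<tau>\<^sup>2 * x ^ 3 = \<bar>\<tau> * (x * sqrt x)\<bar>\<^sup>2"
      using x by (simp add: power_mult_distrib power3_eq_cube power2_eq_square)
    also have "\<dots> \<le> pi\<^sup>2" using \<tau> by (intro power_mono) auto
    finally have tx: "\<tau>\<^sup>2 * x ^ 3 \<le> pi\<^sup>2" .
    have t1: "1 \<le> \<tau>\<^sup>2" using False x by (smt (verit) le_divide_eq_1)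
    let ?u = "\<kappa> / x"
    have u: "0 < ?u" using \<kappa> x by simp
    have "?u ^ 3 / 6 \<le> exp ?u"
    proof -
      have "(\<Sum>i\<in>{3}. ?u ^ i /\<^sub>R fact i) \<le> (\<Sum>i. ?u ^ i /\<^sub>R fact i)"
        by (rule sum_le_suminf[OF summable_exp_generic]) (use u in auto)
      then have "?u ^ 3 /\<^sub>R fact 3 \<le> exp ?u"
        unfolding exp_def by (simp only: sum.insert sum.empty finite.emptyI empty_iff not_False_eq_True add_0_right)
      then show ?thesis by (simp add: eval_nat_numeral)
    qed
    moreover have u3: "0 < ?u ^ 3" using u by simp
    ultimately have "1 / exp ?u \<le> 1 / (?u ^ 3 / 6)" by (intro divide_left_mono) auto
    then have "exp (- ?u) \<le> 6 * x ^ 3 / \<kappa> ^ 3"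
      by (simp add: exp_minus inverse_eq_divide power_divide mult.commute)
    also have "\<dots> \<le> 6 * (pi\<^sup>2 / \<tau>\<^sup>2) / \<kappa> ^ 3"
    proof -
      have "0 < \<tau>\<^sup>2" using t1 by linarith
      then have "x ^ 3 \<le> pi\<^sup>2 / \<tau>\<^sup>2"
        using tx by (subst pos_le_divide_eq) (simp_all only: mult.commute)
      then show ?thesis using \<kappa> by (intro divide_right_mono mult_left_mono) auto
    qed
    also have "\<dots> \<le> 6 * (pi\<^sup>2 * (2 / (1 + \<tau>\<^sup>2))) / \<kappa> ^ 3"
    proof -
      have "pi\<^sup>2 * (1 / \<tau>\<^sup>2) \<le> pi\<^sup>2 * (2 / (1 + \<tau>\<^sup>2))"
        using t1 pos by (intro mult_left_mono) (auto simp: divide_simps)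
      then show ?thesis using \<kappa> by (intro divide_right_mono mult_left_mono) auto
    qed
    also have "\<dots> = (12 * pi\<^sup>2 / \<kappa> ^ 3) * (1 / (1 + \<tau>\<^sup>2))" by simp
    finally show ?thesis using False by (simp add: min_def)
  qed
qed

text \<open>Fixing the membership of a replaces its factor by a probability times a number of
  modulus 1.\<close>

lemma pattern_char_factorization:
  assumes "I \<inter> J = {}" "I \<union> J \<subseteq> {..<N}"
  shows "pattern_char x \<theta> N I J = of_real (pattern_weight x I J) *
    (\<Prod>a<N. if a \<in> I then cis (- (real (wt a) * \<theta>)) else if a \<in> J then 1 else char_factor x \<theta> a)"
proof -
  let ?L = "\<lambda>a. logistic (real (wt a) * x)"
  let ?z = "\<lambda>a. if a \<in> I then cis (- (real (wt a) * \<theta>)) else if a \<in> J then 1 else char_factor x \<theta> a"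
  let ?r = "\<lambda>a. if a \<in> I then ?L a else if a \<in> J then 1 - ?L a else 1"
  have "pattern_char x \<theta> N I J = (\<Prod>a<N. of_real (?r a) * ?z a)"
    unfolding pattern_char_def
    by (rule prod.cong[OF refl]) (use assms(1) in \<open>auto simp: char_factor_def\<close>)
  also have "\<dots> = of_real (\<Prod>a<N. ?r a) * (\<Prod>a<N. ?z a)"
    by (simp add: prod.distrib)
  also have "(\<Prod>a<N. ?r a) = (\<Prod>a\<in>I \<union> J. ?r a)"
    by (rule prod.mono_neutral_right) (use assms in auto)
  also have "\<dots> = (\<Prod>a\<in>I. ?r a) * (\<Prod>a\<in>J. ?r a)"
  proof (rule prod.union_disjoint)
    show "finite I" "finite J" using assms(2) finite_subset[of _ "{..<N}"] by auto
  qed (use assms in auto)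
  also have "(\<Prod>a\<in>I. ?r a) = (\<Prod>a\<in>I. ?L a)" by simp
  also have "(\<Prod>a\<in>J. ?r a) = (\<Prod>a\<in>J. 1 - ?L a)"
    by (rule prod.cong) (use assms in auto)
  finally show ?thesis by (simp add: pattern_weight_def)
qed

text \<open>Positions in I and J give no decay; each removes a term of at most 2 from the
  exponent.\<close>

lemma norm_pattern_char_le:
  assumes IJ: "I \<inter> J = {}" "I \<union> J \<subseteq> {..<N}" and x: "0 \<le> x"
  shows "norm (pattern_char x \<theta> N I J) \<le> pattern_weight x I J *
    exp (- (((\<Sum>a<N. exp (- (real (wt a) * x)) * (1 - cos (real (wt a) * \<theta>))) - 2 * real (card (I \<union> J))) / 4))"
proof -
  let ?z = "\<lambda>a. if a \<in> I then cis (- (real (wt a) * \<theta>)) else if a \<in> J then 1 else char_factor x \<theta> a"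
  let ?t = "\<lambda>a. exp (- (real (wt a) * x)) * (1 - cos (real (wt a) * \<theta>))"
  have t2: "?t a \<le> 1 * 2" for a
  proof (rule mult_mono)
    show "1 - cos (real (wt a) * \<theta>) \<le> 2"
      using cos_ge_minus_one[of "real (wt a) * \<theta>"] by linarith
  qed (use x in auto)
  have "norm (\<Prod>a<N. ?z a) = (\<Prod>a<N. norm (?z a))" by (rule prod_norm[symmetric])
  also have "\<dots> \<le> (\<Prod>a<N. exp (- (if a \<in> I \<union> J then 0 else ?t a / 4)))"
    by (rule prod_mono) (use norm_char_factor_le_exp[OF x] in auto)
  also have "\<dots> = exp (- (\<Sum>a<N. if a \<in> I \<union> J then 0 else ?t a / 4))"
    by (simp add: exp_sum flip: sum_negf)
  finally have up: "norm (\<Prod>a<N. ?z a) \<le> exp (- (\<Sum>a<N. if a \<in> I \<union> J then 0 else ?t a / 4))" .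
  have "(\<Sum>a<N. if a \<in> I \<union> J then 0 else ?t a / 4) \<ge> ((\<Sum>a<N. ?t a) - 2 * real (card (I \<union> J))) / 4"
  proof -
    have "(\<Sum>a<N. ?t a) - 2 * real (card (I \<union> J)) \<le> (\<Sum>a<N. if a \<in> I \<union> J then 0 else ?t a)"
    proof -
      have "(\<Sum>a<N. ?t a) = (\<Sum>a<N. if a \<in> I \<union> J then 0 else ?t a) + (\<Sum>a<N. if a \<in> I \<union> J then ?t a else 0)"
        unfolding sum.distrib[symmetric] by (intro sum.cong) auto
      also have "(\<Sum>a<N. if a \<in> I \<union> J then ?t a else 0) = (\<Sum>a\<in>I \<union> J. ?t a)"
        by (rule sum.mono_neutral_cong_right) (use IJ in auto)
      also have "\<dots> \<le> real (card (I \<union> J)) * 2"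
        by (rule sum_bounded_above) (use t2 in simp)
      finally show ?thesis by simp
    qed
    then have "((\<Sum>a<N. ?t a) - 2 * real (card (I \<union> J))) / 4 \<le> (\<Sum>a<N. if a \<in> I \<union> J then 0 else ?t a) / 4"
      by (rule divide_right_mono) simp
    also have "\<dots> = (\<Sum>a<N. if a \<in> I \<union> J then 0 else ?t a / 4)"
      unfolding sum_divide_distrib by (intro sum.cong) auto
    finally show ?thesis .
  qed
  then have "exp (- (\<Sum>a<N. if a \<in> I \<union> J then 0 else ?t a / 4))
      \<le> exp (- (((\<Sum>a<N. ?t a) - 2 * real (card (I \<union> J))) / 4))"
    by (simp only: exp_le_cancel_iff neg_le_iff_le)
  with up have "norm (\<Prod>a<N. ?z a) \<le> exp (- (((\<Sum>a<N. ?t a) - 2 * real (card (I \<union> J))) / 4))"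
    by (rule order_trans)
  then show ?thesis
    unfolding pattern_char_factorization[OF IJ] norm_mult
    using pattern_weight_nonneg[of x I J] by (simp add: mult_left_mono)
qed

lemma norm_cis_minus_1_le: "norm (cis u - 1) \<le> \<bar>u\<bar>"
  using iexp_approx1[of u 0] by (simp add: cis_conv_exp)

text \<open>Restoring the free factors at the positions of the pattern costs at most wt a *
  \<bar>\<theta>\<bar> each, as all factors have modulus at most 1. Thus all patterns share one
  product, and its Gaussian limit is needed only once.\<close>

lemma pattern_char_approx:
  assumes IJ: "I \<inter> J = {}" "I \<union> J \<subseteq> {..<N}"
  shows "norm (pattern_char x \<theta> N I J - of_real (pattern_weight x I J) * (\<Prod>a<N. char_factor x \<theta> a))
    \<le> pattern_weight x I J * (\<Sum>a\<in>I \<union> J. real (wt a) * \<bar>\<theta>\<bar>)"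
proof -
  let ?L = "\<lambda>a. logistic (real (wt a) * x)" and ?c = "\<lambda>a. cis (- (real (wt a) * \<theta>))"
  let ?z = "\<lambda>a. if a \<in> I then ?c a else if a \<in> J then 1 else char_factor x \<theta> a"
  have c1: "norm (?c a - 1) \<le> real (wt a) * \<bar>\<theta>\<bar>" for a
    using norm_cis_minus_1_le[of "- (real (wt a) * \<theta>)"] by (simp add: abs_mult)
  have L: "0 \<le> ?L a" "?L a \<le> 1" for a
    using logistic_pos[of "real (wt a) * x"] logistic_less_1[of "real (wt a) * x"] by auto
  have z: "norm (?z a - char_factor x \<theta> a) \<le> (if a \<in> I \<union> J then real (wt a) * \<bar>\<theta>\<bar> else 0)" for a
  proof -
    have "?c a - char_factor x \<theta> a = of_real (1 - ?L a) * (?c a - 1)"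
      by (simp add: char_factor_def algebra_simps)
    then have "norm (?c a - char_factor x \<theta> a) = (1 - ?L a) * norm (?c a - 1)"
      by (simp only: norm_mult norm_of_real abs_of_nonneg diff_ge_0_iff_ge L)
    also have "\<dots> \<le> 1 * (real (wt a) * \<bar>\<theta>\<bar>)" using L[of a] c1 by (intro mult_mono) auto
    finally have 1: "norm (?c a - char_factor x \<theta> a) \<le> real (wt a) * \<bar>\<theta>\<bar>" by simp
    have "1 - char_factor x \<theta> a = of_real (- ?L a) * (?c a - 1)"
      by (simp add: char_factor_def algebra_simps)
    then have "norm (1 - char_factor x \<theta> a) = ?L a * norm (?c a - 1)"
      by (simp only: norm_mult norm_of_real abs_minus_cancel abs_of_nonneg L)
    also have "\<dots> \<le> 1 * (real (wt a) * \<bar>\<theta>\<bar>)" using L[of a] c1 by (intro mult_mono) auto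
    finally have 2: "norm (1 - char_factor x \<theta> a) \<le> real (wt a) * \<bar>\<theta>\<bar>" by simp
    from 1 2 show ?thesis by auto
  qed
  have "norm ((\<Prod>a<N. ?z a) - (\<Prod>a<N. char_factor x \<theta> a)) \<le> (\<Sum>a<N. norm (?z a - char_factor x \<theta> a))"
    by (rule norm_prod_diff) (auto simp: norm_char_factor_le_1)
  also have "\<dots> \<le> (\<Sum>a<N. if a \<in> I \<union> J then real (wt a) * \<bar>\<theta>\<bar> else 0)"
    by (rule sum_mono) (rule z)
  also have "\<dots> = (\<Sum>a\<in>I \<union> J. real (wt a) * \<bar>\<theta>\<bar>)"
    by (rule sum.mono_neutral_cong_right) (use IJ in auto)
  finally have *: "norm ((\<Prod>a<N. ?z a) - (\<Prod>a<N. char_factor x \<theta> a)) \<le> (\<Sum>a\<in>I \<union> J. real (wt a) * \<bar>\<theta>\<bar>)" .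
  have "pattern_char x \<theta> N I J - of_real (pattern_weight x I J) * (\<Prod>a<N. char_factor x \<theta> a)
    = of_real (pattern_weight x I J) * ((\<Prod>a<N. ?z a) - (\<Prod>a<N. char_factor x \<theta> a))"
    unfolding pattern_char_factorization[OF IJ] by (rule right_diff_distrib[symmetric])
  then have "norm (pattern_char x \<theta> N I J - of_real (pattern_weight x I J) * (\<Prod>a<N. char_factor x \<theta> a))
    = pattern_weight x I J * norm ((\<Prod>a<N. ?z a) - (\<Prod>a<N. char_factor x \<theta> a))"
    using pattern_weight_nonneg[of x I J] by (simp only: norm_mult norm_of_real abs_of_nonneg)
  also have "\<dots> \<le> pattern_weight x I J * (\<Sum>a\<in>I \<union> J. real (wt a) * \<bar>\<theta>\<bar>)"
    using pattern_weight_nonneg * by (rule mult_left_mono[rotated])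
  finally show ?thesis .
qed

subsection \<open>Gaussian limit at the saddle point\<close>

lemma norm_cis_taylor_le: "norm (cis u - (1 + \<i> * of_real u - of_real (u\<^sup>2 / 2))) \<le> \<bar>u\<bar> ^ 3 / 6"
proof -
  have "(\<Sum>k\<le>2. (\<i> * complex_of_real u) ^ k / fact k) = 1 + \<i> * of_real u - of_real (u\<^sup>2 / 2)"
    by (simp add: eval_nat_numeral power2_eq_square algebra_simps)
  then show ?thesis
    using iexp_approx1[of u 2] by (simp add: cis_conv_exp eval_nat_numeral)
qed

lemma exp_neg_quadratic:
  assumes "0 \<le> (v::real)"
  shows "\<bar>exp (- v) - (1 - v)\<bar> \<le> v\<^sup>2 / 2"
proof -
  have "1 - v \<le> exp (- v)" using exp_ge_add_one_self[of "- v"] by simp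
  moreover have "exp (- v) \<le> 1 - v + v\<^sup>2 / 2"
  proof -
    have e: "1 + v + v\<^sup>2 / 2 \<le> exp v" by (rule exp_lower_Taylor_quadratic[OF assms])
    have p: "0 < 1 + v + v\<^sup>2 / 2" using assms by (simp add: add_pos_nonneg)
    have "exp (- v) = 1 / exp v" by (simp add: exp_minus inverse_eq_divide)
    also have "\<dots> \<le> 1 / (1 + v + v\<^sup>2 / 2)"
      using e p by (intro divide_left_mono) auto
    also have "\<dots> \<le> 1 - v + v\<^sup>2 / 2"
    proof -
      have "(1 - v + v\<^sup>2 / 2) * (1 + v + v\<^sup>2 / 2) = 1 + (v\<^sup>2)\<^sup>2 / 4"
        by (simp add: power2_eq_square algebra_simps)
      then have "1 \<le> (1 - v + v\<^sup>2 / 2) * (1 + v + v\<^sup>2 / 2)" by simp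
      then show ?thesis using p by (simp only: pos_divide_le_eq)
    qed
    finally show ?thesis .
  qed
  ultimately show ?thesis by linarith
qed

text \<open>Centering by cis (t p) cancels the linear terms of the two branches and leaves 1 - v,
  with v half the variance times t^2. The bounds on the remainders are kept linear in p, whose
  exponential decay in wt a makes them summable.\<close>

lemma centered_bernoulli_char:
  fixes p t :: real
  assumes p: "0 \<le> p" "p \<le> 1"
  shows "norm (cis (t * p) * (1 - of_real p + of_real p * cis (- t)) - of_real (exp (- (t\<^sup>2 * (p * (1 - p)) / 2))))
    \<le> \<bar>t\<bar> ^ 3 * p + \<bar>t\<bar> ^ 4 * p"
proof -
  define R where "R u = cis u - (1 + \<i> * of_real u - of_real (u\<^sup>2 / 2))" for u
  define v where "v = t\<^sup>2 * (p * (1 - p)) / 2"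
  have R: "norm (R u) \<le> \<bar>u\<bar> ^ 3 / 6" for u unfolding R_def by (rule norm_cis_taylor_le)
  have cisR: "cis u = R u + (1 + \<i> * of_real u - of_real (u\<^sup>2 / 2))" for u by (simp add: R_def)
  have "cis (t * p) * cis (- t) = cis (- (t * (1 - p)))"
    unfolding cis_mult by (rule arg_cong[of _ _ cis]) (simp add: algebra_simps)
  then have "cis (t * p) * (1 - of_real p + of_real p * cis (- t))
      = of_real (1 - p) * cis (t * p) + of_real p * cis (- (t * (1 - p)))"
    by (simp add: distrib_left algebra_simps)
  also have "\<dots> = of_real (1 - p) * R (t * p) + of_real p * R (- (t * (1 - p))) + of_real (1 - v)"
    unfolding cisR by (simp add: v_def power2_eq_square field_simps)
  finally have eq: "cis (t * p) * (1 - of_real p + of_real p * cis (- t)) - of_real (exp (- v))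
    = of_real (1 - p) * R (t * p) + of_real p * R (- (t * (1 - p))) - of_real (exp (- v) - (1 - v))"
    by simp
  have v0: "0 \<le> v" using p by (simp add: v_def)
  have "norm (of_real (1 - p) * R (t * p)) = (1 - p) * norm (R (t * p))"
    using p by (simp only: norm_mult norm_of_real abs_of_nonneg diff_ge_0_iff_ge)
  also have "\<dots> \<le> 1 * (\<bar>t * p\<bar> ^ 3 / 6)" by (intro mult_mono R) (use p in auto)
  also have "\<bar>t * p\<bar> ^ 3 = \<bar>t\<bar> ^ 3 * p ^ 3" using p by (simp add: abs_mult power_mult_distrib)
  also have "1 * (\<bar>t\<bar> ^ 3 * p ^ 3 / 6) \<le> \<bar>t\<bar> ^ 3 * p / 6"
  proof -
    have "p ^ 3 \<le> p ^ 1" using p by (intro power_decreasing) auto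
    then show ?thesis by (simp add: mult_left_mono)
  qed
  finally have 1: "norm (of_real (1 - p) * R (t * p)) \<le> \<bar>t\<bar> ^ 3 * p / 6" .
  have "norm (of_real p * R (- (t * (1 - p)))) = p * norm (R (- (t * (1 - p))))"
    using p by (simp only: norm_mult norm_of_real abs_of_nonneg)
  also have "\<dots> \<le> p * (\<bar>- (t * (1 - p))\<bar> ^ 3 / 6)" by (intro mult_left_mono R p)
  also have "\<bar>- (t * (1 - p))\<bar> ^ 3 = \<bar>t\<bar> ^ 3 * (1 - p) ^ 3"
    using p by (simp add: abs_mult power_mult_distrib)
  also have "p * (\<bar>t\<bar> ^ 3 * (1 - p) ^ 3 / 6) \<le> p * (\<bar>t\<bar> ^ 3 * 1 / 6)"
    using p by (intro mult_left_mono divide_right_mono power_le_one) auto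
  finally have 2: "norm (of_real p * R (- (t * (1 - p)))) \<le> \<bar>t\<bar> ^ 3 * p / 6" by (simp add: mult_ac)
  have "norm (complex_of_real (exp (- v) - (1 - v))) \<le> v\<^sup>2 / 2"
    unfolding norm_of_real by (rule exp_neg_quadratic[OF v0])
  also have "v\<^sup>2 / 2 \<le> \<bar>t\<bar> ^ 4 * p"
  proof -
    have "p * (1 - p) \<le> p" using p by (simp add: mult_left_le)
    then have "(p * (1 - p))\<^sup>2 \<le> p\<^sup>2" using p by (intro power_mono) auto
    also have "p\<^sup>2 \<le> p" using p by (simp add: power2_eq_square mult_left_le)
    finally have q: "(p * (1 - p))\<^sup>2 \<le> p" .
    have "v\<^sup>2 / 2 = \<bar>t\<bar> ^ 4 * (p * (1 - p))\<^sup>2 / 8"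
      by (simp add: v_def power_divide power_mult_distrib) 
    also have "\<dots> \<le> \<bar>t\<bar> ^ 4 * p / 8" using q by (intro divide_right_mono mult_left_mono) auto
    also have "\<dots> \<le> \<bar>t\<bar> ^ 4 * p" using p by simp
    finally show ?thesis .
  qed
  finally have 3: "norm (complex_of_real (exp (- v) - (1 - v))) \<le> \<bar>t\<bar> ^ 4 * p" .
  have "norm (of_real (1 - p) * R (t * p) + of_real p * R (- (t * (1 - p))) - of_real (exp (- v) - (1 - v)))
    \<le> \<bar>t\<bar> ^ 3 * p / 6 + \<bar>t\<bar> ^ 3 * p / 6 + \<bar>t\<bar> ^ 4 * p"
    by (intro order_trans[OF norm_triangle_ineq4] order_trans[OF norm_triangle_ineq] add_mono 1 2 3)
  also have "\<dots> \<le> \<bar>t\<bar> ^ 3 * p + \<bar>t\<bar> ^ 4 * p" using p by simp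
  finally show ?thesis unfolding eq[unfolded v_def] v_def .
qed

text \<open>Lyapunov's argument for the central limit theorem. The factor \<theta>^2 times the
  variance tends to \<tau>^2 pi^2 / 12, and the errors, of order \<theta>^3 / x^4 and \<theta>^4 /
  x^5, become sqrt x and x.\<close>

lemma char_product_tendsto:
  fixes \<tau> :: real and K :: nat
  defines "\<theta> \<equiv> \<lambda>n. \<tau> * (saddle n * sqrt (saddle n))"
  shows "(\<lambda>n. cis (real n * \<theta> n) * (\<Prod>a<n + K + 1. char_factor (saddle n) (\<theta> n) a))
    \<longlonglongrightarrow> of_real (exp (- (pi\<^sup>2 * \<tau>\<^sup>2 / 24)))"
proof -
  let ?N = "\<lambda>n. n + K + 1"
  define L where "L n a = logistic (real (wt a) * saddle n)" for n a
  define \<mu> where "\<mu> n = (\<Sum>a<?N n. real (wt a) * L n a)" for n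
  define V where "V n = (\<Sum>a<?N n. (real (wt a))\<^sup>2 * (L n a * (1 - L n a)))" for n
  define u where "u n a = cis (real (wt a) * \<theta> n * L n a) * char_factor (saddle n) (\<theta> n) a" for n a
  define U where "U n = 2 * real (?N n) * saddle n" for n
  have L: "0 \<le> L n a" "L n a \<le> 1" "L n a \<le> exp (- (real (wt a) * saddle n))" for n a
    using logistic_pos[of "real (wt a) * saddle n"] logistic_less_1[of "real (wt a) * saddle n"]
      logistic_le_exp[of "real (wt a) * saddle n"] by (auto simp: L_def)
  have char: "char_factor (saddle n) (\<theta> n) a = cis (- (real (wt a) * \<theta> n * L n a)) * u n a" for n a
    by (simp add: u_def cis_mult flip: mult.assoc)
  \<comment> \<open>Centering every factor collects the phases into \<theta> times the difference of
    n and the mean weight.\<close>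
  have prod_char: "cis (real n * \<theta> n) * (\<Prod>a<?N n. char_factor (saddle n) (\<theta> n) a)
      = cis (\<theta> n * (real n - \<mu> n)) * (\<Prod>a<?N n. u n a)" for n
  proof -
    have "(\<Sum>a<?N n. - (real (wt a) * \<theta> n * L n a)) = - (\<theta> n * \<mu> n)"
      unfolding \<mu>_def sum_distrib_left sum_negf by (simp add: mult_ac)
    then have "(\<Prod>a<?N n. char_factor (saddle n) (\<theta> n) a) = cis (- (\<theta> n * \<mu> n)) * (\<Prod>a<?N n. u n a)"
      unfolding char prod.distrib prod_cis by (simp only:)
    moreover have "cis (real n * \<theta> n) * cis (- (\<theta> n * \<mu> n)) = cis (\<theta> n * (real n - \<mu> n))"
      unfolding cis_mult by (rule arg_cong[of _ _ cis]) (simp add: algebra_simps)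
    ultimately show ?thesis by (metis mult.assoc)
  qed
  have lim_u: "(\<lambda>n. (\<Prod>a<?N n. u n a) - of_real (exp (- ((\<theta> n)\<^sup>2 * V n / 2)))) \<longlonglongrightarrow> 0"
  proof (rule Lim_null_comparison)
    show "eventually (\<lambda>n. norm ((\<Prod>a<?N n. u n a) - of_real (exp (- ((\<theta> n)\<^sup>2 * V n / 2))))
        \<le> 48 * \<bar>\<tau>\<bar> ^ 3 * sqrt (saddle n) + 384 * \<bar>\<tau>\<bar> ^ 4 * saddle n) sequentially"
      using eventually_saddle
    proof eventually_elim
      case (elim n)
      let ?x = "saddle n"
      let ?t = "\<lambda>a. real (wt a) * \<theta> n"
      let ?e = "\<lambda>a. exp (- ((?t a)\<^sup>2 * (L n a * (1 - L n a)) / 2))"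
      have "complex_of_real (exp (- ((\<theta> n)\<^sup>2 * V n / 2))) = (\<Prod>a<?N n. of_real (?e a))"
      proof -
        have "- ((\<theta> n)\<^sup>2 * V n / 2) = (\<Sum>a<?N n. - ((?t a)\<^sup>2 * (L n a * (1 - L n a)) / 2))"
          unfolding V_def sum_distrib_left sum_divide_distrib sum_negf
          by (simp add: power_mult_distrib mult_ac)
        then show ?thesis by (simp only: exp_sum finite_lessThan of_real_prod)
      qed
      then have "norm ((\<Prod>a<?N n. u n a) - of_real (exp (- ((\<theta> n)\<^sup>2 * V n / 2))))
          = norm ((\<Prod>a<?N n. u n a) - (\<Prod>a<?N n. of_real (?e a)))" by simp
      also have "\<dots> \<le> (\<Sum>a<?N n. norm (u n a - of_real (?e a)))"
      proof (rule norm_prod_diff)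
        fix a
        show "norm (u n a) \<le> 1" unfolding u_def by (simp add: norm_mult norm_char_factor_le_1)
        have "0 \<le> (?t a)\<^sup>2 * (L n a * (1 - L n a)) / 2" using L by simp
        then show "norm (complex_of_real (?e a)) \<le> 1" by simp
      qed
      also have "\<dots> \<le> (\<Sum>a<?N n. \<bar>\<theta> n\<bar> ^ 3 * (real (wt a) ^ 3 * exp (- (real (wt a) * ?x)))
          + \<bar>\<theta> n\<bar> ^ 4 * (real (wt a) ^ 4 * exp (- (real (wt a) * ?x))))"
      proof (rule sum_mono)
        fix a
        have "norm (u n a - of_real (?e a)) \<le> \<bar>?t a\<bar> ^ 3 * L n a + \<bar>?t a\<bar> ^ 4 * L n a"
          using centered_bernoulli_char[OF L(1,2)[of n a], of "?t a"]
          unfolding u_def char_factor_def L_def .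
        also have "\<dots> \<le> \<bar>?t a\<bar> ^ 3 * exp (- (real (wt a) * ?x)) + \<bar>?t a\<bar> ^ 4 * exp (- (real (wt a) * ?x))"
          using L(3) by (intro add_mono mult_left_mono) auto
        also have "\<dots> = \<bar>\<theta> n\<bar> ^ 3 * (real (wt a) ^ 3 * exp (- (real (wt a) * ?x)))
          + \<bar>\<theta> n\<bar> ^ 4 * (real (wt a) ^ 4 * exp (- (real (wt a) * ?x)))"
          by (simp only: abs_mult power_mult_distrib abs_of_nat mult_ac)
        finally show "norm (u n a - of_real (?e a)) \<le> \<bar>\<theta> n\<bar> ^ 3 * (real (wt a) ^ 3 * exp (- (real (wt a) * ?x)))
          + \<bar>\<theta> n\<bar> ^ 4 * (real (wt a) ^ 4 * exp (- (real (wt a) * ?x)))" .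
      qed
      also have "\<dots> \<le> \<bar>\<theta> n\<bar> ^ 3 * (fact 3 * 2 ^ 3 / ?x ^ Suc 3) + \<bar>\<theta> n\<bar> ^ 4 * (fact 4 * 2 ^ 4 / ?x ^ Suc 4)"
        unfolding sum.distrib sum_distrib_left[symmetric]
        by (intro add_mono mult_left_mono sum_wt_power_exp_le) (use elim in auto)
      also have "\<bar>\<theta> n\<bar> ^ 3 * (fact 3 * 2 ^ 3 / ?x ^ Suc 3) = 48 * \<bar>\<tau>\<bar> ^ 3 * sqrt ?x"
      proof -
        have "(?x * sqrt ?x) ^ 3 = ?x ^ 4 * sqrt ?x"
          using elim by (simp add: eval_nat_numeral)
        then have "\<bar>\<theta> n\<bar> ^ 3 = \<bar>\<tau>\<bar> ^ 3 * (?x ^ 4 * sqrt ?x)"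
          using elim by (simp add: \<theta>_def abs_mult power_mult_distrib)
        moreover have "fact 3 * 2 ^ 3 = (48::real)" by (simp add: eval_nat_numeral)
        ultimately show ?thesis using elim by simp
      qed
      also have "\<bar>\<theta> n\<bar> ^ 4 * (fact 4 * 2 ^ 4 / ?x ^ Suc 4) = 384 * \<bar>\<tau>\<bar> ^ 4 * ?x"
      proof -
        have "(?x * sqrt ?x) ^ 4 = ?x ^ 5 * ?x"
          using elim by (simp add: eval_nat_numeral)
        then have "\<bar>\<theta> n\<bar> ^ 4 = \<bar>\<tau>\<bar> ^ 4 * (?x ^ 5 * ?x)"
          using elim by (simp add: \<theta>_def abs_mult power_mult_distrib)
        moreover have "fact 4 * 2 ^ 4 = (384::real)" by (simp add: eval_nat_numeral)
        ultimately show ?thesis using elim by simp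
      qed
      finally show ?case .
    qed
    have "(\<lambda>n. sqrt (saddle n)) \<longlonglongrightarrow> 0"
      using tendsto_real_sqrt[OF saddle_tendsto_0] by simp
    then show "(\<lambda>n. 48 * \<bar>\<tau>\<bar> ^ 3 * sqrt (saddle n) + 384 * \<bar>\<tau>\<bar> ^ 4 * saddle n) \<longlonglongrightarrow> 0"
      using saddle_tendsto_0 by (auto intro!: tendsto_eq_intros)
  qed
  have \<theta>_sq: "(\<theta> n)\<^sup>2 = \<tau>\<^sup>2 * saddle n ^ 3" if "0 < saddle n" for n
    using that by (simp add: \<theta>_def power_mult_distrib power2_eq_square power3_eq_cube)
  have "(\<lambda>n. saddle n ^ 3 * V n - pi\<^sup>2 / 12) \<longlonglongrightarrow> 0"
  proof (rule Lim_null_comparison)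
    show "eventually (\<lambda>n. norm (saddle n ^ 3 * V n - pi\<^sup>2 / 12)
        \<le> (32 * saddle n + ((U n)\<^sup>2 + 2 * (U n + 1)) * exp (- U n)) / 2) sequentially"
      using eventually_saddle
    proof eventually_elim
      case (elim n)
      have x3: "0 < saddle n ^ 3" using elim by simp
      have "\<bar>V n - pi\<^sup>2 / (12 * saddle n ^ 3)\<bar>
          \<le> (32 * saddle n + ((U n)\<^sup>2 + 2 * (U n + 1)) * exp (- U n)) / (2 * saddle n ^ 3)"
        unfolding V_def L_def U_def using elim by (intro sum_wt_logistic_variance) auto
      then have "saddle n ^ 3 * \<bar>V n - pi\<^sup>2 / (12 * saddle n ^ 3)\<bar>
          \<le> saddle n ^ 3 * ((32 * saddle n + ((U n)\<^sup>2 + 2 * (U n + 1)) * exp (- U n)) / (2 * saddle n ^ 3))"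
        using x3 by (intro mult_left_mono) auto
      moreover have "saddle n ^ 3 * \<bar>V n - pi\<^sup>2 / (12 * saddle n ^ 3)\<bar> = \<bar>saddle n ^ 3 * (V n - pi\<^sup>2 / (12 * saddle n ^ 3))\<bar>"
        using x3 by (simp only: abs_mult abs_of_pos)
      moreover have "saddle n ^ 3 * (V n - pi\<^sup>2 / (12 * saddle n ^ 3)) = saddle n ^ 3 * V n - pi\<^sup>2 / 12"
        using elim by (simp add: right_diff_distrib)
      moreover have "saddle n ^ 3 * ((32 * saddle n + ((U n)\<^sup>2 + 2 * (U n + 1)) * exp (- U n)) / (2 * saddle n ^ 3))
          = (32 * saddle n + ((U n)\<^sup>2 + 2 * (U n + 1)) * exp (- U n)) / 2"
        using elim by simp
      ultimately show ?case by simp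
    qed
    show "(\<lambda>n. (32 * saddle n + ((U n)\<^sup>2 + 2 * (U n + 1)) * exp (- U n)) / 2) \<longlonglongrightarrow> 0"
      unfolding U_def saddle_def by real_asymp
  qed
  from tendsto_add[OF this tendsto_const[of "pi\<^sup>2 / 12"]]
  have "(\<lambda>n. saddle n ^ 3 * V n) \<longlonglongrightarrow> pi\<^sup>2 / 12" by simp
  then have "(\<lambda>n. \<tau>\<^sup>2 * (saddle n ^ 3 * V n) / 2) \<longlonglongrightarrow> \<tau>\<^sup>2 * (pi\<^sup>2 / 12) / 2"
    by (intro tendsto_intros) auto
  moreover have "eventually (\<lambda>n. \<tau>\<^sup>2 * (saddle n ^ 3 * V n) / 2 = (\<theta> n)\<^sup>2 * V n / 2) sequentially"
    using eventually_saddle by eventually_elim (simp add: \<theta>_sq)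
  ultimately have "(\<lambda>n. (\<theta> n)\<^sup>2 * V n / 2) \<longlonglongrightarrow> \<tau>\<^sup>2 * (pi\<^sup>2 / 12) / 2"
    by (rule Lim_transform_eventually)
  then have "(\<lambda>n. complex_of_real (exp (- ((\<theta> n)\<^sup>2 * V n / 2)))) \<longlonglongrightarrow> of_real (exp (- (\<tau>\<^sup>2 * (pi\<^sup>2 / 12) / 2)))"
    by (intro tendsto_of_real tendsto_exp tendsto_minus)
  from tendsto_add[OF lim_u this]
  have lim_prod: "(\<lambda>n. \<Prod>a<?N n. u n a) \<longlonglongrightarrow> of_real (exp (- (pi\<^sup>2 * \<tau>\<^sup>2 / 24)))"
    by (simp add: mult.commute)
  \<comment> \<open>Here the choice of \<open>saddle\<close> enters: n minus the mean is O(1 / x),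
    while \<theta> is of order x^(3/2).\<close>
  have "(\<lambda>n. \<theta> n * (real n - \<mu> n)) \<longlonglongrightarrow> 0"
  proof (rule Lim_null_comparison)
    show "eventually (\<lambda>n. norm (\<theta> n * (real n - \<mu> n)) \<le> \<bar>\<tau>\<bar> * ((8 * saddle n + (U n + 1) * exp (- U n)) / (2 * sqrt (saddle n)))) sequentially"
      using eventually_saddle eventually_gt_at_top[of 0]
    proof eventually_elim
      case (elim n)
      have "real n = pi\<^sup>2 / (24 * (saddle n)\<^sup>2)"
        using elim by (simp add: saddle_def power_divide)
      moreover have "\<bar>\<mu> n - pi\<^sup>2 / (24 * (saddle n)\<^sup>2)\<bar> \<le> (8 * saddle n + (U n + 1) * exp (- U n)) / (2 * (saddle n)\<^sup>2)"
        unfolding \<mu>_def L_def U_def using elim by (intro sum_wt_logistic) auto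
      ultimately have "\<bar>real n - \<mu> n\<bar> \<le> (8 * saddle n + (U n + 1) * exp (- U n)) / (2 * (saddle n)\<^sup>2)"
        by (simp add: abs_minus_commute)
      then have "\<bar>\<theta> n\<bar> * \<bar>real n - \<mu> n\<bar> \<le> \<bar>\<theta> n\<bar> * ((8 * saddle n + (U n + 1) * exp (- U n)) / (2 * (saddle n)\<^sup>2))"
        by (intro mult_left_mono) auto
      also have th: "\<bar>\<theta> n\<bar> = \<bar>\<tau>\<bar> * (saddle n * sqrt (saddle n))"
        using elim by (simp add: \<theta>_def abs_mult)
      also have "\<bar>\<tau>\<bar> * (saddle n * sqrt (saddle n)) * ((8 * saddle n + (U n + 1) * exp (- U n)) / (2 * (saddle n)\<^sup>2))
        = \<bar>\<tau>\<bar> * ((8 * saddle n + (U n + 1) * exp (- U n)) / (2 * sqrt (saddle n)))"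
      proof -
        define s where "s = sqrt (saddle n)"
        have "saddle n = s * s" "0 < s" using elim by (simp_all add: s_def)
        then have "saddle n * s / (2 * (saddle n)\<^sup>2) = 1 / (2 * s)"
          by (simp add: power2_eq_square)
        then have "\<bar>\<tau>\<bar> * (8 * saddle n + (U n + 1) * exp (- U n)) * (saddle n * s / (2 * (saddle n)\<^sup>2))
          = \<bar>\<tau>\<bar> * (8 * saddle n + (U n + 1) * exp (- U n)) * (1 / (2 * s))" by (rule arg_cong)
        then show ?thesis unfolding s_def[symmetric] by (simp add: mult_ac)
      qed
      finally show ?case unfolding th[symmetric] by (simp add: abs_mult)
    qed
    have "(\<lambda>n. (8 * saddle n + (U n + 1) * exp (- U n)) / (2 * sqrt (saddle n))) \<longlonglongrightarrow> 0"
      unfolding U_def saddle_def by real_asymp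
    from tendsto_mult_right_zero[OF this]
    show "(\<lambda>n. \<bar>\<tau>\<bar> * ((8 * saddle n + (U n + 1) * exp (- U n)) / (2 * sqrt (saddle n)))) \<longlonglongrightarrow> 0" .
  qed
  then have "(\<lambda>n. cis (\<theta> n * (real n - \<mu> n))) \<longlonglongrightarrow> cis 0"
    unfolding cis_conv_exp by (intro tendsto_exp tendsto_mult tendsto_const tendsto_of_real)
  from tendsto_mult[OF this lim_prod] show ?thesis
    unfolding prod_char by simp
qed

text \<open>At the saddle point n x and pi^2 / (24 x) are equal, each being half of pi * sqrt (n /
  6).\<close>

lemma partition_function_asymptotic:
  "(\<lambda>n. exp (real n * saddle n) * partition_function (saddle n) (n + K + 1) / exp (pi * sqrt (real n / 6))) \<longlonglongrightarrow> 1"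
proof -
  let ?S = "\<lambda>n. \<Sum>a<n + K + 1. ln (1 + exp (- (real (2 * a + 1) * saddle n)))"
  have "(\<lambda>n. ?S n - pi\<^sup>2 / (24 * saddle n)) \<longlonglongrightarrow> 0"
  proof (rule Lim_null_comparison)
    show "eventually (\<lambda>n. norm (?S n - pi\<^sup>2 / (24 * saddle n))
        \<le> saddle n / 2 + exp (- (2 * real (n + K + 1) * saddle n)) / (2 * saddle n)) sequentially"
      using eventually_saddle
    proof eventually_elim
      case (elim n)
      then show ?case using sum_ln_one_plus_exp[of "saddle n" "n + K + 1"] by simp
    qed
    show "(\<lambda>n. saddle n / 2 + exp (- (2 * real (n + K + 1) * saddle n)) / (2 * saddle n)) \<longlonglongrightarrow> 0"
      unfolding saddle_def by real_asymp
  qed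
  then have "(\<lambda>n. exp (?S n - pi\<^sup>2 / (24 * saddle n))) \<longlonglongrightarrow> exp 0" by (rule tendsto_exp)
  moreover have "eventually (\<lambda>n. exp (?S n - pi\<^sup>2 / (24 * saddle n))
    = exp (real n * saddle n) * partition_function (saddle n) (n + K + 1) / exp (pi * sqrt (real n / 6))) sequentially"
    using eventually_gt_at_top[of 0]
  proof eventually_elim
    case (elim n)
    have "exp (?S n) = partition_function (saddle n) (n + K + 1)"
      unfolding exp_sum[OF finite_lessThan] partition_function_def
      by (intro prod.cong refl) (simp add: wt_def add_pos_pos)
    moreover have "real n * saddle n + pi\<^sup>2 / (24 * saddle n) = pi * sqrt (real n / 6)"
    proof -
      define r where "r = sqrt (real n)"
      have r: "0 < r" "real n = r * r" using elim by (simp_all add: r_def)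
      have s: "sqrt (24::real) = 2 * sqrt 6"
        using real_sqrt_mult[of 4 6] by simp
      have s6: "sqrt 6 * sqrt 6 = (6::real)" by simp
      have x: "saddle n = pi / (2 * sqrt 6 * r)"
        by (simp add: saddle_def real_sqrt_mult s r_def)
      have "sqrt (real n / 6) = r / sqrt 6" by (simp add: r_def real_sqrt_divide)
      then show ?thesis
        unfolding x r(2) using r(1) s6 by (simp add: field_simps power2_eq_square)
    qed
    then have "?S n - pi\<^sup>2 / (24 * saddle n) = real n * saddle n + ?S n - pi * sqrt (real n / 6)" by linarith
    then have "exp (?S n - pi\<^sup>2 / (24 * saddle n)) = exp (real n * saddle n) * exp (?S n) / exp (pi * sqrt (real n / 6))"
      by (simp only: exp_add exp_diff)
    ultimately show ?case by simp
  qed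
  ultimately show ?thesis by (simp add: Lim_transform_eventually)
qed

section \<open>Local limit theorem for pattern counts\<close>

definition main_term :: "nat \<Rightarrow> real" where
  "main_term n = root 4 3 / (pi * root 4 2 * real n powr (1/4)) * exp (pi * sqrt (real n / 6))"

lemma continuous_on_pattern_char: "continuous_on S (\<lambda>\<theta>. pattern_char x \<theta> N I J)"
proof -
  have "continuous_on S (\<lambda>\<theta>. cis (- (c * \<theta>)))" for c
    using continuous_on_cis_mult[of S "- c"] by simp
  then show ?thesis
    unfolding pattern_char_eq_sum by (intro continuous_intros)
qed

lemma gaussian_integral:
  "integrable lborel (\<lambda>\<tau>::real. exp (- (pi\<^sup>2 * \<tau>\<^sup>2 / 24)))"
  "(\<integral>\<tau>. exp (- (pi\<^sup>2 * \<tau>\<^sup>2 / 24)) \<partial>lborel) = sqrt (24 / pi)"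
proof -
  \<comment> \<open>The normal density with 2 \<sigma>^2 = 24 / pi^2 has this exponent.\<close>
  define \<sigma> where "\<sigma> = sqrt 12 / pi"
  have \<sigma>: "0 < \<sigma>" "\<sigma>\<^sup>2 = 12 / pi\<^sup>2" by (simp_all add: \<sigma>_def power_divide)
  have d: "normal_density 0 \<sigma> \<tau> = exp (- (pi\<^sup>2 * \<tau>\<^sup>2 / 24)) / sqrt (24 / pi)" for \<tau>
  proof -
    have "2 * pi * \<sigma>\<^sup>2 = 24 / pi" unfolding \<sigma>(2) by (simp add: power2_eq_square)
    moreover have "- (\<tau> - 0)\<^sup>2 / (2 * \<sigma>\<^sup>2) = - (pi\<^sup>2 * \<tau>\<^sup>2 / 24)"
      unfolding \<sigma>(2) by simp
    ultimately show ?thesis unfolding normal_density_def by simp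
  qed
  have e: "exp (- (pi\<^sup>2 * \<tau>\<^sup>2 / 24)) = sqrt (24 / pi) * normal_density 0 \<sigma> \<tau>" for \<tau>
    unfolding d by simp
  show "integrable lborel (\<lambda>\<tau>::real. exp (- (pi\<^sup>2 * \<tau>\<^sup>2 / 24)))"
    unfolding e by (intro integrable_mult_right integrable_normal_density \<sigma>)
  show "(\<integral>\<tau>. exp (- (pi\<^sup>2 * \<tau>\<^sup>2 / 24)) \<partial>lborel) = sqrt (24 / pi)"
    unfolding e using \<sigma> by simp
qed

lemma integrable_one_over_one_plus_square: "integrable lborel (\<lambda>\<tau>::real. 1 / (1 + \<tau>\<^sup>2))"
  using integrable_inverse_1_plus_square by (simp add: set_integrable_def inverse_eq_divide)

text \<open>The source of the algebraic constants in the statement: \<open>main_term\<close> is the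
  Fourier prefactor times the Gaussian integral sqrt (24 / pi). Comparing fourth powers clears all
  roots.\<close>

lemma saddle_main_term_const:
  assumes "0 < n"
  shows "exp (pi * sqrt (real n / 6)) * sqrt (saddle n) / (2 * pi) = main_term n * sqrt (pi / 24)"
proof -
  have "sqrt (saddle n) / (2 * pi) = root 4 3 / (pi * root 4 2 * real n powr (1/4)) * sqrt (pi / 24)"
  proof (rule power_eq_imp_eq_base[of _ 4])
    have "sqrt y ^ 4 = y\<^sup>2" if "0 \<le> y" for y :: real
      using that by (simp add: eval_nat_numeral)
    moreover have "(real n powr (1/4)) ^ 4 = real n"
      using assms by (simp add: powr_power)
    moreover have "(root 4 3) ^ 4 = (3::real)" "(root 4 2) ^ 4 = (2::real)" by simp_all
    moreover have "(saddle n)\<^sup>2 = pi\<^sup>2 / (24 * real n)" by (simp add: saddle_def power_divide)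
    ultimately show "(sqrt (saddle n) / (2 * pi)) ^ 4
        = (root 4 3 / (pi * root 4 2 * real n powr (1/4)) * sqrt (pi / 24)) ^ 4"
      using assms saddle_pos[OF assms]
      by (simp add: power_divide power_mult_distrib divide_simps) (simp add: eval_nat_numeral mult_ac)
  qed (use saddle_pos[OF assms] in auto)
  then have "exp (pi * sqrt (real n / 6)) * (sqrt (saddle n) / (2 * pi))
    = exp (pi * sqrt (real n / 6)) * (root 4 3 / (pi * root 4 2 * real n powr (1/4)) * sqrt (pi / 24))"
    by (rule arg_cong)
  then show ?thesis unfolding main_term_def by (simp only: mult_ac times_divide_eq_right times_divide_eq_left)
qed

lemma main_term_pos: "0 < n \<Longrightarrow> 0 < main_term n"
  by (simp add: main_term_def)

text \<open>In the proof, \<open>F n\<close> is the Fourier integrand rescaled by \<open>\<theta> = \<tau> * x * sqrt x\<close>, \<open>x = saddle n\<close>, so that the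
  peak at \<open>\<theta> = 0\<close> tends to a Gaussian of fixed width.\<close>

lemma pattern_count_tendsto:
  fixes I J :: "nat \<Rightarrow> nat set" and M :: "nat set"
  assumes mem: "\<And>m. m \<in> M \<Longrightarrow> m \<in> I m" and disj: "\<And>m. m \<in> M \<Longrightarrow> I m \<inter> J m = {}"
    and window: "\<And>m. m \<in> M \<Longrightarrow> I m \<union> J m \<subseteq> {m - K..m + K}"
    and lim: "(\<lambda>n. saddle n * (\<Sum>m\<in>M \<inter> {..<n}. pattern_weight (saddle n) (I m) (J m))) \<longlonglongrightarrow> c"
  shows "(\<lambda>n. real (\<Sum>m\<in>M \<inter> {..<n}. card {A \<in> odd_sets n. I m \<subseteq> A \<and> A \<inter> J m = {}}) / main_term n) \<longlonglongrightarrow> c"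
proof -
  let ?N = "\<lambda>n. n + K + 1"
  define P where "P n \<theta> = (\<Sum>m\<in>M \<inter> {..<n}. pattern_char (saddle n) \<theta> (?N n) (I m) (J m))" for n \<theta>
  define Q where "Q n \<theta> = indicator {-pi..pi} \<theta> *\<^sub>R (cis (real n * \<theta>) * P n \<theta>)" for n and \<theta> :: real
  define \<theta> where "\<theta> n \<tau> = \<tau> * (saddle n * sqrt (saddle n))" for n \<tau>
  \<comment> \<open>The factor \<open>saddle n\<close> balances the sum over m in P, which is of
    order 1 / \<open>saddle n\<close>.\<close>
  define F where "F n \<tau> = of_real (saddle n) * Q n (\<theta> n \<tau>)" for n \<tau>
  define W where "W n = (\<Sum>m\<in>M \<inter> {..<n}. pattern_weight (saddle n) (I m) (J m))" for n
  define count where "count n = (\<Sum>m\<in>M \<inter> {..<n}. card {A \<in> odd_sets n. I m \<subseteq> A \<and> A \<inter> J m = {}})" for n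
  have sub: "I m \<union> J m \<subseteq> {..<?N n}" if "m \<in> M \<inter> {..<n}" for m n
    using window[of m] that by fastforce
  have cardIJ: "card (I m \<union> J m) \<le> 2 * K + 1" if "m \<in> M" for m
  proof -
    have "card (I m \<union> J m) \<le> card {m - K..m + K}"
      by (rule card_mono[OF _ window[OF that]]) simp
    then show ?thesis by simp
  qed
  have finI: "finite (I m)" if "m \<in> M" for m
    using window[OF that] by (auto intro: finite_subset)
  have pw: "pattern_weight x (I m) (J m) \<le> exp (- (real (wt m) * x))" if "m \<in> M" for m x
    by (rule pattern_weight_le_exp[OF finI[OF that] mem[OF that]])
  have contQ: "continuous_on S (\<lambda>\<theta>. cis (real n * \<theta>) * P n \<theta>)" for S n
    unfolding P_def by (intro continuous_intros continuous_on_cis_mult continuous_on_pattern_char)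
  have measQ: "Q n \<in> borel_measurable borel" for n
  proof -
    have "(\<lambda>\<theta>. cis (real n * \<theta>) * P n \<theta>) \<in> borel_measurable borel"
      by (rule borel_measurable_continuous_onI[OF contQ])
    then show ?thesis unfolding Q_def[abs_def] by measurable
  qed
  have measF: "F n \<in> borel_measurable lborel" for n
    unfolding F_def[abs_def] \<theta>_def using measQ[of n] by measurable
  have int_count: "of_nat (count n) = complex_of_real (exp (real n * saddle n) * partition_function (saddle n) (?N n) * sqrt (saddle n) / (2 * pi))
      * (\<integral>\<tau>. F n \<tau> \<partial>lborel)" if n: "0 < n" for n
  proof -
    let ?x = "saddle n"
    let ?k = "complex_of_real (exp (real n * ?x) * partition_function ?x (?N n) / (2 * pi))"
    have x: "0 < ?x" by (rule saddle_pos[OF n])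
    have "of_nat (count n) = (\<Sum>m\<in>M \<inter> {..<n}. ?k *
        (\<integral>\<theta>. indicator {-pi..pi} \<theta> *\<^sub>R (cis (real n * \<theta>) * pattern_char ?x \<theta> (?N n) (I m) (J m)) \<partial>lborel))"
      unfolding count_def of_nat_sum
      by (rule sum.cong[OF refl], rule card_pattern_eq_integral) (use sub in auto)
    also have "\<dots> = ?k * (\<integral>\<theta>. (\<Sum>m\<in>M \<inter> {..<n}. indicator {-pi..pi} \<theta> *\<^sub>R (cis (real n * \<theta>) * pattern_char ?x \<theta> (?N n) (I m) (J m))) \<partial>lborel)"
    proof (subst Bochner_Integration.integral_sum)
      fix m
      have "continuous_on {-pi..pi} (\<lambda>\<theta>. cis (real n * \<theta>) * pattern_char ?x \<theta> (?N n) (I m) (J m))"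
        by (intro continuous_intros continuous_on_cis_mult continuous_on_pattern_char)
      from borel_integrable_atLeastAtMost'[OF this]
      show "integrable lborel (\<lambda>\<theta>. indicator {-pi..pi} \<theta> *\<^sub>R (cis (real n * \<theta>) * pattern_char ?x \<theta> (?N n) (I m) (J m)))"
        unfolding set_integrable_def .
    qed (rule sum_distrib_left[symmetric])
    also have "(\<lambda>\<theta>. \<Sum>m\<in>M \<inter> {..<n}. indicator {-pi..pi} \<theta> *\<^sub>R (cis (real n * \<theta>) * pattern_char ?x \<theta> (?N n) (I m) (J m))) = Q n"
      unfolding Q_def[abs_def] P_def sum_distrib_left scaleR_sum_right ..
    \<comment> \<open>The substitution has Jacobian x^(3/2); dividing out the factor x contained in
      F leaves sqrt x.\<close>
    also have "(\<integral>\<theta>. Q n \<theta> \<partial>lborel) = \<bar>?x * sqrt ?x\<bar> *\<^sub>R (\<integral>\<tau>. Q n (0 + ?x * sqrt ?x * \<tau>) \<partial>lborel)"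
      by (rule lborel_integral_real_affine) (use x in auto)
    also have "(\<lambda>\<tau>. Q n (0 + ?x * sqrt ?x * \<tau>)) = (\<lambda>\<tau>. of_real (1 / ?x) * F n \<tau>)"
    proof (rule ext)
      fix \<tau>
      have "\<theta> n \<tau> = 0 + ?x * sqrt ?x * \<tau>" by (simp add: \<theta>_def mult_ac)
      moreover have "complex_of_real (1 / ?x) * of_real ?x = 1"
        using x by (simp only: of_real_mult[symmetric]) simp
      then have "complex_of_real (1 / ?x) * (of_real ?x * q) = q" for q
        unfolding mult.assoc[symmetric] by simp
      ultimately show "Q n (0 + ?x * sqrt ?x * \<tau>) = of_real (1 / ?x) * F n \<tau>"
        unfolding F_def by simp
    qed
    also have "(\<integral>\<tau>. of_real (1 / ?x) * F n \<tau> \<partial>lborel) = of_real (1 / ?x) * (\<integral>\<tau>. F n \<tau> \<partial>lborel)"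
      by (rule integral_mult_right_zero)
    also have "\<bar>?x * sqrt ?x\<bar> *\<^sub>R (of_real (1 / ?x) * (\<integral>\<tau>. F n \<tau> \<partial>lborel)) = of_real (sqrt ?x) * (\<integral>\<tau>. F n \<tau> \<partial>lborel)"
    proof -
      have "\<bar>?x * sqrt ?x\<bar> * (1 / ?x) = sqrt ?x" using x by simp
      then show ?thesis by (metis mult_scaleR_left of_real_def scaleR_scaleR)
    qed
    finally show ?thesis by (simp add: mult_ac)
  qed
  \<comment> \<open>The exponent combines 1 / 4 from the tail term, at most 1, and a loss of 2 for
    each of at most 2 K + 1 window positions, both divided by 4; likewise 512 = 4 * 128.\<close>
  define B where "B = exp (1 / 4 + real (2 * K + 1) / 2) * (12 * pi\<^sup>2 / (1 / 512) ^ 3)"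
  have bound: "norm (F n \<tau>) \<le> B * (1 / (1 + \<tau>\<^sup>2))"
    if x: "0 < saddle n" "saddle n \<le> 1" and tail: "exp (- (2 * real (?N n) * saddle n)) / saddle n \<le> 1" for n \<tau>
  proof (cases "\<theta> n \<tau> \<in> {-pi..pi}")
    case True
    let ?x = "saddle n" and ?th = "\<theta> n \<tau>"
    let ?V = "\<Sum>a<?N n. exp (- (real (wt a) * ?x)) * (1 - cos (real (wt a) * ?th))"
    let ?E = "exp (1 / 4 + real (2 * K + 1) / 2) * exp (- (1 / 512 * min (1 / ?x) (\<tau>\<^sup>2)))"
    have th: "\<bar>?th\<bar> \<le> pi" using True by auto
    have "?th\<^sup>2 / ?x ^ 3 = \<tau>\<^sup>2"
    proof -
      have "(?x * sqrt ?x)\<^sup>2 = ?x ^ 3"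
        using x by (simp add: power_mult_distrib) (simp add: power2_eq_square power3_eq_cube)
      then have "?th\<^sup>2 = \<tau>\<^sup>2 * ?x ^ 3" by (simp add: \<theta>_def power_mult_distrib)
      then show ?thesis using x by simp
    qed
    then have V: "min (1 / ?x) (\<tau>\<^sup>2) / 128 - 1 \<le> ?V"
      using order_trans[OF diff_left_mono[OF tail] sum_damped_cos_ge[OF x th, of "?N n"]] by simp
    have exponent: "- ((v - 2 * k) / 4) \<le> 1 / 4 + k' / 2 + - (1 / 512 * \<mu>)"
      if "\<mu> / 128 - 1 \<le> v" "k \<le> k'" for v k k' \<mu> :: real
      using that by (simp add: field_simps)
    have term_le: "norm (pattern_char ?x ?th (?N n) (I m) (J m)) \<le> exp (- (real (wt m) * ?x)) * ?E" if m: "m \<in> M \<inter> {..<n}" for m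
    proof -
      have mM: "m \<in> M" using m by simp
      have "norm (pattern_char ?x ?th (?N n) (I m) (J m)) \<le> pattern_weight ?x (I m) (J m) * exp (- ((?V - 2 * real (card (I m \<union> J m))) / 4))"
        by (rule norm_pattern_char_le[OF disj[OF mM] sub[OF m]]) (use x in simp)
      also have "\<dots> \<le> exp (- (real (wt m) * ?x)) * ?E"
      proof (rule mult_mono[OF pw[OF mM]])
        have "real (card (I m \<union> J m)) \<le> real (2 * K + 1)" using cardIJ[OF mM] by (rule of_nat_mono)
        then have "- ((?V - 2 * real (card (I m \<union> J m))) / 4) \<le> 1 / 4 + real (2 * K + 1) / 2 + - (1 / 512 * min (1 / ?x) (\<tau>\<^sup>2))"
          by (rule exponent[OF V])
        then show "exp (- ((?V - 2 * real (card (I m \<union> J m))) / 4)) \<le> ?E"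
          unfolding exp_add[symmetric] exp_le_cancel_iff .
      qed auto
      finally show ?thesis .
    qed
    have "norm (P n ?th) \<le> (\<Sum>m\<in>M \<inter> {..<n}. exp (- (real (wt m) * ?x)) * ?E)"
      unfolding P_def by (rule order_trans[OF norm_sum sum_mono]) (rule term_le)
    also have "\<dots> = (\<Sum>m\<in>M \<inter> {..<n}. exp (- (real (wt m) * ?x))) * ?E"
      by (rule sum_distrib_right[symmetric])
    also have "\<dots> \<le> (\<Sum>m<n. exp (- (real (wt m) * ?x))) * ?E"
      by (intro mult_right_mono sum_mono2) auto
    also have "\<dots> \<le> (1 / (2 * ?x)) * ?E"
      using sum_exp_odd_le[OF x(1), of n] by (intro mult_right_mono) (auto simp: wt_def)
    finally have Pn: "norm (P n ?th) \<le> (1 / (2 * ?x)) * ?E" .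
    have "norm (F n \<tau>) = ?x * norm (P n ?th)"
      using True x by (simp add: F_def Q_def norm_mult)
    also have "\<dots> \<le> ?x * ((1 / (2 * ?x)) * ?E)"
      using Pn x by (intro mult_left_mono) auto
    also have "\<dots> \<le> ?E" using x by simp
    also have "\<dots> \<le> exp (1 / 4 + real (2 * K + 1) / 2) * ((12 * pi\<^sup>2 / (1 / 512) ^ 3) * (1 / (1 + \<tau>\<^sup>2)))"
      by (intro mult_left_mono exp_neg_min_le) (use x th in \<open>auto simp: \<theta>_def\<close>)
    finally show ?thesis by (simp only: B_def mult.assoc)
  next
    case False
    then have "F n \<tau> = 0" by (simp add: F_def Q_def)
    moreover have "0 \<le> B * (1 / (1 + \<tau>\<^sup>2))"
      unfolding B_def by (intro mult_nonneg_nonneg divide_nonneg_nonneg add_nonneg_nonneg) auto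
    ultimately show ?thesis by simp
  qed
  have pointwise: "(\<lambda>n. F n \<tau>) \<longlonglongrightarrow> of_real c * of_real (exp (- (pi\<^sup>2 * \<tau>\<^sup>2 / 24)))" for \<tau>
  proof -
    let ?C = "\<lambda>n. cis (real n * \<theta> n \<tau>) * (\<Prod>a<?N n. char_factor (saddle n) (\<theta> n \<tau>) a)"
    have "?C \<longlonglongrightarrow> of_real (exp (- (pi\<^sup>2 * \<tau>\<^sup>2 / 24)))"
      unfolding \<theta>_def by (rule char_product_tendsto)
    from tendsto_mult[OF tendsto_of_real[OF lim] this]
    have main: "(\<lambda>n. of_real (saddle n * W n) * ?C n) \<longlonglongrightarrow> of_real c * of_real (exp (- (pi\<^sup>2 * \<tau>\<^sup>2 / 24)))"
      unfolding W_def .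
    have "(\<lambda>n. \<theta> n \<tau>) \<longlonglongrightarrow> \<tau> * (0 * sqrt 0)"
      unfolding \<theta>_def by (intro tendsto_intros saddle_tendsto_0)
    then have "(\<lambda>n. \<theta> n \<tau>) \<longlonglongrightarrow> 0" by simp
    then have "eventually (\<lambda>n. \<theta> n \<tau> \<in> {-pi<..<pi}) sequentially"
      by (rule topological_tendstoD) (auto simp: pi_gt_zero)
    then have inside: "eventually (\<lambda>n. \<theta> n \<tau> \<in> {-pi..pi}) sequentially"
      by (rule eventually_mono) auto
    \<comment> \<open>Replacing every pattern by the common product costs O(\<bar>\<theta>\<bar> /
      x^2) after summing over m; with \<bar>\<theta>\<bar> of order x^(3/2) and the factor x of F
      this is O(sqrt x).\<close>
    have "(\<lambda>n. F n \<tau> - of_real (saddle n * W n) * ?C n) \<longlonglongrightarrow> 0"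
    proof (rule Lim_null_comparison)
      show "eventually (\<lambda>n. norm (F n \<tau> - of_real (saddle n * W n) * ?C n)
          \<le> 2 * (real (2 * K + 1))\<^sup>2 * \<bar>\<tau>\<bar> * sqrt (saddle n)) sequentially"
        using eventually_saddle inside
      proof eventually_elim
        case (elim n)
        let ?x = "saddle n" and ?th = "\<theta> n \<tau>"
        let ?X = "\<Prod>a<?N n. char_factor ?x ?th a"
        have F: "F n \<tau> = of_real ?x * (cis (real n * ?th) * P n ?th)"
          using elim by (simp add: F_def Q_def)
        have diff: "P n ?th - of_real (W n) * ?X
            = (\<Sum>m\<in>M \<inter> {..<n}. pattern_char ?x ?th (?N n) (I m) (J m) - of_real (pattern_weight ?x (I m) (J m)) * ?X)"
          by (simp add: P_def W_def sum_subtractf sum_distrib_right)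
        have "norm (P n ?th - of_real (W n) * ?X)
            \<le> (\<Sum>m\<in>M \<inter> {..<n}. ((real (2 * K + 1))\<^sup>2 * \<bar>?th\<bar>) * (real (wt m) ^ 1 * exp (- (real (wt m) * ?x))))"
          unfolding diff
        proof (rule order_trans[OF norm_sum sum_mono])
          fix m assume m: "m \<in> M \<inter> {..<n}"
          then have mM: "m \<in> M" by simp
          have "norm (pattern_char ?x ?th (?N n) (I m) (J m) - of_real (pattern_weight ?x (I m) (J m)) * ?X)
              \<le> pattern_weight ?x (I m) (J m) * (\<Sum>a\<in>I m \<union> J m. real (wt a) * \<bar>?th\<bar>)"
            by (rule pattern_char_approx[OF disj[OF mM] sub[OF m]])
          also have "\<dots> \<le> exp (- (real (wt m) * ?x)) * (real (2 * K + 1) * (real (2 * K + 1) * real (wt m) * \<bar>?th\<bar>))"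
          proof (rule mult_mono[OF pw[OF mM]])
            have "(\<Sum>a\<in>I m \<union> J m. real (wt a) * \<bar>?th\<bar>) \<le> real (card (I m \<union> J m)) * (real (2 * K + 1) * real (wt m) * \<bar>?th\<bar>)"
            proof (rule sum_bounded_above, rule mult_right_mono)
              fix a assume "a \<in> I m \<union> J m"
              then have "a \<le> m + K" using window[OF mM] by auto
              \<comment> \<open>Indeed 2 (m + K) + 1 = (2 m + 1) + 2 K <= (2 K + 1) (2 m +
                1).\<close>
              then have "wt a \<le> (2 * K + 1) * wt m" by (simp add: wt_def algebra_simps)
              then show "real (wt a) \<le> real (2 * K + 1) * real (wt m)"
                by (simp only: of_nat_le_iff of_nat_mult[symmetric])
            qed simp
            also have "\<dots> \<le> real (2 * K + 1) * (real (2 * K + 1) * real (wt m) * \<bar>?th\<bar>)"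
              using cardIJ[OF mM] by (intro mult_right_mono of_nat_mono) auto
            finally show "(\<Sum>a\<in>I m \<union> J m. real (wt a) * \<bar>?th\<bar>) \<le> real (2 * K + 1) * (real (2 * K + 1) * real (wt m) * \<bar>?th\<bar>)" .
          qed (auto intro!: sum_nonneg)
          also have "\<dots> = ((real (2 * K + 1))\<^sup>2 * \<bar>?th\<bar>) * (real (wt m) ^ 1 * exp (- (real (wt m) * ?x)))"
            by (simp only: power2_eq_square power_one_right mult_ac)
          finally show "norm (pattern_char ?x ?th (?N n) (I m) (J m) - of_real (pattern_weight ?x (I m) (J m)) * ?X)
              \<le> ((real (2 * K + 1))\<^sup>2 * \<bar>?th\<bar>) * (real (wt m) ^ 1 * exp (- (real (wt m) * ?x)))" .
        qed
        also have "\<dots> \<le> (\<Sum>m<n. ((real (2 * K + 1))\<^sup>2 * \<bar>?th\<bar>) * (real (wt m) ^ 1 * exp (- (real (wt m) * ?x))))"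
        proof (rule sum_mono2)
          show "0 \<le> ((real (2 * K + 1))\<^sup>2 * \<bar>?th\<bar>) * (real (wt m) ^ 1 * exp (- (real (wt m) * ?x)))" for m
            by (intro mult_nonneg_nonneg zero_le_power of_nat_0_le_iff abs_ge_zero exp_ge_zero)
        qed (rule finite_lessThan, rule Int_lower2)
        also have "\<dots> \<le> ((real (2 * K + 1))\<^sup>2 * \<bar>?th\<bar>) * (fact 1 * 2 ^ 1 / ?x ^ Suc 1)"
          unfolding sum_distrib_left[symmetric] by (intro mult_left_mono sum_wt_power_exp_le) (use elim in auto)
        finally have PW: "norm (P n ?th - of_real (W n) * ?X) \<le> ((real (2 * K + 1))\<^sup>2 * \<bar>?th\<bar>) * (fact 1 * 2 ^ 1 / ?x ^ Suc 1)" .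
        have "F n \<tau> - of_real (?x * W n) * ?C n = of_real ?x * (cis (real n * ?th) * (P n ?th - of_real (W n) * ?X))"
          unfolding F by (simp add: algebra_simps)
        then have "norm (F n \<tau> - of_real (?x * W n) * ?C n) = ?x * norm (P n ?th - of_real (W n) * ?X)"
          using elim by (simp add: norm_mult)
        also have "\<dots> \<le> ?x * (((real (2 * K + 1))\<^sup>2 * \<bar>?th\<bar>) * (fact 1 * 2 ^ 1 / ?x ^ Suc 1))"
          using PW elim by (intro mult_left_mono) auto
        also have "\<dots> = 2 * (real (2 * K + 1))\<^sup>2 * \<bar>\<tau>\<bar> * sqrt ?x"
        proof -
          have "\<bar>?th\<bar> = \<bar>\<tau>\<bar> * (?x * sqrt ?x)" using elim by (simp add: \<theta>_def abs_mult)
          then show ?thesis using elim by (simp add: field_simps)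
        qed
        finally show ?case .
      qed
      have "(\<lambda>n. sqrt (saddle n)) \<longlonglongrightarrow> 0"
        using tendsto_real_sqrt[OF saddle_tendsto_0] by simp
      from tendsto_mult_right_zero[OF this]
      show "(\<lambda>n. 2 * (real (2 * K + 1))\<^sup>2 * \<bar>\<tau>\<bar> * sqrt (saddle n)) \<longlonglongrightarrow> 0" .
    qed
    from tendsto_add[OF this main] show ?thesis by simp
  qed
  have "(\<lambda>n. exp (- (2 * real (?N n) * saddle n)) / saddle n) \<longlonglongrightarrow> 0"
    unfolding saddle_def by real_asymp
  then have "eventually (\<lambda>n. exp (- (2 * real (?N n) * saddle n)) / saddle n < 1) sequentially"
    by (rule order_tendstoD(2)) simp
  with eventually_saddle
  have "eventually (\<lambda>n. \<forall>\<tau>. norm (F n \<tau>) \<le> B * (1 / (1 + \<tau>\<^sup>2))) sequentially"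
    by eventually_elim (simp only: bound less_imp_le simp_thms)
  \<comment> \<open>Dominated convergence asks for the bound at every index, so the sequence is
    shifted by n0 and the shift is undone afterwards.\<close>
  then obtain n0 where n0: "\<And>n \<tau>. n0 \<le> n \<Longrightarrow> norm (F n \<tau>) \<le> B * (1 / (1 + \<tau>\<^sup>2))"
    unfolding eventually_sequentially by blast
  have "(\<lambda>n. \<integral>\<tau>. F (n + n0) \<tau> \<partial>lborel) \<longlonglongrightarrow> (\<integral>\<tau>. of_real c * of_real (exp (- (pi\<^sup>2 * \<tau>\<^sup>2 / 24))) \<partial>lborel)"
  proof (rule integral_dominated_convergence[where w = "\<lambda>\<tau>. B * (1 / (1 + \<tau>\<^sup>2))"])
    show "(\<lambda>\<tau>. complex_of_real c * complex_of_real (exp (- (pi\<^sup>2 * \<tau>\<^sup>2 / 24)))) \<in> borel_measurable lborel"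
      by measurable
    show "integrable lborel (\<lambda>\<tau>. B * (1 / (1 + \<tau>\<^sup>2)))"
      by (intro integrable_mult_right integrable_one_over_one_plus_square)
    show "AE \<tau> in lborel. (\<lambda>n. F (n + n0) \<tau>) \<longlonglongrightarrow> of_real c * of_real (exp (- (pi\<^sup>2 * \<tau>\<^sup>2 / 24)))"
      by (intro AE_I2 LIMSEQ_ignore_initial_segment pointwise)
    show "AE \<tau> in lborel. norm (F (n + n0) \<tau>) \<le> B * (1 / (1 + \<tau>\<^sup>2))" for n
      by (intro AE_I2 n0) simp
  qed (rule measF)
  then have "(\<lambda>n. \<integral>\<tau>. F n \<tau> \<partial>lborel) \<longlonglongrightarrow> (\<integral>\<tau>. of_real c * of_real (exp (- (pi\<^sup>2 * \<tau>\<^sup>2 / 24))) \<partial>lborel)"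
    by (rule LIMSEQ_offset)
  also have "(\<integral>\<tau>. complex_of_real c * of_real (exp (- (pi\<^sup>2 * \<tau>\<^sup>2 / 24))) \<partial>lborel) = of_real (c * sqrt (24 / pi))"
    unfolding integral_mult_right_zero integral_complex_of_real gaussian_integral(2) by simp
  finally have limF: "(\<lambda>n. \<integral>\<tau>. F n \<tau> \<partial>lborel) \<longlonglongrightarrow> of_real (c * sqrt (24 / pi))" .
  define r where "r n = exp (real n * saddle n) * partition_function (saddle n) (?N n) / exp (pi * sqrt (real n / 6))" for n
  have "r \<longlonglongrightarrow> 1"
    unfolding r_def by (rule partition_function_asymptotic)
  from tendsto_mult[OF tendsto_of_real[OF tendsto_mult[OF this tendsto_const[of "sqrt (pi / 24)"]]] limF]
  have "(\<lambda>n. of_real (r n * sqrt (pi / 24)) * (\<integral>\<tau>. F n \<tau> \<partial>lborel)) \<longlonglongrightarrow> complex_of_real (1 * sqrt (pi / 24)) * of_real (c * sqrt (24 / pi))" .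
  also have "complex_of_real (1 * sqrt (pi / 24)) * of_real (c * sqrt (24 / pi)) = of_real c"
  proof -
    have "sqrt (pi / 24) * sqrt (24 / pi) = 1" by (simp flip: real_sqrt_mult)
    then have "1 * sqrt (pi / 24) * (c * sqrt (24 / pi)) = c" by (metis mult.left_commute mult.right_neutral mult_1)
    then show ?thesis by (simp only: of_real_mult[symmetric])
  qed
  finally have "(\<lambda>n. of_real (r n * sqrt (pi / 24)) * (\<integral>\<tau>. F n \<tau> \<partial>lborel)) \<longlonglongrightarrow> complex_of_real c" .
  moreover have "eventually (\<lambda>n. of_real (r n * sqrt (pi / 24)) * (\<integral>\<tau>. F n \<tau> \<partial>lborel) = complex_of_real (real (count n) / main_term n)) sequentially"
    using eventually_gt_at_top[of 0]
  proof eventually_elim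
    case (elim n)
    let ?e = "exp (pi * sqrt (real n / 6))"
    have "exp (real n * saddle n) * partition_function (saddle n) (?N n) * sqrt (saddle n) / (2 * pi)
        = r n * (?e * sqrt (saddle n) / (2 * pi))"
      by (simp add: r_def)
    also have "\<dots> = main_term n * (r n * sqrt (pi / 24))"
      unfolding saddle_main_term_const[OF elim] by (simp only: mult_ac)
    finally have "complex_of_real (real (count n)) = of_real (main_term n * (r n * sqrt (pi / 24))) * (\<integral>\<tau>. F n \<tau> \<partial>lborel)"
      using int_count[OF elim] by simp
    then show ?case using main_term_pos[OF elim] by simp
  qed
  ultimately have "(\<lambda>n. complex_of_real (real (count n) / main_term n)) \<longlonglongrightarrow> of_real c"
    by (rule Lim_transform_eventually)
  then show ?thesis
    unfolding tendsto_of_real_iff count_def .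
qed

subsection \<open>Asymptotics of the hook counts\<close>

text \<open>Double counting of pairs (A, m). An occurrence at m puts m into A, which forces m < n
  and makes the index set independent of A.\<close>

lemma sum_card_pattern:
  assumes "\<And>m. m \<in> M \<Longrightarrow> m \<in> I m"
  shows "(\<Sum>A\<in>odd_sets n. card {m \<in> M. I m \<subseteq> A \<and> A \<inter> J m = {}})
    = (\<Sum>m\<in>M \<inter> {..<n}. card {A \<in> odd_sets n. I m \<subseteq> A \<and> A \<inter> J m = {}})"
proof -
  have "(\<Sum>A\<in>odd_sets n. card {m \<in> M. I m \<subseteq> A \<and> A \<inter> J m = {}})
      = (\<Sum>A\<in>odd_sets n. card {m \<in> M \<inter> {..<n}. I m \<subseteq> A \<and> A \<inter> J m = {}})"
  proof (rule sum.cong[OF refl])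
    fix A assume A: "A \<in> odd_sets n"
    have "{m \<in> M. I m \<subseteq> A \<and> A \<inter> J m = {}} = {m \<in> M \<inter> {..<n}. I m \<subseteq> A \<and> A \<inter> J m = {}}"
      using assms odd_sets_bound[OF A] by blast
    then show "card {m \<in> M. I m \<subseteq> A \<and> A \<inter> J m = {}} = card {m \<in> M \<inter> {..<n}. I m \<subseteq> A \<and> A \<inter> J m = {}}"
      by (rule arg_cong)
  qed
  also have "\<dots> = (\<Sum>m\<in>M \<inter> {..<n}. card {A \<in> odd_sets n. I m \<subseteq> A \<and> A \<inter> J m = {}})"
    by (rule sum_multicount_gen) (auto simp: finite_odd_sets)
  finally show ?thesis .
qed

text \<open>The pattern "a in, a - t out" has limit 1 / 4, half the integral of 1 / (1 + y)^2, and
  is counted twice. The offset t disappears in the limit, which is why the answer does not depend on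
  t.\<close>

lemma a_star_tendsto:
  assumes "1 \<le> t"
  shows "(\<lambda>n. real (a_star t n) / main_term n) \<longlonglongrightarrow> 1 / 2"
proof -
  define f where "f n = (\<Sum>m\<in>{t..} \<inter> {..<n}. card {A \<in> odd_sets n. {m} \<subseteq> A \<and> A \<inter> {m - t} = {}})" for n
  define g where "g n = (\<Sum>m\<in>{..<t} \<inter> {..<n}. card {A \<in> odd_sets n. {m, t - 1 - m} \<subseteq> A \<and> A \<inter> {} = {}})" for n
  have half: "moment_int 0 (Suc (0 + 1)) / 2 = 1 / 4"
    using moment_int_0[of 0] by simp
  have "(\<lambda>n. saddle n * (\<Sum>m\<in>{t..} \<inter> {..<n}. pattern_weight (saddle n) {m} {m - t})) \<longlonglongrightarrow> 1 / 4"
    unfolding half[symmetric] by (rule pattern_sum_tendsto[where K = t]) (use assms in auto)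
  then have f: "(\<lambda>n. real (f n) / main_term n) \<longlonglongrightarrow> 1 / 4"
    unfolding f_def by (rule pattern_count_tendsto[where K = t, rotated 3]) (use assms in auto)
  \<comment> \<open>There are at most t boundary positions, each of weight at most 1, so the factor
    \<open>saddle n\<close> makes them vanish.\<close>
  have "(\<lambda>n. saddle n * (\<Sum>m\<in>{..<t} \<inter> {..<n}. pattern_weight (saddle n) {m, t - 1 - m} {})) \<longlonglongrightarrow> 0"
  proof (rule Lim_null_comparison)
    show "eventually (\<lambda>n. norm (saddle n * (\<Sum>m\<in>{..<t} \<inter> {..<n}. pattern_weight (saddle n) {m, t - 1 - m} {})) \<le> real t * saddle n) sequentially"
      using eventually_saddle
    proof eventually_elim
      case (elim n)
      let ?W = "\<Sum>m\<in>{..<t} \<inter> {..<n}. pattern_weight (saddle n) {m, t - 1 - m} {}"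
      have "?W \<le> real (card ({..<t} \<inter> {..<n})) * 1"
      proof (rule sum_bounded_above)
        fix m
        have "pattern_weight (saddle n) {m, t - 1 - m} {} \<le> exp (- (real (wt m) * saddle n))"
          by (rule pattern_weight_le_exp) auto
        also have "\<dots> \<le> 1" using elim by simp
        finally show "pattern_weight (saddle n) {m, t - 1 - m} {} \<le> 1" .
      qed
      also have "\<dots> \<le> real t"
        using card_mono[of "{..<t}" "{..<t} \<inter> {..<n}"] by simp
      finally have "?W \<le> real t" .
      moreover have "0 \<le> ?W" by (intro sum_nonneg pattern_weight_nonneg)
      ultimately show ?case using elim by (simp add: abs_mult mult_right_mono mult.commute)
    qed
    show "(\<lambda>n. real t * saddle n) \<longlonglongrightarrow> 0"
      by (rule tendsto_mult_right_zero[OF saddle_tendsto_0])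
  qed
  then have g: "(\<lambda>n. real (g n) / main_term n) \<longlonglongrightarrow> 0"
    unfolding g_def by (rule pattern_count_tendsto[where K = t, rotated 3]) auto
  have "a_star t n = 2 * f n + g n" for n
  proof -
    have "(\<Sum>A\<in>odd_sets n. card {a \<in> A. t \<le> a \<and> a - t \<notin> A})
        = (\<Sum>A\<in>odd_sets n. card {m \<in> {t..}. {m} \<subseteq> A \<and> A \<inter> {m - t} = {}})"
      by (intro sum.cong refl arg_cong[of _ _ card]) auto
    also have "\<dots> = f n" unfolding f_def by (rule sum_card_pattern) simp
    finally have 1: "(\<Sum>A\<in>odd_sets n. card {a \<in> A. t \<le> a \<and> a - t \<notin> A}) = f n" .
    have "(\<Sum>A\<in>odd_sets n. card {a \<in> A. a < t \<and> t - 1 - a \<in> A})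
        = (\<Sum>A\<in>odd_sets n. card {m \<in> {..<t}. {m, t - 1 - m} \<subseteq> A \<and> A \<inter> {} = {}})"
      by (intro sum.cong refl arg_cong[of _ _ card]) auto
    also have "\<dots> = g n" unfolding g_def by (rule sum_card_pattern) simp
    finally have 2: "(\<Sum>A\<in>odd_sets n. card {a \<in> A. a < t \<and> t - 1 - a \<in> A}) = g n" .
    show ?thesis unfolding a_star_eq[OF assms] 1 2 ..
  qed
  then have "real (a_star t n) / main_term n = 2 * (real (f n) / main_term n) + real (g n) / main_term n" for n
    by (simp add: add_divide_distrib)
  moreover have "(\<lambda>n. 2 * (real (f n) / main_term n) + real (g n) / main_term n) \<longlonglongrightarrow> 2 * (1 / 4) + 0"
    by (intro tendsto_intros f g)
  ultimately show ?thesis by simp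
qed

text \<open>Splitting by the exact set T of offsets s with m - s in A turns a condition on the
  number of elements in a window into disjoint membership patterns. With k <= m, truncated
  subtraction is injective on the offsets. P later carries a <= 2 m, which for a = 2 k + 1 also
  excludes m = k.\<close>

lemma card_window_eq_sum:
  fixes A :: "nat set"
  assumes "finite A"
  shows "card {m \<in> A. 2 * k \<le> 2 * m \<and> P m \<and> card (A \<inter> {m - k..<m}) = l}
    = (\<Sum>T | T \<subseteq> {1..k} \<and> card T = l.
        card {m \<in> {m. k \<le> m \<and> P m}. insert m ((\<lambda>s. m - s) ` T) \<subseteq> A \<and> A \<inter> (\<lambda>s. m - s) ` ({1..k} - T) = {}})"
proof -
  define Y where "Y T = {m \<in> {m. k \<le> m \<and> P m}. insert m ((\<lambda>s. m - s) ` T) \<subseteq> A \<and> A \<inter> (\<lambda>s. m - s) ` ({1..k} - T) = {}}" for T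
  define D where "D m = {s \<in> {1..k}. m - s \<in> A}" for m
  have Y: "m \<in> Y T \<longleftrightarrow> k \<le> m \<and> P m \<and> m \<in> A \<and> T = D m" if "T \<subseteq> {1..k}" for m T
    using that unfolding Y_def D_def by blast
  have card: "card (A \<inter> {m - k..<m}) = card (D m)" if "k \<le> m" for m
  proof -
    have "A \<inter> {m - k..<m} = (\<lambda>s. m - s) ` D m"
    proof
      show "A \<inter> {m - k..<m} \<subseteq> (\<lambda>s. m - s) ` D m"
      proof
        fix a assume a: "a \<in> A \<inter> {m - k..<m}"
        then have "m - a \<in> D m" "a = m - (m - a)" using that by (auto simp: D_def)
        then show "a \<in> (\<lambda>s. m - s) ` D m" by blast
      qed
      show "(\<lambda>s. m - s) ` D m \<subseteq> A \<inter> {m - k..<m}" using that by (auto simp: D_def)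
    qed
    moreover have "inj_on (\<lambda>s. m - s) (D m)"
      by (rule inj_onI) (use that in \<open>auto simp: D_def\<close>)
    ultimately show ?thesis by (simp add: card_image)
  qed
  have "{m \<in> A. 2 * k \<le> 2 * m \<and> P m \<and> card (A \<inter> {m - k..<m}) = l} = (\<Union>T\<in>{T. T \<subseteq> {1..k} \<and> card T = l}. Y T)"
  proof (rule Set.set_eqI)
    fix m
    have "D m \<subseteq> {1..k}" by (auto simp: D_def)
    then show "m \<in> {m \<in> A. 2 * k \<le> 2 * m \<and> P m \<and> card (A \<inter> {m - k..<m}) = l}
        \<longleftrightarrow> m \<in> (\<Union>T\<in>{T. T \<subseteq> {1..k} \<and> card T = l}. Y T)"
      using Y card by auto
  qed
  also have "card \<dots> = (\<Sum>T | T \<subseteq> {1..k} \<and> card T = l. card (Y T))"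
  proof (rule card_UN_disjoint)
    show "finite {T. T \<subseteq> {1..k} \<and> card T = l}"
      by (rule finite_subset[of _ "Pow {1..k}"]) auto
    have "Y T \<subseteq> A" for T by (auto simp: Y_def)
    then show "\<forall>T\<in>{T. T \<subseteq> {1..k} \<and> card T = l}. finite (Y T)"
      using finite_subset[OF _ assms] by simp
    show "\<forall>T\<in>{T. T \<subseteq> {1..k} \<and> card T = l}. \<forall>T'\<in>{T. T \<subseteq> {1..k} \<and> card T = l}. T \<noteq> T' \<longrightarrow> Y T \<inter> Y T' = {}"
    proof (intro ballI impI equals0I)
      fix T T' m assume "T \<in> {T. T \<subseteq> {1..k} \<and> card T = l}" "T' \<in> {T. T \<subseteq> {1..k} \<and> card T = l}"
        "T \<noteq> T'" "m \<in> Y T \<inter> Y T'"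
      then show False using Y[of T m] Y[of T' m] by simp
    qed
  qed
  finally show ?thesis by (simp only: Y_def)
qed

text \<open>For a given arm a the limit depends on T only through its size, the leg t - 1 - a, so
  summing over T produces the binomial coefficient of \<open>hook_const\<close>.\<close>

lemma b_star_tendsto:
  assumes "1 \<le> t"
  shows "(\<lambda>n. real (b_star t n) / main_term n) \<longlonglongrightarrow> hook_const t"
proof -
  define M where "M a = {m::nat. a div 2 \<le> m \<and> a \<le> 2 * m}" for a
  define I where "I T m = insert m ((\<lambda>s. m - s) ` T)" for T and m :: nat
  define J where "J a T m = (\<lambda>s. m - s) ` ({1..a div 2} - T)" for a T and m :: nat
  define f where "f a T n = (\<Sum>m\<in>M a \<inter> {..<n}. card {A \<in> odd_sets n. I T m \<subseteq> A \<and> A \<inter> J a T m = {}})" for a T n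
  define TT where "TT a = {T. T \<subseteq> {1..a div 2} \<and> card T = t - 1 - a}" for a
  have lim: "(\<lambda>n. real (f a T n) / main_term n) \<longlonglongrightarrow> moment_int (t - 1 - a) (Suc (a div 2)) / 2"
    if a: "a < t" and T: "T \<in> TT a" for a T
  proof -
    have T': "T \<subseteq> {1..a div 2}" "card T = t - 1 - a" "finite T"
      using T by (auto simp: TT_def intro: finite_subset)
    have le: "s \<le> m" "1 \<le> s" if "m \<in> M a" "s \<in> {1..a div 2}" for m s
      using that by (auto simp: M_def)
    have inj: "inj_on (\<lambda>s. m - s) {1..a div 2}" if "m \<in> M a" for m
    proof (rule inj_onI)
      fix s s' assume "s \<in> {1..a div 2}" "s' \<in> {1..a div 2}" "m - s = m - s'"
      with le[OF that, of s] le[OF that, of s'] show "s = s'" by linarith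
    qed
    have nin: "m \<notin> (\<lambda>s. m - s) ` S" if "m \<in> M a" "S \<subseteq> {1..a div 2}" for m S
    proof
      assume "m \<in> (\<lambda>s. m - s) ` S"
      then obtain s where s: "s \<in> S" "m = m - s" by blast
      then have "s \<in> {1..a div 2}" using that(2) by blast
      from le[OF that(1) this] s(2) show False by linarith
    qed
    have disj: "I T m \<inter> J a T m = {}" if m: "m \<in> M a" for m
    proof -
      have "(\<lambda>s. m - s) ` T \<inter> (\<lambda>s. m - s) ` ({1..a div 2} - T) = {}"
        using inj_on_image_Int[OF inj[OF m] T'(1), of "{1..a div 2} - T"] by auto
      then show ?thesis
        unfolding I_def J_def using nin[OF m, of "{1..a div 2} - T"] by blast
    qed
    have window: "I T m \<union> J a T m \<subseteq> {m - t..m + t}" if "m \<in> M a" for m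
    proof -
      have "a div 2 \<le> t" using a by linarith
      then show ?thesis
        unfolding I_def J_def using T'(1) by fastforce
    qed
    have cI: "card (I T m) = Suc (t - 1 - a)" if m: "m \<in> M a" for m
      unfolding I_def
      using nin[OF m T'(1)] T' card_image[OF inj_on_subset[OF inj[OF m] T'(1)]] by simp
    have cJ: "card (J a T m) = a div 2 - (t - 1 - a)" if m: "m \<in> M a" for m
      unfolding J_def
      using card_image[OF inj_on_subset[OF inj[OF m], of "{1..a div 2} - T"]] T' card_Diff_subset[OF T'(3,1)] by simp
    have "t - 1 - a \<le> a div 2"
      using card_mono[OF _ T'(1)] T'(2) by simp
    then have sum: "Suc (t - 1 - a + (a div 2 - (t - 1 - a))) = Suc (a div 2)" by simp
    have "(\<lambda>n. saddle n * (\<Sum>m\<in>M a \<inter> {..<n}. pattern_weight (saddle n) (I T m) (J a T m)))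
        \<longlonglongrightarrow> moment_int (t - 1 - a) (Suc (t - 1 - a + (a div 2 - (t - 1 - a)))) / 2"
    proof (rule pattern_sum_tendsto[OF disj window cI cJ])
      fix m assume "t \<le> m"
      with a show "m \<in> M a" unfolding M_def by auto
    qed
    then show ?thesis
      unfolding f_def sum
      by (intro pattern_count_tendsto[OF _ disj window]) (simp add: I_def)
  qed
  have b: "b_star t n = (\<Sum>a<t. \<Sum>T\<in>TT a. f a T n)" for n
  proof -
    have "b_star t n = (\<Sum>A\<in>odd_sets n. \<Sum>a<t. \<Sum>T\<in>TT a. card {m \<in> M a. I T m \<subseteq> A \<and> A \<inter> J a T m = {}})"
      unfolding b_star_eq[OF assms]
    proof (intro sum.cong refl)
      fix A a assume "A \<in> odd_sets n"
      then have "finite A" by (simp add: odd_sets_def)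
      have "{m \<in> A. a \<le> 2 * m \<and> card (A \<inter> {m - a div 2..<m}) = t - 1 - a}
        = {m \<in> A. 2 * (a div 2) \<le> 2 * m \<and> a \<le> 2 * m \<and> card (A \<inter> {m - a div 2..<m}) = t - 1 - a}"
        by auto
      then show "card {m \<in> A. a \<le> 2 * m \<and> card (A \<inter> {m - a div 2..<m}) = t - 1 - a}
        = (\<Sum>T\<in>TT a. card {m \<in> M a. I T m \<subseteq> A \<and> A \<inter> J a T m = {}})"
        unfolding TT_def M_def I_def J_def
        using card_window_eq_sum[OF \<open>finite A\<close>, of "a div 2" "\<lambda>m. a \<le> 2 * m" "t - 1 - a"] by simp
    qed
    also have "\<dots> = (\<Sum>a<t. \<Sum>A\<in>odd_sets n. \<Sum>T\<in>TT a. card {m \<in> M a. I T m \<subseteq> A \<and> A \<inter> J a T m = {}})"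
      by (rule sum.swap)
    also have "\<dots> = (\<Sum>a<t. \<Sum>T\<in>TT a. \<Sum>A\<in>odd_sets n. card {m \<in> M a. I T m \<subseteq> A \<and> A \<inter> J a T m = {}})"
      by (intro sum.cong refl sum.swap)
    also have "\<dots> = (\<Sum>a<t. \<Sum>T\<in>TT a. f a T n)"
      unfolding f_def by (intro sum.cong refl sum_card_pattern) (simp add: I_def)
    finally show ?thesis .
  qed
  have "(\<lambda>n. \<Sum>a<t. \<Sum>T\<in>TT a. real (f a T n) / main_term n)
      \<longlonglongrightarrow> (\<Sum>a<t. \<Sum>T\<in>TT a. moment_int (t - 1 - a) (Suc (a div 2)) / 2)"
    by (intro tendsto_sum lim) auto
  moreover have "(\<Sum>a<t. \<Sum>T\<in>TT a. real (f a T n) / main_term n) = real (b_star t n) / main_term n" for n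
    unfolding b by (simp add: sum_divide_distrib)
  moreover have "(\<Sum>a<t. \<Sum>T\<in>TT a. moment_int (t - 1 - a) (Suc (a div 2)) / 2) = hook_const t"
  proof -
    have "card (TT a) = (a div 2) choose (t - 1 - a)" for a
      unfolding TT_def using n_subsets[of "{1..a div 2}" "t - 1 - a"] by simp
    then show ?thesis
      unfolding hook_const_def sum_divide_distrib by simp
  qed
  ultimately show ?thesis by simp
qed

lemma moment_int_nonneg: "0 \<le> moment_int l k"
  by (rule has_integral_nonneg[OF moment_int_has_integral]) auto

text \<open>Needed because convergence of the quotient gives an asymptotic equivalence only for a
  nonzero limit. The term a = t - 1, hooks with empty leg, is already positive.\<close>

lemma hook_const_pos:
  assumes "1 \<le> t"
  shows "0 < hook_const t"
proof -
  define f where "f a = real ((a div 2) choose (t - 1 - a)) * moment_int (t - 1 - a) (Suc (a div 2))" for a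
  have "0 < moment_int 0 (Suc k)" for k
  proof (cases k)
    case 0
    then show ?thesis using moment_int_0_1 by simp
  next
    case (Suc k')
    have "1 / 2 ^ Suc k' < (1::real)" by (simp add: one_less_power del: power_Suc)
    then show ?thesis unfolding Suc moment_int_0 by (simp del: power_Suc)
  qed
  then have "0 < f (t - 1)" using assms by (simp add: f_def)
  moreover have "f (t - 1) \<le> sum f {..<t}"
    by (rule member_le_sum) (use assms moment_int_nonneg in \<open>auto simp: f_def\<close>)
  ultimately show ?thesis by (simp add: hook_const_def f_def)
qed

lemma asymp_equiv_main_term:
  assumes "(\<lambda>n. f n / main_term n) \<longlonglongrightarrow> c" "c \<noteq> 0"
  shows "f \<sim>[at_top] (\<lambda>n. c * main_term n)"
proof (rule asymp_equivI')
  from tendsto_divide[OF assms(1) tendsto_const[of c] assms(2)]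
  show "(\<lambda>n. f n / (c * main_term n)) \<longlonglongrightarrow> 1"
    using assms(2) by (simp add: mult.commute)
qed

theorem theorem1p3:
  shows "(\<forall>t::nat. t \<ge> 1 \<longrightarrow>
      (\<lambda>n::nat. real (a_star t n)) \<sim>[at_top]
      (\<lambda>n. root 4 3 / (2 * pi * root 4 2 * real n powr (1/4)) * exp (pi * sqrt (real n / 6))))
    \<and> (\<exists>\<beta>::nat \<Rightarrow> real.
      (\<forall>t::nat. t \<ge> 1 \<longrightarrow>
        \<beta> t \<in> rat_log2_field
        \<and> (\<lambda>n::nat. real (b_star t n)) \<sim>[at_top]
          (\<lambda>n. \<beta> t * (root 4 3 / (pi * root 4 2 * real n powr (1/4))) * exp (pi * sqrt (real n / 6)))
        \<and> (\<beta> t \<in> \<rat> \<longleftrightarrow> [t = 0] (mod 3)))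
      \<and> (\<forall>t::nat. t \<ge> 2 \<longrightarrow> \<beta> t < 1/2))"
proof (intro conjI exI[of _ hook_const] allI impI)
  fix t :: nat assume t: "1 \<le> t"
  have "(\<lambda>n. real (a_star t n)) \<sim>[at_top] (\<lambda>n. 1 / 2 * main_term n)"
    by (rule asymp_equiv_main_term[OF a_star_tendsto[OF t]]) simp
  also have "(\<lambda>n. 1 / 2 * main_term n)
      = (\<lambda>n. root 4 3 / (2 * pi * root 4 2 * real n powr (1/4)) * exp (pi * sqrt (real n / 6)))"
    by (simp add: main_term_def fun_eq_iff)
  finally show "(\<lambda>n. real (a_star t n)) \<sim>[at_top]
      (\<lambda>n. root 4 3 / (2 * pi * root 4 2 * real n powr (1/4)) * exp (pi * sqrt (real n / 6)))" .
  have "(\<lambda>n. real (b_star t n)) \<sim>[at_top] (\<lambda>n. hook_const t * main_term n)"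
    by (rule asymp_equiv_main_term[OF b_star_tendsto[OF t]]) (use hook_const_pos[OF t] in simp)
  then show "(\<lambda>n. real (b_star t n)) \<sim>[at_top]
      (\<lambda>n. hook_const t * (root 4 3 / (pi * root 4 2 * real n powr (1/4))) * exp (pi * sqrt (real n / 6)))"
    by (simp only: main_term_def mult.assoc)
  show "hook_const t \<in> rat_log2_field" by (rule hook_const_in_rat_log2_field)
  show "hook_const t \<in> \<rat> \<longleftrightarrow> [t = 0] (mod 3)" by (rule hook_const_rational_iff)
next
  fix t :: nat
  show "hook_const t < 1 / 2" by (rule hook_const_less_half)
qed

end
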